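(* Let $n\ge 1$, let $c^B$ be a Coxeter element of $B_n$ and let $c^A=\eta(c^B)$. With the notation of the context, the map $\mathcal U_{c^B}\circ\Pi_{c^B}$ from $\mathrm{Aff}(c^B)$ to $\mathbb R^{H^B}\cong\mathbb R^{n^2}$ is a unimodular transformation such that, for all vertices $X(\eta(v))$ of $\mathrm{Birk}(c^B)$ (where $v$ ranges over the $c^B$-singletons in $B_n$), $$\mathcal U_{c^B}\circ\Pi_{c^B}\,(X(\eta(v)))=o(f^B(v)).$$ In particular, $\mathrm{Birk}(c^B)$ is integrally equivalent to the order polytope $\mathcal O(H^B)$, where $H^B$ is the heap of the $c^B$-sorting word of the longest element of $B_n$.
   Context: **Groups.** $A_{2n-1}=S_{2n}$ is the symmetric group on $\{1,\dots,2n\}$ with simple reflections $s^A_k=(k\ \ k{+}1)$, $1\le k\le 2n-1$. $B_n$ is the group of permutations $v$ of $\{-n,\dots,-1,1,\dots,n\}$ with $v(-k)=-v(k)$, with simple reflections $s^B_0=(-1\ \ 1)$ and $s^B_k=(-k{-}1\ \ {-k})(k\ \ k{+}1)$, $1\le k\le n-1$. Products are composed right to left. In each group, distinct $s_i,s_j$ commute iff $|i-j|>1$. A Coxeter element is a product of all simple reflections, each exactly once, in some order. Reduced words are written as sequences of indices; a commutation move swaps two adjacent letters $i,j$ with $|i-j|>1$; the commutation class of a reduced word is the set of words reachable by commutation moves. The longest elements are $w_0^A$ (length $\binom{2n}{2}$) and $w_0^B$ (length $n^2$). **Unfolding.** $\eta:B_n\to A_{2n-1}$ is the injective homomorphism $\eta(s^B_0)=s^A_n$,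 $\eta(s^B_i)=s^A_{n+i}s^A_{n-i}$ for $i>0$. Equivalently $\eta(v)=\theta v\theta^{-1}$, where $\theta:\{-n,\dots,-1,1,\dots,n\}\to\{1,\dots,2n\}$ is the order-preserving bijection. The element $c^A=\eta(c^B)$ is a Coxeter element of $A_{2n-1}$. **Sorting words, singletons.** Fix a reduced word of $c$. The $c$-sorting word $\mathrm{sort}_c(w)$ is the lexicographically first (as a sequence of positions) subword of $c^\infty=c\,c\,c\cdots$ that is a reduced word for $w$. An element $w$ is a $c$-singleton if some reduced word of $w$ is a prefix of a word in the commutation class of $\mathrm{sort}_c(w_0)$. **Heaps.** For a reduced word $a_1\cdots a_\ell$, its heap is the poset on $\{1,\dots,\ell\}$ given by the transitive closure of $x\prec y$ whenever $x<y$ and $|a_x-a_y|\le1$; element $x$ has label $a_x$. Put $H^A=\mathrm{Heap}(\mathrm{sort}_{c^A}(w_0^A))$ and $H^B=\mathrm{Heap}(\mathrm{sort}_{c^B}(w_0^B))$. For a $c^A$-singleton $w$ (resp. $c^B$-singleton $v$), $f^A(w)$ (resp. $f^B(v)$) is the unique order ideal $I$ of $H^A$ (resp. $H^B$) such that the subword of $\mathrm{sort}_c(w_0)$ at the positions in $I$ is a reduced word of that element; $f^A$ and $f^B$ are isomorphisms from the poset of $c$-singletons (right weak order) to the lattice of order ideals. Write $o(I)$ for the indicator vector of $I$ (in $\mathbb R^{H^A}$ or $\mathbb R^{H^B}$). The order polytope $\mathcal O(H)$ is the convex hull of all $o(I)$, $I$ an order ideal of $H$. **Polytopes.** $X(w)$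 is the $2n\times2n$ permutation matrix with $1$'s in positions $(i,w(i))$. $\mathrm{Birk}(c^A)$ is the convex hull of all $X(w)$, $w$ a $c^A$-singleton; $\mathrm{Birk}(c^B)$ is the convex hull of all $X(\eta(v))$, $v$ a $c^B$-singleton in $B_n$. $\mathrm{Aff}(c^A)$ and $\mathrm{Aff}(c^B)$ are their affine hulls; $\mathrm{Aff}(c^B)\subseteq\mathrm{Aff}(c^A)$. **The map $\Pi_{c^B}$.** For $2\le i\le 2n-1$, call $i$ lower-barred if $s^A_i$ appears after $s^A_{i-1}$ in reduced words of $c^A$, and upper-barred otherwise. $\Pi_{c^B}$ is the coordinate projection from real $2n\times 2n$ matrices to $\mathbb R^{n^2}$ recording (in some fixed order) the entries in positions $(i,j)$ with $1\le i\le n$, $i<j\le 2n$, except those positions $(i,u)$ with $u$ upper-barred and $i\le\min(u-1,2n-u)$. It is injective on $\mathrm{Aff}(c^B)$. **The map $\mathcal U_{c^B}$.** By earlier work on type $A$ there is a (necessarily unique) affine map $\Psi_A:\mathrm{Aff}(c^A)\to\mathbb R^{H^A}$ with $\Psi_A(X(w))=o(f^A(w))$ for all $c^A$-singletons $w$, and it is a unimodular transformation. Let $P:\mathbb R^{H^A}\to\mathbb R^{H^B}$ be the linear map with $P(\mathbf e_x)=\mathbf 0$ if $x$ has label $<n$, and $P(\mathbf e_x)=\mathbf e_y$ if $x$ is the $k$-th occurrence of label $n+i$ ($i\ge0$) in $H^A$ and $y$ is the $k$-th occurrence of label $i$ in $H^B$ (elements with a common label form a chain; this correspondence is an isomorphism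 from the subposet of $H^A$ of elements with labels $\ge n$ onto $H^B$). Define $\mathcal U_{c^B}:\Pi_{c^B}(\mathrm{Aff}(c^B))\to\mathbb R^{H^B}$ by $\mathcal U_{c^B}(\Pi_{c^B}(X))=P(\Psi_A(X))$ for $X\in\mathrm{Aff}(c^B)$. **Unimodular transformation, integral equivalence.** An affine map $T$ from an affine subspace $V\subseteq\mathbb R^m$ to $\mathbb R^k$ is a unimodular transformation if it is injective and restricts to a bijection from $V\cap\mathbb Z^m$ onto $T(V)\cap\mathbb Z^k$. Lattice polytopes $Q\subseteq\mathbb R^m$ and $R\subseteq\mathbb R^k$ are integrally equivalent if there is a unimodular transformation defined on the affine hull of $Q$ that maps $Q$ onto $R$. *)

theory Defs
  imports
    "HOL-Analysis.Convex"
    "HOL-Combinatorics.Permutations"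
    "HOL-Library.Function_Algebras"
begin

section \<open>Coordinate spaces, unimodular transformations, integral equivalence\<close>

text \<open>
  The dimensions depend on the variable \<open>n\<close>. A vector with coordinates indexed by a finite set \<open>S\<close>
  is therefore a function that vanishes outside \<open>S\<close>, and functions carry the pointwise vector space
  structure, so that the library's \<open>affine\<close>, \<open>affine hull\<close> and \<open>convex hull\<close> apply.
\<close>

instantiation "fun" :: (type, real_vector) real_vector
begin

definition scaleR_fun :: "real \<Rightarrow> ('a \<Rightarrow> 'b) \<Rightarrow> 'a \<Rightarrow> 'b" where
  "scaleR_fun r f = (\<lambda>x. r *\<^sub>R f x)"

instance
  by standard (simp_all add: scaleR_fun_def fun_eq_iff scaleR_add_right scaleR_add_left)

end

definition coord_space :: "'i set \<Rightarrow> ('i \<Rightarrow> real) set" where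
  "coord_space S = {x. \<forall>i. i \<notin> S \<longrightarrow> x i = 0}"

definition integer_points :: "('i \<Rightarrow> real) set" where
  "integer_points = {x. \<forall>i. x i \<in> \<int>}"

definition affine_map_on :: "'a::real_vector set \<Rightarrow> ('a \<Rightarrow> 'b::real_vector) \<Rightarrow> bool" where
  "affine_map_on V T \<longleftrightarrow>
     (\<forall>x\<in>V. \<forall>y\<in>V. \<forall>a b. a + b = 1 \<longrightarrow> T (a *\<^sub>R x + b *\<^sub>R y) = a *\<^sub>R T x + b *\<^sub>R T y)"

definition unimodular_transformation ::
  "('i \<Rightarrow> real) set \<Rightarrow> (('i \<Rightarrow> real) \<Rightarrow> 'k \<Rightarrow> real) \<Rightarrow> bool" where
  "unimodular_transformation V T \<longleftrightarrow>
     affine V \<and> affine_map_on V T \<and> inj_on T V \<and>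
     bij_betw T (V \<inter> integer_points) (T ` V \<inter> integer_points)"

definition lattice_polytope :: "('i \<Rightarrow> real) set \<Rightarrow> bool" where
  "lattice_polytope Q \<longleftrightarrow> (\<exists>F. finite F \<and> F \<subseteq> integer_points \<and> Q = convex hull F)"

definition integrally_equivalent :: "('i \<Rightarrow> real) set \<Rightarrow> ('k \<Rightarrow> real) set \<Rightarrow> bool" where
  "integrally_equivalent Q R \<longleftrightarrow>
     lattice_polytope Q \<and> lattice_polytope R \<and>
     (\<exists>T. unimodular_transformation (affine hull Q) T \<and> T ` Q = R)"


section \<open>Words, Coxeter elements, sorting words, singletons\<close>

text \<open>
  A group of permutations is given by its simple reflections \<open>s i\<close>, for \<open>i\<close> in an index set \<open>J\<close>;
  words are lists of indices, and products are composed right to left.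
\<close>

definition word_prod :: "(nat \<Rightarrow> 'a \<Rightarrow> 'a) \<Rightarrow> nat list \<Rightarrow> 'a \<Rightarrow> 'a" where
  "word_prod s ws = foldr (\<lambda>i g. s i \<circ> g) ws id"

definition cox_length :: "(nat \<Rightarrow> 'a \<Rightarrow> 'a) \<Rightarrow> nat set \<Rightarrow> ('a \<Rightarrow> 'a) \<Rightarrow> nat" where
  "cox_length s J w = (LEAST k. \<exists>ws. set ws \<subseteq> J \<and> length ws = k \<and> word_prod s ws = w)"

definition reduced_word :: "(nat \<Rightarrow> 'a \<Rightarrow> 'a) \<Rightarrow> nat set \<Rightarrow> nat list \<Rightarrow> ('a \<Rightarrow> 'a) \<Rightarrow> bool" where
  "reduced_word s J ws w \<longleftrightarrow>
     set ws \<subseteq> J \<and> word_prod s ws = w \<and> length ws = cox_length s J w"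

definition coxeter_element :: "(nat \<Rightarrow> 'a \<Rightarrow> 'a) \<Rightarrow> nat set \<Rightarrow> ('a \<Rightarrow> 'a) \<Rightarrow> bool" where
  "coxeter_element s J c \<longleftrightarrow> (\<exists>cs. distinct cs \<and> set cs = J \<and> word_prod s cs = c)"

definition longest_element ::
  "(nat \<Rightarrow> 'a \<Rightarrow> 'a) \<Rightarrow> nat set \<Rightarrow> ('a \<Rightarrow> 'a) set \<Rightarrow> 'a \<Rightarrow> 'a" where
  "longest_element s J W = (THE w. w \<in> W \<and> (\<forall>u\<in>W. cox_length s J u \<le> cox_length s J w))"

text \<open>The letter at position \<open>p\<close> (counted from 0) of the infinite word \<open>cs cs cs \<dots>\<close>.\<close>

definition inf_letter :: "nat list \<Rightarrow> nat \<Rightarrow> nat" where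
  "inf_letter cs p = cs ! (p mod length cs)"

definition reduced_subword ::
  "(nat \<Rightarrow> 'a \<Rightarrow> 'a) \<Rightarrow> nat set \<Rightarrow> nat list \<Rightarrow> ('a \<Rightarrow> 'a) \<Rightarrow> nat list \<Rightarrow> bool" where
  "reduced_subword s J cs w ps \<longleftrightarrow>
     sorted_wrt (<) ps \<and> reduced_word s J (map (inf_letter cs) ps) w"

definition sort_positions ::
  "(nat \<Rightarrow> 'a \<Rightarrow> 'a) \<Rightarrow> nat set \<Rightarrow> nat list \<Rightarrow> ('a \<Rightarrow> 'a) \<Rightarrow> nat list" where
  "sort_positions s J cs w =
     (THE ps. reduced_subword s J cs w ps \<and>
        (\<forall>qs. reduced_subword s J cs w qs \<longrightarrow> qs = ps \<or> (ps, qs) \<in> lexord less_than))"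

definition sort_word ::
  "(nat \<Rightarrow> 'a \<Rightarrow> 'a) \<Rightarrow> nat set \<Rightarrow> nat list \<Rightarrow> ('a \<Rightarrow> 'a) \<Rightarrow> nat list" where
  "sort_word s J cs w = map (inf_letter cs) (sort_positions s J cs w)"

definition commutation_move :: "nat list \<Rightarrow> nat list \<Rightarrow> bool" where
  "commutation_move ws ws' \<longleftrightarrow>
     (\<exists>us vs i j. \<bar>int i - int j\<bar> > 1 \<and> ws = us @ [i, j] @ vs \<and> ws' = us @ [j, i] @ vs)"

definition commutation_class :: "nat list \<Rightarrow> nat list set" where
  "commutation_class ws = {ws'. (ws, ws') \<in> {(us, vs). commutation_move us vs}\<^sup>*}"

text \<open>Here \<open>sw\<close> is to be the sorting word of the longest element.\<close>

definition singletons ::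
  "(nat \<Rightarrow> 'a \<Rightarrow> 'a) \<Rightarrow> nat set \<Rightarrow> nat list \<Rightarrow> ('a \<Rightarrow> 'a) set" where
  "singletons s J sw =
     {w. \<exists>us vs. reduced_word s J us w \<and> us @ vs \<in> commutation_class sw}"


section \<open>Heaps and order polytopes\<close>

text \<open>Heap elements are the positions \<open>0, \<dots>, length ws - 1\<close>; position \<open>x\<close> has label \<open>ws ! x\<close>.\<close>

definition heap_less :: "nat list \<Rightarrow> (nat \<times> nat) set" where
  "heap_less ws =
     {(x, y). x < y \<and> y < length ws \<and> \<bar>int (ws ! x) - int (ws ! y)\<bar> \<le> 1}\<^sup>+"

definition order_ideal :: "nat list \<Rightarrow> nat set \<Rightarrow> bool" where
  "order_ideal ws I \<longleftrightarrow>
     I \<subseteq> {..<length ws} \<and> (\<forall>x y. y \<in> I \<and> (x, y) \<in> heap_less ws \<longrightarrow> x \<in> I)"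

definition ideal_of ::
  "(nat \<Rightarrow> 'a \<Rightarrow> 'a) \<Rightarrow> nat set \<Rightarrow> nat list \<Rightarrow> ('a \<Rightarrow> 'a) \<Rightarrow> nat set" where
  "ideal_of s J sw w = (THE I. order_ideal sw I \<and> reduced_word s J (nths sw I) w)"

definition ideal_vector :: "nat set \<Rightarrow> nat \<Rightarrow> real" where
  "ideal_vector I = (\<lambda>x. if x \<in> I then 1 else 0)"

definition order_polytope :: "nat list \<Rightarrow> (nat \<Rightarrow> real) set" where
  "order_polytope ws = convex hull {ideal_vector I | I. order_ideal ws I}"

definition occurrence :: "nat list \<Rightarrow> nat \<Rightarrow> nat" where
  "occurrence ws x = card {x'. x' \<le> x \<and> ws ! x' = ws ! x}"


section \<open>Types A and B, and unfolding\<close>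

definition sA :: "nat \<Rightarrow> nat \<Rightarrow> nat" where
  "sA k = Transposition.transpose k (k + 1)"

definition sB :: "nat \<Rightarrow> int \<Rightarrow> int" where
  "sB k = (if k = 0 then Transposition.transpose (-1) 1
           else Transposition.transpose (- int k - 1) (- int k) \<circ>
                Transposition.transpose (int k) (int k + 1))"

definition JA :: "nat \<Rightarrow> nat set" where
  "JA n = {1..2 * n - 1}"

definition JB :: "nat \<Rightarrow> nat set" where
  "JB n = {..<n}"

definition groupA :: "nat \<Rightarrow> (nat \<Rightarrow> nat) set" where
  "groupA n = {w. w permutes {1..2 * n}}"

definition signed_set :: "nat \<Rightarrow> int set" where
  "signed_set n = {- int n..int n} - {0}"

definition groupB :: "nat \<Rightarrow> (int \<Rightarrow> int) set" where
  "groupB n = {v. v permutes signed_set n \<and> (\<forall>k. v (- k) = - v k)}"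

text \<open>The order-preserving bijection from \<open>{-n, \<dots>, -1, 1, \<dots>, n}\<close> to \<open>{1, \<dots>, 2n}\<close>.\<close>

definition theta :: "nat \<Rightarrow> int \<Rightarrow> nat" where
  "theta n k = nat (if k < 0 then int n + 1 + k else int n + k)"

definition eta :: "nat \<Rightarrow> (int \<Rightarrow> int) \<Rightarrow> nat \<Rightarrow> nat" where
  "eta n v = map_permutation (signed_set n) (theta n) v"

lemma inj_on_theta: "inj_on (theta n) (signed_set n)"
  by (auto simp: inj_on_def theta_def signed_set_def split: if_splits)

lemma theta_image: "theta n ` signed_set n = {1..2 * n}"
proof
  show "theta n ` signed_set n \<subseteq> {1..2 * n}"
    by (auto simp: theta_def signed_set_def split: if_splits)
  show "{1..2 * n} \<subseteq> theta n ` signed_set n"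
  proof
    fix j assume j: "j \<in> {1..2 * n}"
    define k where "k = (if j \<le> n then int j - int n - 1 else int j - int n)"
    have "theta n k = j" "k \<in> signed_set n"
      using j by (auto simp: theta_def signed_set_def k_def)
    then show "j \<in> theta n ` signed_set n" by blast
  qed
qed

lemma eta_theta:
  assumes "k \<in> signed_set n"
  shows "eta n v (theta n k) = theta n (v k)"
  using assms inj_on_theta[of n]
  by (simp add: eta_def map_permutation_def restrict_id_def)

lemma eta_outside:
  assumes "j \<notin> {1..2 * n}"
  shows "eta n v j = j"
  unfolding eta_def map_permutation_def restrict_id_def theta_image using assms by auto

lemma eta_eqI:
  assumes "\<And>k. k \<in> signed_set n \<Longrightarrow> theta n (v k) = w (theta n k)"
    and "\<And>j. j \<notin> {1..2 * n} \<Longrightarrow> w j = j"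
  shows "eta n v = w"
proof
  fix j
  show "eta n v j = w j"
  proof (cases "j \<in> {1..2 * n}")
    case True
    then obtain k where "k \<in> signed_set n" "j = theta n k"
      using theta_image by blast
    then show ?thesis using assms(1) eta_theta by simp
  qed (simp add: eta_outside assms(2))
qed

text \<open>\<open>eta\<close> has the prescribed values on the simple reflections.\<close>

lemma eta_sB_0:
  assumes "n \<ge> 1"
  shows "eta n (sB 0) = sA n"
proof (rule eta_eqI)
  fix k assume "k \<in> signed_set n"
  then consider "k = -1" | "k = 1" | "k < -1" "- int n \<le> k" | "k > 1"
    unfolding signed_set_def by fastforce
  then show "theta n (sB 0 k) = sA n (theta n k)"
    by cases (use assms in \<open>auto simp: sB_def sA_def theta_def Transposition.transpose_def nat_add_distrib\<close>)
qed (use assms in \<open>auto simp: sA_def Transposition.transpose_def\<close>)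

lemma eta_sB:
  assumes "1 \<le> i" "i < n"
  shows "eta n (sB i) = sA (n + i) \<circ> sA (n - i)"
proof (rule eta_eqI)
  fix k assume k: "k \<in> signed_set n"
  have sA_eq: "sA (n + i) (sA (n - i) j) =
      (if j = n - i then n - i + 1 else if j = n - i + 1 then n - i
       else if j = n + i then n + i + 1 else if j = n + i + 1 then n + i else j)" for j
  proof -
    obtain m where "n = m + i" "m \<ge> 1"
      using assms by (metis add.commute le_add_diff_inverse less_imp_le_nat zero_less_diff less_one not_less)
    then show ?thesis
      using assms(1) by (simp add: sA_def Transposition.transpose_def)
  qed
  have sB_eq: "sB i l =
      (if l = - int i - 1 then - int i else if l = - int i then - int i - 1
       else if l = int i then int i + 1 else if l = int i + 1 then int i else l)" for l
    using assms by (simp add: sB_def Transposition.transpose_def)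
  consider "k = - int i - 1" | "k = - int i" | "k = int i" | "k = int i + 1"
    | (neg) "k < 0" "- int n \<le> k" "k \<noteq> - int i - 1" "k \<noteq> - int i"
    | (pos) "k > 0" "k \<noteq> int i" "k \<noteq> int i + 1"
    using k unfolding signed_set_def by fastforce
  then show "theta n (sB i k) = (sA (n + i) \<circ> sA (n - i)) (theta n k)"
  proof cases
    case neg
    then have "theta n k \<le> n" "theta n k \<noteq> n - i" "theta n k \<noteq> n - i + 1"
      using assms by (auto simp: theta_def)
    then show ?thesis
      using neg assms by (simp add: sA_eq sB_eq)
  next
    case pos
    then have "theta n k > n" "theta n k \<noteq> n + i" "theta n k \<noteq> n + i + 1"
      using assms by (auto simp: theta_def)
    moreover from this(1) have "theta n k \<noteq> n - i" "theta n k \<noteq> n - i + 1"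
      using assms by linarith+
    ultimately show ?thesis
      using pos assms by (simp add: sA_eq sB_eq)
  qed (use assms in \<open>auto simp: sA_eq sB_eq theta_def nat_diff_distrib nat_add_distrib\<close>)
qed (use assms in \<open>auto simp: sA_def Transposition.transpose_def\<close>)

text \<open>In the following, \<open>csA\<close> and \<open>csB\<close> are the fixed reduced words of the Coxeter elements.\<close>

definition sortA :: "nat \<Rightarrow> nat list \<Rightarrow> nat list" where
  "sortA n csA = sort_word sA (JA n) csA (longest_element sA (JA n) (groupA n))"

definition sortB :: "nat \<Rightarrow> nat list \<Rightarrow> nat list" where
  "sortB n csB = sort_word sB (JB n) csB (longest_element sB (JB n) (groupB n))"

definition singletonsA :: "nat \<Rightarrow> nat list \<Rightarrow> (nat \<Rightarrow> nat) set" where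
  "singletonsA n csA = singletons sA (JA n) (sortA n csA)"

definition singletonsB :: "nat \<Rightarrow> nat list \<Rightarrow> (int \<Rightarrow> int) set" where
  "singletonsB n csB = singletons sB (JB n) (sortB n csB)"

definition fA :: "nat \<Rightarrow> nat list \<Rightarrow> (nat \<Rightarrow> nat) \<Rightarrow> nat set" where
  "fA n csA w = ideal_of sA (JA n) (sortA n csA) w"

definition fB :: "nat \<Rightarrow> nat list \<Rightarrow> (int \<Rightarrow> int) \<Rightarrow> nat set" where
  "fB n csB v = ideal_of sB (JB n) (sortB n csB) v"


section \<open>The polytopes and the maps\<close>

definition perm_matrix :: "nat \<Rightarrow> (nat \<Rightarrow> nat) \<Rightarrow> nat \<times> nat \<Rightarrow> real" where
  "perm_matrix n w = (\<lambda>(i, j). if i \<in> {1..2 * n} \<and> j = w i then 1 else 0)"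

definition BirkA :: "nat \<Rightarrow> nat list \<Rightarrow> (nat \<times> nat \<Rightarrow> real) set" where
  "BirkA n csA = convex hull (perm_matrix n ` singletonsA n csA)"

definition BirkB :: "nat \<Rightarrow> nat list \<Rightarrow> (nat \<times> nat \<Rightarrow> real) set" where
  "BirkB n csB = convex hull ((\<lambda>v. perm_matrix n (eta n v)) ` singletonsB n csB)"

definition AffA :: "nat \<Rightarrow> nat list \<Rightarrow> (nat \<times> nat \<Rightarrow> real) set" where
  "AffA n csA = affine hull (BirkA n csA)"

definition AffB :: "nat \<Rightarrow> nat list \<Rightarrow> (nat \<times> nat \<Rightarrow> real) set" where
  "AffB n csB = affine hull (BirkB n csB)"

definition lower_barred :: "nat list \<Rightarrow> nat \<Rightarrow> bool" where
  "lower_barred csA i \<longleftrightarrow>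
     (\<exists>p q. p < q \<and> q < length csA \<and> csA ! p = i - 1 \<and> csA ! q = i)"

definition upper_barred :: "nat \<Rightarrow> nat list \<Rightarrow> nat \<Rightarrow> bool" where
  "upper_barred n csA i \<longleftrightarrow> 2 \<le> i \<and> i \<le> 2 * n - 1 \<and> \<not> lower_barred csA i"

text \<open>The positions recorded by \<open>Pi_map\<close>, row by row; there are \<open>n\<^sup>2\<close> of them.\<close>

definition recorded :: "nat \<Rightarrow> nat list \<Rightarrow> (nat \<times> nat) list" where
  "recorded n csA =
     [(i, j). i \<leftarrow> [1..<n + 1], j \<leftarrow> [i + 1..<2 * n + 1],
              \<not> (upper_barred n csA j \<and> i \<le> min (j - 1) (2 * n - j))]"

definition Pi_map :: "nat \<Rightarrow> nat list \<Rightarrow> (nat \<times> nat \<Rightarrow> real) \<Rightarrow> nat \<Rightarrow> real" where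
  "Pi_map n csA X =
     (\<lambda>k. if k < length (recorded n csA) then X (recorded n csA ! k) else 0)"

text \<open>
  The affine map on \<open>AffA n csA\<close> that interpolates the indicator vectors of the ideals; these
  conditions determine its values on \<open>AffA n csA\<close>, and only those values are used.
\<close>

definition Psi_A :: "nat \<Rightarrow> nat list \<Rightarrow> (nat \<times> nat \<Rightarrow> real) \<Rightarrow> nat \<Rightarrow> real" where
  "Psi_A n csA =
     (SOME Psi. affine_map_on (AffA n csA) Psi \<and>
        (\<forall>w\<in>singletonsA n csA. Psi (perm_matrix n w) = ideal_vector (fA n csA w)))"

text \<open>The coordinate at \<open>y\<close> collects the coordinate at the element \<open>x\<close> corresponding to \<open>y\<close>.\<close>

definition P_map :: "nat \<Rightarrow> nat list \<Rightarrow> nat list \<Rightarrow> (nat \<Rightarrow> real) \<Rightarrow> nat \<Rightarrow> real" where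
  "P_map n csA csB z =
     (let a = sortA n csA; b = sortB n csB in
      (\<lambda>y. if y < length b
           then \<Sum>x | x < length a \<and> a ! x = n + b ! y \<and> occurrence a x = occurrence b y. z x
           else 0))"

definition U_map :: "nat \<Rightarrow> nat list \<Rightarrow> nat list \<Rightarrow> (nat \<Rightarrow> real) \<Rightarrow> nat \<Rightarrow> real" where
  "U_map n csA csB y =
     P_map n csA csB (Psi_A n csA (the_inv_into (AffB n csB) (Pi_map n csA) y))"

end

theory Submission
  imports Defs
begin

text \<open>
  Adding a heap element with label \<open>i\<close> to an ideal changes the permutation matrix by
  \<open>(e_i - e_(i+1)) \<otimes> (e_b - e_a)\<close>, where \<open>a, b\<close> are the values at the places \<open>i, i + 1\<close>, and
  these depend on the heap element only. Hence the matrix of a singleton is an affine function of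
  the indicator vector of its ideal, and everything reduces to inverting this function over the
  integers.

  Because \<open>cA\<close> is invariant under the diagram automorphism, \<open>cA^n\<close> and \<open>cB^n\<close> are the longest
  elements and both words are reduced, so the sorting words are literally the \<open>n\<close>-th powers of the
  given words. The values \<open>a, b\<close> then have a closed form: each value \<open>j\<close> follows a billiard path
  determined by a phase modulo \<open>2n\<close>, and the values at the \<open>k\<close>-th letter \<open>i\<close> have phases
  \<open>k - u_i\<close> and \<open>k + l_i + 1\<close>, where \<open>l_i\<close> and \<open>u_i\<close> count the lower- and upper-barred numbers up to
  \<open>i\<close>. With these the partial sums of the first \<open>i\<close> rows form a triangular system with diagonal
  entries \<open>1\<close> or \<open>-1\<close> for the coordinates with label \<open>i\<close>. For \<open>i \<le> n\<close> the entries of row \<open>i\<close> that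
  this system uses are exactly those recorded by \<open>Pi_map\<close>.
\<close>

section \<open>Words and heaps\<close>

text \<open>Phases number the cycle of the Coxeter element of type A: from 1 it ascends through the
  lower-barred numbers to 2n and descends through the upper-barred ones, and multiplication by it
  adds 1 to each phase. Symmetry puts n - 1 numbers on either side, so 2n lies opposite 1, and n
  rounds are a half turn, which reverses all places. Ideals, prefixes and commutation classes are
  compared by counting letters. \<open>fire\<close> says locally that the next copy of a letter is
  minimal in what remains of the heap of n rounds. This survives commutation moves, restriction to
  ideals and unfolding, and along admissible words the group element and the letter counts determine
  each other. Reducedness comes from comparing the number of letters with the length of the longest
  element. The length of type B has to be pulled back along \<open>eta\<close>, where inversions
  count most contributions twice but those on the symmetry axis once. \<open>Psi_A\<close> is given
  by choice, so a solution of its defining conditions must be exhibited. The inverse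
  \<open>coord\<close> of the triangular system is one, and affine maps that agree on generators of
  an affine hull agree on it.\<close>

lemma word_prod_Nil [simp]: "word_prod s [] = id"
  by (simp add: word_prod_def)

lemma word_prod_Cons [simp]: "word_prod s (i # ws) = s i \<circ> word_prod s ws"
  by (simp add: word_prod_def)

lemma word_prod_append [simp]: "word_prod s (us @ vs) = word_prod s us \<circ> word_prod s vs"
  by (induction us) (simp_all add: comp_assoc)

lemma commutation_class_refl: "ws \<in> commutation_class ws"
  by (simp add: commutation_class_def)

lemma commutation_class_trans:
  "vs \<in> commutation_class us \<Longrightarrow> ws \<in> commutation_class vs \<Longrightarrow> ws \<in> commutation_class us"
  by (auto simp: commutation_class_def)

lemma commutation_class_invariant [consumes 1, case_names base move]:
  assumes "ws' \<in> commutation_class ws" and "P ws"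
    and "\<And>us vs i j. \<bar>int i - int j\<bar> > 1 \<Longrightarrow> P (us @ [i, j] @ vs) \<Longrightarrow> P (us @ [j, i] @ vs)"
  shows "P ws'"
proof -
  have "(ws, ws') \<in> {(us, vs). commutation_move us vs}\<^sup>*"
    using assms(1) by (simp add: commutation_class_def)
  then show ?thesis
  proof (induction rule: rtrancl_induct)
    case (step y z)
    then show ?case using assms(3) unfolding commutation_move_def by blast
  qed (rule assms(2))
qed

lemma commutation_class_context:
  assumes "ws' \<in> commutation_class ws"
  shows "us @ ws' @ vs \<in> commutation_class (us @ ws @ vs)"
  using assms
proof (induction rule: commutation_class_invariant)
  case (move us' vs' i j)
  have "commutation_move (us @ (us' @ [i, j] @ vs') @ vs) (us @ (us' @ [j, i] @ vs') @ vs)"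
    unfolding commutation_move_def using move(1)
    by (intro exI[of _ "us @ us'"] exI[of _ "vs' @ vs"] exI[of _ i] exI[of _ j]) simp
  then show ?case
    using move(2) by (auto simp: commutation_class_def intro: rtrancl_into_rtrancl)
qed (rule commutation_class_refl)

lemma commutation_class_letter:
  assumes "\<And>y. y \<in> set ys \<Longrightarrow> \<bar>int i - int y\<bar> > 1"
  shows "ys @ [i] \<in> commutation_class (i # ys)"
  using assms
proof (induction ys)
  case (Cons y ys)
  have "commutation_move ([] @ [i, y] @ ys) ([] @ [y, i] @ ys)"
    unfolding commutation_move_def using Cons.prems by fastforce
  then have "y # i # ys \<in> commutation_class (i # y # ys)"
    by (auto simp: commutation_class_def)
  moreover have "[y] @ (ys @ [i]) @ [] \<in> commutation_class ([y] @ (i # ys) @ [])"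
    by (rule commutation_class_context, rule Cons.IH) (use Cons.prems in auto)
  ultimately show ?case
    by (auto intro: commutation_class_trans)
qed (simp add: commutation_class_refl)

text \<open>The heap order is a transitive closure, so being closed under its generating relation is
  enough; this removes \<open>heap_less\<close> from later arguments.\<close>

lemma order_ideal_iff:
  "order_ideal ws I \<longleftrightarrow> I \<subseteq> {..<length ws} \<and>
     (\<forall>x y. y \<in> I \<and> x < y \<and> \<bar>int (ws ! x) - int (ws ! y)\<bar> \<le> 1 \<longrightarrow> x \<in> I)" (is "_ \<longleftrightarrow> ?R")
proof
  assume o: "order_ideal ws I"
  show ?R
  proof (intro conjI allI impI)
    fix x y assume "y \<in> I \<and> x < y \<and> \<bar>int (ws ! x) - int (ws ! y)\<bar> \<le> 1"
    moreover from this have "(x, y) \<in> heap_less ws"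
      using o unfolding heap_less_def order_ideal_def by blast
    ultimately show "x \<in> I"
      using o unfolding order_ideal_def by blast
  qed (use o in \<open>simp add: order_ideal_def\<close>)
next
  assume r: ?R
  have "y \<in> I \<longrightarrow> x \<in> I" if "(x, y) \<in> heap_less ws" for x y
    using that unfolding heap_less_def
    by (induction rule: trancl_induct) (use r in blast)+
  then show "order_ideal ws I"
    using r by (auto simp: order_ideal_def)
qed

lemma order_idealD:
  "order_ideal ws I \<Longrightarrow> y \<in> I \<Longrightarrow> x < y \<Longrightarrow> \<bar>int (ws ! x) - int (ws ! y)\<bar> \<le> 1 \<Longrightarrow> x \<in> I"
  by (auto simp: order_ideal_iff)

lemma order_ideal_Suc:
  assumes "order_ideal (a # ws) I"
  shows "order_ideal ws {x. Suc x \<in> I}"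
  using assms unfolding order_ideal_iff
  by (auto) (metis (no_types, lifting) Suc_less_eq nth_Cons_Suc)

text \<open>The letters of the ideal are moved to the front. A leading letter outside the ideal
  commutes with all selected letters, since otherwise it would lie below one of them.\<close>

lemma nths_ideal_commutation_class:
  assumes "order_ideal ws I"
  shows "nths ws I @ nths ws (- I) \<in> commutation_class ws"
  using assms
proof (induction ws arbitrary: I)
  case (Cons a ws)
  define I' where "I' = {x. Suc x \<in> I}"
  have I': "order_ideal ws I'"
    unfolding I'_def by (rule order_ideal_Suc[OF Cons.prems])
  have eq: "nths (a # ws) I = (if 0 \<in> I then [a] else []) @ nths ws I'"
    "nths (a # ws) (- I) = (if 0 \<in> I then [] else [a]) @ nths ws (- I')"
    by (simp_all add: nths_Cons I'_def Compl_eq)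
  have IH: "[a] @ (nths ws I' @ nths ws (- I')) @ [] \<in> commutation_class ([a] @ ws @ [])"
    by (rule commutation_class_context[OF Cons.IH[OF I']])
  show ?case
  proof (cases "0 \<in> I")
    case True
    then show ?thesis using IH by (simp add: eq)
  next
    case False
    have "\<bar>int a - int y\<bar> > 1" if y: "y \<in> set (nths ws I')" for y
    proof (rule ccontr)
      assume n: "\<not> \<bar>int a - int y\<bar> > 1"
      obtain x where x: "x < length ws" "Suc x \<in> I" "y = ws ! x"
        using y by (auto simp: set_nths I'_def)
      have "0 \<in> I"
        using Cons.prems x n unfolding order_ideal_iff
        by (metis linorder_not_less nth_Cons_0 nth_Cons_Suc zero_less_Suc)
      with False show False by simp
    qed
    then have "[] @ (nths ws I' @ [a]) @ nths ws (- I')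
        \<in> commutation_class ([] @ (a # nths ws I') @ nths ws (- I'))"
      by (intro commutation_class_context commutation_class_letter)
    then show ?thesis
      using IH False by (auto simp: eq intro: commutation_class_trans)
  qed
qed (simp add: commutation_class_refl)

section \<open>Letter counts and admissible words\<close>

definition before :: "'a list \<Rightarrow> 'a \<Rightarrow> 'a \<Rightarrow> bool" where
  "before cs i j \<longleftrightarrow> (\<exists>p q. p < q \<and> q < length cs \<and> cs ! p = i \<and> cs ! q = j)"

lemma before_iff_split: "before cs i j \<longleftrightarrow> (\<exists>xs ys zs. cs = xs @ i # ys @ j # zs)"
proof
  assume "before cs i j"
  then obtain p q where pq: "p < q" "q < length cs" "cs ! p = i" "cs ! q = j"
    by (auto simp: before_def)
  have "drop (Suc p) cs = take (q - Suc p) (drop (Suc p) cs) @ j # drop (Suc q) cs"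
    using pq id_take_nth_drop[of "q - Suc p" "drop (Suc p) cs"] by simp
  then have "cs = take p cs @ i # take (q - Suc p) (drop (Suc p) cs) @ j # drop (Suc q) cs"
    using pq id_take_nth_drop[of p cs] by simp
  then show "\<exists>xs ys zs. cs = xs @ i # ys @ j # zs" by blast
next
  assume "\<exists>xs ys zs. cs = xs @ i # ys @ j # zs"
  then obtain xs ys zs where cs: "cs = xs @ i # ys @ j # zs" by blast
  have "cs ! (length xs + Suc (length ys)) = j"
    unfolding cs by (simp only: nth_append_length_plus nth_Cons_Suc nth_append_length)
  then show "before cs i j"
    unfolding before_def
    by (intro exI[of _ "length xs"] exI[of _ "length xs + Suc (length ys)"]) (simp add: cs)
qed

lemma before_total:
  assumes "i \<in> set cs" "j \<in> set cs" "i \<noteq> j"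
  shows "before cs i j \<or> before cs j i"
  using assms unfolding before_def in_set_conv_nth by (metis linorder_neqE_nat)

lemma before_asym:
  assumes "distinct cs" "before cs i j"
  shows "\<not> before cs j i"
proof
  assume "before cs j i"
  then obtain p q where "p < q" "q < length cs" "cs ! p = j" "cs ! q = i"
    unfolding before_def by blast
  moreover obtain p' q' where "p' < q'" "q' < length cs" "cs ! p' = i" "cs ! q' = j"
    using assms(2) unfolding before_def by blast
  ultimately have "p = q'" "q = p'"
    using nth_eq_iff_index_eq[OF assms(1), of p q'] nth_eq_iff_index_eq[OF assms(1), of q p'] by auto
  then show False using \<open>p < q\<close> \<open>p' < q'\<close> by simp
qed

text \<open>The counts \<open>m\<close> describe the part of the heap of \<open>n\<close> rounds
  that is already used, and the next copy of \<open>k\<close> is to be minimal in the rest. A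
  neighbour earlier in \<open>cs\<close> must be one round ahead, a later one level with
  \<open>k\<close>. Neither can be further ahead, because its next copy waits for the missing copy
  of \<open>k\<close>; hence equations instead of inequalities.\<close>

definition fire :: "nat \<Rightarrow> nat list \<Rightarrow> (nat \<Rightarrow> nat) \<Rightarrow> nat \<Rightarrow> bool" where
  "fire n cs m k \<longleftrightarrow> k \<in> set cs \<and> m k < n \<and>
     (\<forall>j\<in>set cs. \<bar>int j - int k\<bar> = 1 \<longrightarrow> m j = (if before cs j k then m k + 1 else m k))"

definition admissible :: "nat \<Rightarrow> nat list \<Rightarrow> nat list \<Rightarrow> bool" where
  "admissible n cs ws \<longleftrightarrow> (\<forall>p<length ws. fire n cs (count_list (take p ws)) (ws ! p))"

lemma fire_cong:
  assumes "\<And>j. \<bar>int j - int k\<bar> \<le> 1 \<Longrightarrow> m j = m' j"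
  shows "fire n cs m k \<longleftrightarrow> fire n cs m' k"
  using assms unfolding fire_def by auto

lemma admissible_Nil [simp]: "admissible n cs []"
  by (simp add: admissible_def)

lemma admissible_snoc: "admissible n cs (ws @ [k]) \<longleftrightarrow> admissible n cs ws \<and> fire n cs (count_list ws) k"
  by (auto simp: admissible_def nth_append less_Suc_eq)

lemma admissible_append:
  "admissible n cs (us @ vs) \<longleftrightarrow> admissible n cs us \<and>
     (\<forall>p<length vs. fire n cs (\<lambda>i. count_list us i + count_list (take p vs) i) (vs ! p))"
proof (induction vs rule: rev_induct)
  case (snoc v vs)
  have eq: "count_list (us @ vs) = (\<lambda>i. count_list us i + count_list vs i)"
    by (simp add: fun_eq_iff)
  show ?case
    unfolding append_assoc[symmetric] admissible_snoc snoc eq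
    by (auto simp: nth_append less_Suc_eq)
qed simp

lemma admissible_prefix: "admissible n cs (us @ vs) \<Longrightarrow> admissible n cs us"
  by (simp add: admissible_append)

lemma admissible_set: "admissible n cs ws \<Longrightarrow> set ws \<subseteq> set cs"
  by (auto simp: admissible_def fire_def in_set_conv_nth)

lemma admissible_count_le: "admissible n cs ws \<Longrightarrow> count_list ws i \<le> n"
  by (induction ws rule: rev_induct) (auto simp: admissible_snoc fire_def)

text \<open>Letters at distance more than 1 do not see each other's counts, so both may fire in
  either order, and the counts afterwards coincide.\<close>

lemma admissible_swap:
  assumes "\<bar>int i - int j\<bar> > 1" "admissible n cs (us @ [i, j] @ vs)"
  shows "admissible n cs (us @ [j, i] @ vs)"
proof -
  have 1: "count_list (us @ [i, j]) = count_list (us @ [j, i])"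
    by (simp add: fun_eq_iff)
  have "admissible n cs (us @ [i, j])"
    using assms(2) admissible_prefix by (metis append_assoc)
  then have "admissible n cs ((us @ [i]) @ [j])" by simp
  then have f: "admissible n cs us" "fire n cs (count_list us) i" "fire n cs (count_list (us @ [i])) j"
    by (simp_all only: admissible_snoc)
  have "fire n cs (count_list (us @ [i])) j \<longleftrightarrow> fire n cs (count_list us) j"
    "fire n cs (count_list (us @ [j])) i \<longleftrightarrow> fire n cs (count_list us) i"
    by (rule fire_cong; use assms(1) in auto)+
  with f have "admissible n cs ((us @ [j]) @ [i])"
    by (simp only: admissible_snoc)
  then have "admissible n cs (us @ [j, i])" by simp
  moreover have "admissible n cs ((us @ [i, j]) @ vs)" using assms(2) by simp
  ultimately have "admissible n cs ((us @ [j, i]) @ vs)"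
    using 1 unfolding admissible_append by metis
  then show ?thesis by simp
qed

lemma admissible_commutation_class:
  assumes "ws' \<in> commutation_class ws" "admissible n cs ws"
  shows "admissible n cs ws'"
  using assms by (induction rule: commutation_class_invariant) (auto dest: admissible_swap)

lemma count_list_replicate_concat:
  "count_list (concat (replicate r ws)) i = r * count_list ws i"
  by (induction r) auto

lemma count_list_distinct: "distinct ws \<Longrightarrow> count_list ws i = (if i \<in> set ws then 1 else 0)"
  by (induction ws) auto

text \<open>Only the relative order of adjacent labels matters, so \<open>ds\<close> may differ from
  \<open>cs\<close>. This freedom serves the unfolding of \<open>csB\<close>, whose powers must be
  admissible for \<open>csA\<close>.\<close>

lemma admissible_power:
  assumes cs: "distinct cs" and ds: "distinct ds" "set ds = set cs" and "r \<le> n"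
    and before: "\<And>i j. i \<in> set cs \<Longrightarrow> j \<in> set cs \<Longrightarrow> \<bar>int i - int j\<bar> = 1 \<Longrightarrow> before ds i j \<longleftrightarrow> before cs i j"
  shows "admissible n cs (concat (replicate r ds))"
  using \<open>r \<le> n\<close>
proof (induction r)
  case (Suc r)
  have "fire n cs (\<lambda>i. r * count_list ds i + count_list (take p ds) i) (ds ! p)"
    if p: "p < length ds" for p
  proof -
    define k where "k = ds ! p"
    have k: "k \<in> set cs"
      unfolding k_def ds(2)[symmetric] using p by (rule nth_mem)
    have inb: "j \<in> set (take p ds) \<longleftrightarrow> before ds j k" if "j \<in> set cs" for j
    proof
      assume "j \<in> set (take p ds)"
      then obtain q where q: "q < length (take p ds)" "take p ds ! q = j"
        unfolding in_set_conv_nth by blast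
      then have "q < p" "ds ! q = j" by simp_all
      then show "before ds j k"
        unfolding before_def k_def using p by blast
    next
      assume "before ds j k"
      then obtain q q' where q: "q < q'" "q' < length ds" "ds ! q = j" "ds ! q' = ds ! p"
        unfolding before_def k_def by blast
      then have "q < p"
        using p ds(1) by (simp add: nth_eq_iff_index_eq)
      then have "q < length (take p ds)" "take p ds ! q = j"
        using q p by simp_all
      then show "j \<in> set (take p ds)"
        using nth_mem by blast
    qed
    have cnt: "r * count_list ds j + count_list (take p ds) j = r + (if before ds j k then 1 else 0)"
      if "j \<in> set cs" for j
      using that ds inb[OF that] by (simp add: count_list_distinct)
    have "\<not> before ds k k"
      using ds(1) before_asym by metis
    then show ?thesis
      using Suc.prems k before cnt unfolding fire_def k_def[symmetric] by (auto simp: cnt)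
  qed
  moreover have "concat (replicate (Suc r) ds) = concat (replicate r ds) @ ds"
    by (induction r) auto
  ultimately show ?case
    using Suc by (simp add: admissible_append count_list_replicate_concat)
qed simp

lemma nths_take_Suc:
  assumes "p < length ws"
  shows "nths (take (Suc p) ws) I = nths (take p ws) I @ (if p \<in> I then [ws ! p] else [])"
  using assms by (simp add: take_Suc_conv_app_nth nths_append)

lemma count_list_nths_take:
  assumes "p \<le> length ws"
  shows "count_list (nths (take p ws) I) i = card {x. x < p \<and> x \<in> I \<and> ws ! x = i}"
  using assms
proof (induction p)
  case (Suc p)
  have "{x. x < Suc p \<and> x \<in> I \<and> ws ! x = i} =
      (if p \<in> I \<and> ws ! p = i then insert p else id) {x. x < p \<and> x \<in> I \<and> ws ! x = i}"
    by (auto simp: less_Suc_eq)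
  then show ?case
    using Suc by (auto simp: nths_take_Suc)
qed simp

lemma count_list_take:
  "p \<le> length ws \<Longrightarrow> count_list (take p ws) i = card {x. x < p \<and> ws ! x = i}"
  using count_list_nths_take[of p ws UNIV i] by (simp add: nths_all)

text \<open>For an element of the ideal, all earlier elements with the same or an adjacent label lie
  in the ideal too, so its letter sees the same counts as in the full word.\<close>

lemma admissible_nths:
  assumes "order_ideal ws I" "admissible n cs ws"
  shows "admissible n cs (nths ws I)"
proof -
  have "admissible n cs (nths (take p ws) I)" if "p \<le> length ws" for p
    using that
  proof (induction p)
    case (Suc p)
    have "fire n cs (count_list (nths (take p ws) I)) (ws ! p)" if "p \<in> I"
    proof -
      have "{x. x < p \<and> x \<in> I \<and> ws ! x = j} = {x. x < p \<and> ws ! x = j}"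
        if "\<bar>int j - int (ws ! p)\<bar> \<le> 1" for j
        using that \<open>p \<in> I\<close> assms(1) unfolding order_ideal_iff by auto
      then have "fire n cs (count_list (nths (take p ws) I)) (ws ! p) \<longleftrightarrow>
          fire n cs (count_list (take p ws)) (ws ! p)"
        using Suc.prems by (intro fire_cong) (simp add: count_list_nths_take count_list_take)
      then show ?thesis
        using assms(2) Suc.prems by (simp add: admissible_def)
    qed
    then show ?case
      using Suc by (simp add: nths_take_Suc admissible_snoc)
  qed simp
  from this[of "length ws"] show ?thesis by simp
qed

text \<open>One less than \<open>occurrence\<close>. Together with the label it identifies a heap
  element, and it is the index \<open>k\<close> of the coordinates used later.\<close>

definition round_of :: "nat list \<Rightarrow> nat \<Rightarrow> nat" where
  "round_of ws x = count_list (take x ws) (ws ! x)"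

lemma round_of_card: "x < length ws \<Longrightarrow> round_of ws x = card {y. y < x \<and> ws ! y = ws ! x}"
  by (simp add: round_of_def count_list_take)

lemma occurrence_round_of:
  assumes "x < length ws" shows "occurrence ws x = Suc (round_of ws x)"
proof -
  have "{x'. x' \<le> x \<and> ws ! x' = ws ! x} = insert x {y. y < x \<and> ws ! y = ws ! x}" by auto
  then show ?thesis using assms by (simp add: occurrence_def round_of_card)
qed

text \<open>Elements with a common label form a chain, of which an ideal takes an initial segment.
  So an ideal is recovered from its letter counts.\<close>

lemma ideal_mem_iff_round_of:
  assumes "order_ideal ws I" "x < length ws"
  shows "x \<in> I \<longleftrightarrow> round_of ws x < count_list (nths ws I) (ws ! x)"
proof -
  have c: "count_list (nths ws I) (ws ! x) = card {y. y \<in> I \<and> ws ! y = ws ! x}"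
  proof -
    have "{y. y < length ws \<and> y \<in> I \<and> ws ! y = ws ! x} = {y. y \<in> I \<and> ws ! y = ws ! x}"
      using assms(1) by (auto simp: order_ideal_iff)
    then show ?thesis using count_list_nths_take[of "length ws" ws I] by simp
  qed
  have fin: "finite I"
    using assms(1) by (auto simp: order_ideal_iff intro: finite_subset)
  show ?thesis
  proof
    assume x: "x \<in> I"
    have "y \<in> I" if "y < x" "ws ! y = ws ! x" for y
      by (rule order_idealD[OF assms(1) x]) (use that in simp_all)
    then have "insert x {y. y < x \<and> ws ! y = ws ! x} \<subseteq> {y. y \<in> I \<and> ws ! y = ws ! x}"
      using x by auto
    then have "card (insert x {y. y < x \<and> ws ! y = ws ! x}) \<le> card {y. y \<in> I \<and> ws ! y = ws ! x}"
      by (rule card_mono[rotated]) (use fin in simp)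
    then show "round_of ws x < count_list (nths ws I) (ws ! x)"
      using assms(2) by (simp add: c round_of_card)
  next
    assume *: "round_of ws x < count_list (nths ws I) (ws ! x)"
    show "x \<in> I"
    proof (rule ccontr)
      assume "x \<notin> I"
      have "y < x" if "y \<in> I" "ws ! y = ws ! x" for y
      proof (rule ccontr)
        assume "\<not> y < x"
        then have "x < y" using that \<open>x \<notin> I\<close> by (metis linorder_neqE_nat)
        then show False using order_idealD[OF assms(1), of y x] that \<open>x \<notin> I\<close> by simp
      qed
      then have "{y. y \<in> I \<and> ws ! y = ws ! x} \<subseteq> {y. y < x \<and> ws ! y = ws ! x}" by auto
      then have "card {y. y \<in> I \<and> ws ! y = ws ! x} \<le> card {y. y < x \<and> ws ! y = ws ! x}"
        by (rule card_mono[rotated]) simp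
      with * show False
        using assms(2) by (simp add: c round_of_card)
    qed
  qed
qed

lemma round_of_less:
  assumes "x < y" "y \<le> length ws"
  shows "round_of ws x < count_list (take y ws) (ws ! x)"
proof -
  have "insert x {z. z < x \<and> ws ! z = ws ! x} \<subseteq> {z. z < y \<and> ws ! z = ws ! x}"
    using assms by auto
  then have "card (insert x {z. z < x \<and> ws ! z = ws ! x}) \<le> card {z. z < y \<and> ws ! z = ws ! x}"
    by (rule card_mono[rotated]) simp
  then show ?thesis
    using assms by (simp add: round_of_card count_list_take)
qed

lemma round_of_unique:
  assumes "x < length ws" "y < length ws" "ws ! x = ws ! y" "round_of ws x = round_of ws y"
  shows "x = y"
  using assms round_of_less[of x y ws] round_of_less[of y x ws]
  by (metis less_imp_le_nat less_irrefl linorder_neqE_nat round_of_def)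

lemma round_of_exists:
  assumes "k < count_list ws i"
  shows "\<exists>x<length ws. ws ! x = i \<and> round_of ws x = k"
  using assms
proof (induction ws rule: rev_induct)
  case (snoc w ws)
  show ?case
  proof (cases "k < count_list ws i")
    case True
    then obtain x where "x < length ws" "ws ! x = i" "round_of ws x = k" using snoc by blast
    then show ?thesis
      by (intro exI[of _ x]) (auto simp: nth_append round_of_def)
  next
    case False
    then show ?thesis
      using snoc.prems by (intro exI[of _ "length ws"]) (auto simp: round_of_def split: if_splits)
  qed
qed simp

text \<open>The count vectors in which adjacent letters alternate, beginning with the one that comes
  first in \<open>cs\<close>.\<close>

definition valid :: "nat list \<Rightarrow> (nat \<Rightarrow> nat) \<Rightarrow> bool" where
  "valid cs m \<longleftrightarrow> (\<forall>i\<in>set cs. \<forall>j\<in>set cs. \<bar>int i - int j\<bar> = 1 \<longrightarrow> before cs i j \<longrightarrow>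
     m j \<le> m i \<and> m i \<le> m j + 1)"

lemma admissible_valid:
  assumes "distinct cs" "admissible n cs ws"
  shows "valid cs (count_list ws)"
  using assms(2)
proof (induction ws rule: rev_induct)
  case (snoc k ws)
  then have f: "fire n cs (count_list ws) k" and v: "valid cs (count_list ws)"
    by (simp_all add: admissible_snoc)
  show ?case
    unfolding valid_def
  proof (intro ballI impI)
    fix i j assume ij: "i \<in> set cs" "j \<in> set cs" "\<bar>int i - int j\<bar> = 1" "before cs i j"
    have v': "count_list ws j \<le> count_list ws i \<and> count_list ws i \<le> count_list ws j + 1"
      using v ij by (auto simp: valid_def)
    consider "i = k" "j \<noteq> k" | "j = k" "i \<noteq> k" | "i \<noteq> k" "j \<noteq> k" using ij(3) by fastforce
    then show "count_list (ws @ [k]) j \<le> count_list (ws @ [k]) i \<and>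
        count_list (ws @ [k]) i \<le> count_list (ws @ [k]) j + 1"
    proof cases
      case 1
      then have "count_list ws j = count_list ws i"
        using f ij before_asym[OF assms(1) ij(4)] unfolding fire_def by (metis abs_minus_commute)
      then show ?thesis using 1 by simp
    next
      case 2
      then have "count_list ws i = count_list ws j + 1"
        using f ij unfolding fire_def by metis
      then show ?thesis using 2 by simp
    qed (use v' in simp)
  qed
qed (simp add: valid_def)

text \<open>\<open>fire\<close> at \<open>y\<close> compares the rounds of \<open>x\<close> and
  \<open>y\<close>, and \<open>valid\<close> compares the bounds at their labels. If the label of
  \<open>x\<close> comes first in \<open>cs\<close>, then \<open>x\<close> may be in the same round
  as \<open>y\<close>; otherwise its round is strictly smaller, which makes up for the slack of 1 in
  \<open>valid\<close>.\<close>

lemma valid_order_ideal: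
  assumes cs: "distinct cs" and m: "valid cs m" and ws: "admissible n cs ws"
  shows "order_ideal ws {x. x < length ws \<and> round_of ws x < m (ws ! x)}"
  unfolding order_ideal_iff
proof (intro conjI allI impI)
  fix x y
  assume "y \<in> {x. x < length ws \<and> round_of ws x < m (ws ! x)} \<and> x < y \<and>
    \<bar>int (ws ! x) - int (ws ! y)\<bar> \<le> 1"
  then have y: "y < length ws" "round_of ws y < m (ws ! y)" and xy: "x < y"
    and d: "\<bar>int (ws ! x) - int (ws ! y)\<bar> \<le> 1" by auto
  have f: "fire n cs (count_list (take y ws)) (ws ! y)"
    using ws y by (simp add: admissible_def)
  have mem: "ws ! x \<in> set cs" "ws ! y \<in> set cs"
    using admissible_set[OF ws] y xy by (auto simp: subset_iff)
  have r: "round_of ws x < count_list (take y ws) (ws ! x)"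
    using round_of_less xy y by simp
  consider "ws ! x = ws ! y" | "\<bar>int (ws ! x) - int (ws ! y)\<bar> = 1" "before cs (ws ! x) (ws ! y)"
    | "\<bar>int (ws ! x) - int (ws ! y)\<bar> = 1" "\<not> before cs (ws ! x) (ws ! y)" "before cs (ws ! y) (ws ! x)"
    using d before_total[OF mem] by linarith
  then have "round_of ws x < m (ws ! x)"
  proof cases
    case 1
    then show ?thesis using r y by (simp add: round_of_def)
  next
    case 2
    then have "count_list (take y ws) (ws ! x) = round_of ws y + 1"
      using f mem unfolding fire_def round_of_def by metis
    moreover have "m (ws ! y) \<le> m (ws ! x)"
      using 2 m mem by (auto simp: valid_def)
    ultimately show ?thesis using r y by simp
  next
    case 3
    then have "count_list (take y ws) (ws ! x) = round_of ws y"
      using f mem unfolding fire_def round_of_def by metis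
    moreover have "m (ws ! y) \<le> m (ws ! x) + 1"
      using 3 m mem by (auto simp: valid_def abs_minus_commute)
    ultimately show ?thesis using r y by simp
  qed
  then show "x \<in> {x. x < length ws \<and> round_of ws x < m (ws ! x)}"
    using xy y by simp
qed auto

text \<open>The counts of any admissible word are \<open>valid\<close> and so cut out an ideal of
  the full word. The word itself is not assumed to be a prefix of anything, which is what unfolded
  words require.\<close>

lemma admissible_ideal_exists:
  assumes cs: "distinct cs" and us: "admissible n cs us" and ws: "admissible n cs ws"
    and full: "\<And>i. i \<in> set cs \<Longrightarrow> count_list ws i = n"
  shows "\<exists>I. order_ideal ws I \<and> count_list (nths ws I) = count_list us"
proof -
  define I where "I = {x. x < length ws \<and> round_of ws x < count_list us (ws ! x)}"
  have I: "order_ideal ws I"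
    unfolding I_def by (rule valid_order_ideal[OF cs admissible_valid[OF cs us] ws])
  have a: "admissible n cs (nths ws I)"
    by (rule admissible_nths[OF I ws])
  have "count_list (nths ws I) i = count_list us i" for i
  proof (cases "i \<in> set cs")
    case True
    \<comment> \<open>Both counts are at most \<open>n\<close>, so they agree once they exceed the
      same numbers below \<open>n\<close>.\<close>
    have "k < count_list (nths ws I) i \<longleftrightarrow> k < count_list us i" if kn: "k < n" for k
    proof -
      obtain x where x: "x < length ws" "ws ! x = i" "round_of ws x = k"
        using round_of_exists[of k ws i] full[OF True] kn by auto
      then have "x \<in> I \<longleftrightarrow> k < count_list (nths ws I) i" "x \<in> I \<longleftrightarrow> k < count_list us i"
        using ideal_mem_iff_round_of[OF I, of x] by (auto simp: I_def)
      then show ?thesis by simp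
    qed
    then show ?thesis
      using admissible_count_le[OF a, of i] admissible_count_le[OF us, of i]
      by (meson linorder_not_less nle_le order_le_less_trans order_less_irrefl order_less_le_trans)
  next
    case False
    then have "i \<notin> set (nths ws I)" "i \<notin> set us"
      using admissible_set[OF a] admissible_set[OF us] by auto
    then show ?thesis by simp
  qed
  then show ?thesis using I by blast
qed

section \<open>Lengths and sorting words\<close>

text \<open>A common frame for both types: a statistic that right multiplication by a generator
  raises by at most 1, and that some generator lowers by exactly 1 away from the identity, must be
  the Coxeter length.\<close>

locale length_statistic =
  fixes s :: "nat \<Rightarrow> 'a \<Rightarrow> 'a" and J :: "nat set" and W :: "('a \<Rightarrow> 'a) set"
    and len :: "('a \<Rightarrow> 'a) \<Rightarrow> nat"
  assumes id_mem: "id \<in> W" and len_id: "len id = 0"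
    and step_mem: "w \<in> W \<Longrightarrow> i \<in> J \<Longrightarrow> w \<circ> s i \<in> W"
    and len_step: "w \<in> W \<Longrightarrow> i \<in> J \<Longrightarrow> len (w \<circ> s i) \<le> Suc (len w)"
    and descent: "w \<in> W \<Longrightarrow> w \<noteq> id \<Longrightarrow> \<exists>i\<in>J. len w = Suc (len (w \<circ> s i))"
    and invol: "i \<in> J \<Longrightarrow> s i \<circ> s i = id"
begin

lemma word_mem: "set ws \<subseteq> J \<Longrightarrow> word_prod s ws \<in> W \<and> len (word_prod s ws) \<le> length ws"
proof (induction ws rule: rev_induct)
  case (snoc i ws)
  then have "word_prod s ws \<circ> s i \<in> W" "len (word_prod s ws \<circ> s i) \<le> Suc (len (word_prod s ws))"
    by (auto intro!: step_mem len_step)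
  moreover have "word_prod s (ws @ [i]) = word_prod s ws \<circ> s i"
    by (simp add: fun_eq_iff)
  moreover have "len (word_prod s ws) \<le> length ws"
    using snoc by simp
  ultimately show ?case by (metis Suc_le_mono length_append_singleton order_trans)
qed (simp add: id_mem len_id)

lemma word_exists:
  assumes "w \<in> W"
  shows "\<exists>ws. set ws \<subseteq> J \<and> length ws = len w \<and> word_prod s ws = w"
  using assms
proof (induction "len w" arbitrary: w)
  case 0
  then have w: "w = id" using descent by fastforce
  show ?case unfolding w len_id by (rule exI[of _ "[]"]) simp
next
  case (Suc k)
  then have "w \<noteq> id" using len_id by auto
  then obtain i where i: "i \<in> J" "len w = Suc (len (w \<circ> s i))"
    using descent Suc.prems by blast
  moreover have "w \<circ> s i \<in> W" using step_mem Suc.prems i by blast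
  ultimately obtain ws where ws: "set ws \<subseteq> J" "length ws = len (w \<circ> s i)" "word_prod s ws = w \<circ> s i"
    using Suc.hyps by auto
  have "word_prod s (ws @ [i]) = w"
    using ws invol[OF i(1)] by (simp add: comp_assoc)
  then show ?case
    using ws i by (intro exI[of _ "ws @ [i]"]) simp
qed

lemma cox_length_eq: "w \<in> W \<Longrightarrow> cox_length s J w = len w"
  unfolding cox_length_def
  by (rule Least_equality) (use word_exists word_mem in blast)+

lemma longest_element_eq:
  assumes "w0 \<in> W" and "\<And>u. u \<in> W \<Longrightarrow> u \<noteq> w0 \<Longrightarrow> len u < len w0"
  shows "longest_element s J W = w0"
  unfolding longest_element_def
proof (rule the_equality)
  show "w0 \<in> W \<and> (\<forall>u\<in>W. cox_length s J u \<le> cox_length s J w0)"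
    using assms by (auto simp: cox_length_eq) (metis less_imp_le_nat order_refl)
  show "w = w0" if "w \<in> W \<and> (\<forall>u\<in>W. cox_length s J u \<le> cox_length s J w)" for w
    using that assms by (metis cox_length_eq linorder_not_less)
qed

end

lemma sorted_wrt_less_nth_ge:
  assumes "sorted_wrt (<) (qs :: nat list)" "j < length qs"
  shows "j \<le> qs ! j"
  using assms(2)
proof (induction j)
  case (Suc j)
  have "qs ! j < qs ! Suc j"
    using assms(1) Suc.prems by (simp add: sorted_wrt_iff_nth_less)
  with Suc show ?case by simp
qed simp

text \<open>At the first disagreement a strictly increasing list has skipped a number, so its entry
  there is larger.\<close>

lemma upt_lexord_least:
  assumes "sorted_wrt (<) qs" "length qs = l" "qs \<noteq> [0..<l]"
  shows "([0..<l], qs) \<in> lexord less_than"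
proof -
  define j where "j = (LEAST j. j < l \<and> qs ! j \<noteq> j)"
  have "\<exists>j. j < l \<and> qs ! j \<noteq> j"
    using assms(2,3) by (metis add_0 length_upt minus_nat.diff_0 nth_equalityI nth_upt)
  then have j: "j < l" "qs ! j \<noteq> j"
    using LeastI_ex[of "\<lambda>j. j < l \<and> qs ! j \<noteq> j"] by (auto simp: j_def)
  have "qs ! i = i" if "i < j" for i
    using not_less_Least[of i "\<lambda>j. j < l \<and> qs ! j \<noteq> j"] that j unfolding j_def[symmetric] by auto
  then have "take j [0..<l] = take j qs"
    using j assms(2) by (intro nth_equalityI) auto
  moreover have "j < qs ! j"
    using sorted_wrt_less_nth_ge[OF assms(1), of j] j assms(2) by simp
  ultimately show ?thesis
    unfolding lexord_take_index_conv using j assms(2) by (auto intro!: exI[of _ j])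
qed

lemma concat_replicate_snoc: "concat (replicate (Suc r) xs) = concat (replicate r xs) @ xs"
  by (induction r) auto

lemma map_inf_letter:
  assumes "cs \<noteq> []"
  shows "map (inf_letter cs) [0..<r * length cs] = concat (replicate r cs)"
proof (induction r)
  case (Suc r)
  have "[0..<Suc r * length cs] = [0..<r * length cs] @ [r * length cs..<r * length cs + length cs]"
    using upt_add_eq_append[of 0 "r * length cs" "length cs"] by (simp add: add.commute)
  moreover have "map (inf_letter cs) [r * length cs..<r * length cs + length cs] = cs"
    by (rule nth_equalityI) (simp_all add: inf_letter_def)
  ultimately show ?case
    using Suc by (simp only: map_append concat_replicate_snoc)
qed simp

text \<open>All reduced subwords for \<open>w\<close> have the same length, and among position lists
  of that length the initial segment is lexicographically first. So nothing has to be sorted once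
  the power is known to be reduced.\<close>

lemma sort_word_power:
  assumes "cs \<noteq> []" "reduced_word s J (concat (replicate r cs)) w"
  shows "sort_word s J cs w = concat (replicate r cs)"
proof -
  define l where "l = r * length cs"
  have red: "reduced_subword s J cs w [0..<l]"
    using assms by (simp add: reduced_subword_def l_def map_inf_letter)
  have len: "length qs = l" if "reduced_subword s J cs w qs" for qs
    using that red by (simp add: reduced_subword_def reduced_word_def)
  have "sort_positions s J cs w = [0..<l]"
    unfolding sort_positions_def
  proof (rule the_equality)
    show "reduced_subword s J cs w [0..<l] \<and>
        (\<forall>qs. reduced_subword s J cs w qs \<longrightarrow> qs = [0..<l] \<or> ([0..<l], qs) \<in> lexord less_than)"
      using red len upt_lexord_least by (auto simp: reduced_subword_def)
  next
    fix ps
    assume *: "reduced_subword s J cs w ps \<and>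
        (\<forall>qs. reduced_subword s J cs w qs \<longrightarrow> qs = ps \<or> (ps, qs) \<in> lexord less_than)"
    show "ps = [0..<l]"
    proof (rule ccontr)
      assume ne: "ps \<noteq> [0..<l]"
      then have "([0..<l], ps) \<in> lexord less_than"
        using * len upt_lexord_least by (auto simp: reduced_subword_def)
      moreover have "(ps, [0..<l]) \<in> lexord less_than"
        using * red ne by metis
      ultimately have "(ps, ps) \<in> lexord less_than"
        using lexord_trans[OF _ _ trans_less_than] by metis
      then show False
        using lexord_irreflexive[of less_than ps] by simp
    qed
  qed
  then show ?thesis
    using assms(1) by (simp add: sort_word_def l_def map_inf_letter)
qed

text \<open>A shorter word for the prefix would shorten the whole word.\<close>

lemma reduced_word_prefix:
  assumes "reduced_word s J (us @ vs) w"
  shows "reduced_word s J us (word_prod s us)"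
proof -
  let ?P = "\<lambda>u k. \<exists>ws. set ws \<subseteq> J \<and> length ws = k \<and> word_prod s ws = u"
  have P: "?P (word_prod s us) (length us)"
    using assms by (auto simp: reduced_word_def)
  define l where "l = cox_length s J (word_prod s us)"
  have "?P (word_prod s us) l"
    unfolding l_def cox_length_def by (rule LeastI[of "?P (word_prod s us)", OF P])
  then obtain ws where ws: "set ws \<subseteq> J" "length ws = l" "word_prod s ws = word_prod s us" by blast
  have "?P w (length (ws @ vs))"
    using ws assms by (intro exI[of _ "ws @ vs"]) (auto simp: reduced_word_def)
  then have "cox_length s J w \<le> length (ws @ vs)"
    unfolding cox_length_def by (rule Least_le)
  then have "length us \<le> l"
    using assms ws by (simp add: reduced_word_def)
  moreover have "l \<le> length us"
    unfolding l_def cox_length_def by (rule Least_le[of "?P (word_prod s us)", OF P])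
  ultimately show ?thesis
    using assms by (simp add: reduced_word_def l_def)
qed

text \<open>The assumption \<open>determined\<close> carries the content specific to the group. It
  makes the ideal in \<open>ideal_of\<close> unique and identifies the singletons with the products
  over ideals.\<close>

locale sorted_heap =
  fixes s :: "nat \<Rightarrow> 'a \<Rightarrow> 'a" and J :: "nat set" and n :: nat and cs sw :: "nat list"
  assumes distinct: "distinct cs" and set_cs: "set cs = J"
    and admissible_sw: "admissible n cs sw" and full: "\<And>i. i \<in> J \<Longrightarrow> count_list sw i = n"
    and reduced: "reduced_word s J sw (word_prod s sw)"
    and commute: "\<And>i j. \<bar>int i - int j\<bar> > 1 \<Longrightarrow> s i \<circ> s j = s j \<circ> s i"
    and determined: "\<And>us vs. admissible n cs us \<Longrightarrow> admissible n cs vs \<Longrightarrow>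
      word_prod s us = word_prod s vs \<longleftrightarrow> count_list us = count_list vs"
begin

lemma class_reduced:
  assumes "ws \<in> commutation_class sw"
  shows "reduced_word s J ws (word_prod s sw)"
proof -
  have "set ws \<subseteq> J \<and> length ws = length sw \<and> word_prod s ws = word_prod s sw"
    using assms
  proof (induction rule: commutation_class_invariant)
    case (move us vs i j)
    have "word_prod s (us @ [j, i] @ vs) = word_prod s us \<circ> (s j \<circ> s i) \<circ> word_prod s vs"
      by (simp add: comp_assoc)
    also have "\<dots> = word_prod s (us @ [i, j] @ vs)"
      unfolding commute[OF move(1), symmetric] by (simp add: comp_assoc)
    finally have "word_prod s (us @ [j, i] @ vs) = word_prod s (us @ [i, j] @ vs)" .
    then show ?case using move(2) unfolding set_append length_append by simp
  qed (use reduced in \<open>simp add: reduced_word_def\<close>)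
  then show ?thesis
    using reduced by (simp add: reduced_word_def)
qed

lemma ideal_reduced:
  "order_ideal sw I \<Longrightarrow> reduced_word s J (nths sw I) (word_prod s (nths sw I))"
  by (rule reduced_word_prefix[OF class_reduced[OF nths_ideal_commutation_class]])

lemma ideal_eqI:
  assumes "order_ideal sw I" "order_ideal sw I'"
    and "word_prod s (nths sw I) = word_prod s (nths sw I')"
  shows "I = I'"
proof -
  have "count_list (nths sw I) = count_list (nths sw I')"
    using determined admissible_nths admissible_sw assms by metis
  then have "x \<in> I \<longleftrightarrow> x \<in> I'" if "x < length sw" for x
    using ideal_mem_iff_round_of[OF assms(1) that] ideal_mem_iff_round_of[OF assms(2) that] by simp
  moreover have "I \<subseteq> {..<length sw}" "I' \<subseteq> {..<length sw}"
    using assms(1,2) by (auto simp: order_ideal_iff)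
  ultimately show ?thesis by blast
qed

lemma ideal_of_eq:
  assumes "order_ideal sw I"
  shows "ideal_of s J sw (word_prod s (nths sw I)) = I"
  unfolding ideal_of_def
  by (rule the_equality) (use assms ideal_reduced ideal_eqI in \<open>auto simp: reduced_word_def\<close>)

lemma ideal_singleton:
  "order_ideal sw I \<Longrightarrow> word_prod s (nths sw I) \<in> singletons s J sw"
  unfolding singletons_def using ideal_reduced nths_ideal_commutation_class by blast

lemma admissible_ideal:
  assumes "admissible n cs us"
  obtains I where "order_ideal sw I" "word_prod s us = word_prod s (nths sw I)"
    "count_list us = count_list (nths sw I)"
proof -
  obtain I where I: "order_ideal sw I" "count_list (nths sw I) = count_list us"
    using admissible_ideal_exists[OF distinct assms admissible_sw] full by (auto simp: set_cs)
  then have "word_prod s us = word_prod s (nths sw I)"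
    using determined[OF assms admissible_nths[OF I(1) admissible_sw]] by simp
  then show thesis using I that by simp
qed

text \<open>A prefix of a word in the commutation class is admissible, so it has the counts of an
  ideal, and \<open>determined\<close> turns equal counts into equal group elements.\<close>

lemma singletonE:
  assumes "w \<in> singletons s J sw"
  obtains I where "order_ideal sw I" "w = word_prod s (nths sw I)" "ideal_of s J sw w = I"
proof -
  obtain us vs where us: "reduced_word s J us w" "us @ vs \<in> commutation_class sw"
    using assms by (auto simp: singletons_def)
  have "admissible n cs us"
    using admissible_commutation_class[OF us(2) admissible_sw] admissible_prefix by blast
  then obtain I where "order_ideal sw I" "word_prod s us = word_prod s (nths sw I)"
    using admissible_ideal by metis
  then show thesis
    using us that ideal_of_eq by (auto simp: reduced_word_def)
qed

end

section \<open>Strands of the sorting network\<close>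

lemma sA_simps: "sA k k = Suc k" "sA k (Suc k) = k" "j \<noteq> k \<Longrightarrow> j \<noteq> Suc k \<Longrightarrow> sA k j = j"
  by (auto simp: sA_def)

lemma sA_permutes: "k \<in> {1..2 * n - 1} \<Longrightarrow> sA k permutes {1..2 * n}"
  unfolding sA_def by (rule permutes_swap_id) auto

lemma word_prod_permutes:
  assumes "\<And>i. i \<in> set ws \<Longrightarrow> s i permutes A"
  shows "word_prod s ws permutes A"
  using assms by (induction ws) (auto intro: permutes_compose permutes_id)

lemma word_prod_sA_permutes: "set ws \<subseteq> {1..2 * n - 1} \<Longrightarrow> word_prod sA ws permutes {1..2 * n}"
  by (rule word_prod_permutes) (use sA_permutes in blast)

text \<open>\<open>flip\<close> is invariance of the orientation under exchanging \<open>i\<close>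
  with \<open>2 * n - i\<close>. The mirror reverses the numerical order of the ends of an edge,
  hence the negation.\<close>

locale symmetric_orientation =
  fixes n :: nat and cs :: "nat list"
  assumes n_pos: "n \<ge> 1" and distinct_cs: "distinct cs" and set_cs: "set cs = {1..2 * n - 1}"
    and flip: "\<And>j. 2 \<le> j \<Longrightarrow> j \<le> 2 * n - 1 \<Longrightarrow>
      before cs (j - 1) j \<longleftrightarrow> \<not> before cs (2 * n - j) (2 * n + 1 - j)"
begin

definition lower :: "nat \<Rightarrow> bool" where "lower j \<longleftrightarrow> before cs (j - 1) j"
definition lowers :: "nat \<Rightarrow> nat" where "lowers j = card {l \<in> {2..j}. lower l}"
definition uppers :: "nat \<Rightarrow> nat" where "uppers j = card {l \<in> {2..j}. \<not> lower l}"

lemma lower_sym: "2 \<le> j \<Longrightarrow> j \<le> 2 * n - 1 \<Longrightarrow> lower (2 * n + 1 - j) \<longleftrightarrow> \<not> lower j"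
  using flip[of j] by (auto simp: lower_def)

lemma before_mem: "before cs i j \<Longrightarrow> i \<in> {1..2 * n - 1} \<and> j \<in> {1..2 * n - 1}"
  unfolding set_cs[symmetric] before_def by auto

lemma lower_range: "lower j \<Longrightarrow> 2 \<le> j \<and> j \<le> 2 * n - 1"
  unfolding lower_def using before_mem by fastforce

lemma before_up: "2 \<le> j \<Longrightarrow> j \<le> 2 * n - 1 \<Longrightarrow> before cs j (j - 1) \<longleftrightarrow> \<not> lower j"
proof -
  assume j: "2 \<le> j" "j \<le> 2 * n - 1"
  have "before cs j (j - 1) \<or> before cs (j - 1) j"
    by (rule before_total) (use j in \<open>auto simp: set_cs\<close>)
  then show ?thesis
    unfolding lower_def using before_asym[OF distinct_cs] by blast
qed

lemma LU_1 [simp]: "lowers (Suc 0) = 0" "uppers (Suc 0) = 0"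
  by (simp_all add: lowers_def uppers_def)

lemma lowers_step: "j \<ge> 1 \<Longrightarrow> lowers (Suc j) = lowers j + (if lower (Suc j) then 1 else 0)"
proof -
  assume "j \<ge> 1"
  then have "{l \<in> {2..Suc j}. lower l} = (if lower (Suc j) then insert (Suc j) else id) {l \<in> {2..j}. lower l}"
    by (auto simp: le_Suc_eq)
  then show ?thesis by (auto simp: lowers_def)
qed

lemma uppers_step: "j \<ge> 1 \<Longrightarrow> uppers (Suc j) = uppers j + (if lower (Suc j) then 0 else 1)"
proof -
  assume "j \<ge> 1"
  then have "{l \<in> {2..Suc j}. \<not> lower l} = (if lower (Suc j) then id else insert (Suc j)) {l \<in> {2..j}. \<not> lower l}"
    by (auto simp: le_Suc_eq)
  then show ?thesis by (auto simp: uppers_def)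
qed

lemma lowers_pred:
  assumes "lower j"
  shows "lowers (j - 1) < lowers j"
proof -
  have "j - 1 \<ge> 1" "Suc (j - 1) = j" using lower_range[OF assms] by linarith+
  then show ?thesis using lowers_step[of "j - 1"] assms by simp
qed

lemma uppers_pred:
  assumes "\<not> lower j" "2 \<le> j"
  shows "uppers (j - 1) < uppers j"
proof -
  have "j - 1 \<ge> 1" "Suc (j - 1) = j" using assms by linarith+
  then show ?thesis using uppers_step[of "j - 1"] assms by simp
qed

lemma lowers_mono: "i \<le> j \<Longrightarrow> lowers i \<le> lowers j" and uppers_mono: "i \<le> j \<Longrightarrow> uppers i \<le> uppers j"
  unfolding lowers_def uppers_def by (auto intro!: card_mono)

lemma LU_sum: "j \<ge> 1 \<Longrightarrow> lowers j + uppers j + 1 = j"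
  by (induction j rule: nat_induct_at_least) (simp_all add: lowers_step uppers_step)

text \<open>The mirror exchanges lower- and upper-barred numbers, so raising \<open>i\<close> by 1
  adds to \<open>lowers i\<close> exactly what it takes from
  \<open>uppers (2 * n - i)\<close>.\<close>

lemma UL_const: "i \<ge> 1 \<Longrightarrow> i \<le> 2 * n - 1 \<Longrightarrow> uppers (2 * n - i) + lowers i = uppers (2 * n - 1)"
proof (induction i rule: nat_induct_at_least)
  case (Suc i)
  then have "lowers (Suc i) = lowers i + (if lower (Suc i) then 1 else 0)"
    by (simp add: lowers_step)
  moreover have "uppers (2 * n - i) = uppers (2 * n - Suc i) + (if lower (2 * n - i) then 0 else 1)"
    using uppers_step[of "2 * n - Suc i"] Suc by (simp add: Suc_diff_Suc)
  moreover have "lower (2 * n - i) \<longleftrightarrow> \<not> lower (Suc i)"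
    using lower_sym[of "Suc i"] Suc by simp
  ultimately show ?case using Suc by auto
qed simp

lemma lowers_last: "lowers (2 * n - 1) = n - 1" and uppers_last: "uppers (2 * n - 1) = n - 1"
proof -
  have *: "1 \<le> 2 * n - 1" "2 * n - (2 * n - 1) = 1" using n_pos by simp_all
  have "lowers (2 * n - 1) = uppers (2 * n - 1)"
    using UL_const[OF *(1) order_refl] unfolding *(2) by simp
  then show "lowers (2 * n - 1) = n - 1" "uppers (2 * n - 1) = n - 1"
    using LU_sum[OF *(1)] n_pos by linarith+
qed

lemma UL: "i \<ge> 1 \<Longrightarrow> i \<le> 2 * n - 1 \<Longrightarrow> uppers (2 * n - i) + lowers i = n - 1"
  using UL_const uppers_last by simp

lemma lowers_le: "i \<le> 2 * n - 1 \<Longrightarrow> lowers i \<le> n - 1" and uppers_le: "i \<le> 2 * n - 1 \<Longrightarrow> uppers i \<le> n - 1"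
  using lowers_mono uppers_mono lowers_last uppers_last by metis+

text \<open>
  Sorting networks as billiards: the strand carrying the value \<open>j\<close> is described by its phase \<open>phase j\<close>,
  an integer modulo \<open>2 * n\<close>; \<open>strand\<close> is the inverse of \<open>phase\<close>. At the \<open>k\<close>-th occurrence (from 0) of the letter
  \<open>i\<close> the values \<open>up_val i k\<close> and \<open>down_val i k\<close> at the places \<open>i\<close> and \<open>i + 1\<close> are exchanged.
\<close>

definition phase :: "nat \<Rightarrow> int" where
  "phase j = (if j = 2 * n \<or> lower j then int (lowers (j - 1)) + 1 else - int (uppers j))"

definition strand :: "int \<Rightarrow> nat" where
  "strand x = inv_into {1..2 * n} phase ((x + int n - 1) mod (2 * int n) - (int n - 1))"

definition up_val :: "nat \<Rightarrow> nat \<Rightarrow> nat" where "up_val i k = strand (int k - int (uppers i))"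
definition down_val :: "nat \<Rightarrow> nat \<Rightarrow> nat" where "down_val i k = strand (int k + int (lowers i) + 1)"

text \<open>The sign separates two kinds: positive phases for 2n and the lower-barred numbers,
  nonpositive ones for 1 and the upper-barred numbers. Within a kind the counts are strictly
  monotone.\<close>

lemma phase_less:
  assumes "1 \<le> i" "i < j" "j \<le> 2 * n"
  shows "phase i \<noteq> phase j"
proof (cases "j = 2 * n \<or> lower j"; cases "lower i")
  assume j: "j = 2 * n \<or> lower j" and i: "lower i"
  have "lowers (i - 1) < lowers i"
    by (rule lowers_pred[OF i])
  also have "lowers i \<le> lowers (j - 1)" using assms by (intro lowers_mono) simp
  finally show ?thesis using i j assms by (simp add: phase_def)
next
  assume j: "\<not> (j = 2 * n \<or> lower j)" and i: "\<not> lower i"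
  have "uppers i \<le> uppers (j - 1)" using assms by (intro uppers_mono) simp
  also have "\<dots> < uppers j"
    by (rule uppers_pred) (use j assms in auto)
  finally show ?thesis using i j assms by (simp add: phase_def)
qed (use assms in \<open>auto simp: phase_def\<close>)

lemma phase_inj: "inj_on phase {1..2 * n}"
  by (rule linorder_inj_onI') (use phase_less in auto)

lemma phase_range: "1 \<le> j \<Longrightarrow> j \<le> 2 * n \<Longrightarrow> phase j \<in> {1 - int n..int n}"
proof -
  assume j: "1 \<le> j" "j \<le> 2 * n"
  show ?thesis
  proof (cases "j = 2 * n \<or> lower j")
    case True
    have "lowers (j - 1) \<le> n - 1" using j by (intro lowers_le) simp
    then show ?thesis using True n_pos by (auto simp: phase_def)
  next
    case False
    have "uppers j \<le> n - 1" using j False by (intro uppers_le) linarith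
    then show ?thesis using False n_pos by (auto simp: phase_def)
  qed
qed

lemma phase_image: "phase ` {1..2 * n} = {1 - int n..int n}"
proof (rule card_subset_eq)
  show "card (phase ` {1..2 * n}) = card {1 - int n..int n}"
    using phase_inj by (simp add: card_image)
qed (use phase_range in auto)

lemma strand_mem: "1 \<le> strand x \<and> strand x \<le> 2 * n"
  and phase_strand: "phase (strand x) = (x + int n - 1) mod (2 * int n) - (int n - 1)"
proof -
  have "0 \<le> (x + int n - 1) mod (2 * int n)" "(x + int n - 1) mod (2 * int n) < 2 * int n"
    using n_pos by simp_all
  then have *: "(x + int n - 1) mod (2 * int n) - (int n - 1) \<in> phase ` {1..2 * n}"
    unfolding phase_image by auto
  show "1 \<le> strand x \<and> strand x \<le> 2 * n"
    using inv_into_into[OF *] by (simp add: strand_def)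
  show "phase (strand x) = (x + int n - 1) mod (2 * int n) - (int n - 1)"
    using f_inv_into_f[OF *] by (simp add: strand_def)
qed

lemma strand_eq_iff: "strand x = strand y \<longleftrightarrow> 2 * int n dvd x - y"
proof -
  have "strand x = strand y \<longleftrightarrow> phase (strand x) = phase (strand y)"
    using phase_inj strand_mem by (auto simp: inj_on_eq_iff)
  also have "\<dots> \<longleftrightarrow> (x + int n - 1) mod (2 * int n) = (y + int n - 1) mod (2 * int n)"
    by (simp add: phase_strand)
  also have "\<dots> \<longleftrightarrow> 2 * int n dvd x - y"
    by (simp add: mod_eq_dvd_iff algebra_simps)
  finally show ?thesis .
qed

lemma strand_small_eq_iff: "\<bar>x - y\<bar> < 2 * int n \<Longrightarrow> strand x = strand y \<longleftrightarrow> x = y"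
  unfolding strand_eq_iff using zdvd_not_zless[of "\<bar>x - y\<bar>" "2 * int n"] by auto

lemma strand_shift: "strand (x + 2 * int n) = strand x"
  by (simp add: strand_eq_iff)

lemma strand_phase: "1 \<le> j \<Longrightarrow> j \<le> 2 * n \<Longrightarrow> strand (phase j) = j"
proof -
  assume j: "1 \<le> j" "j \<le> 2 * n"
  have "phase (strand (phase j)) = phase j"
    using phase_range[OF j] by (simp add: phase_strand)
  then show ?thesis
    using phase_inj strand_mem j by (auto simp: inj_on_eq_iff)
qed

lemma down_val_eq_down_val: "k < n \<Longrightarrow> k' < n \<Longrightarrow> down_val i k = down_val i k' \<longleftrightarrow> k = k'"
  unfolding down_val_def by (subst strand_small_eq_iff) auto

lemma up_val_eq_up_val: "k < n \<Longrightarrow> k' < n \<Longrightarrow> up_val i k = up_val i k' \<longleftrightarrow> k = k'"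
  unfolding up_val_def by (subst strand_small_eq_iff) auto

text \<open>The two phases differ by \<open>k - k' + lowers i + uppers i + 1\<close>, which is
  \<open>k - k' + i\<close> by \<open>LU_sum\<close>. For \<open>i \<le> n\<close> this is smaller
  than a full turn, so congruence is equality.\<close>

lemma down_val_eq_up_val: "1 \<le> i \<Longrightarrow> i \<le> n \<Longrightarrow> k < n \<Longrightarrow> k' < n \<Longrightarrow> down_val i k = up_val i k' \<longleftrightarrow> k' = k + i"
  unfolding down_val_def up_val_def using LU_sum[of i] by (subst strand_small_eq_iff) auto

text \<open>Beyond the middle the coincidence that occurs within range is one full turn away, which
  replaces \<open>i\<close> by \<open>2 * n - i\<close>.\<close>

lemma up_val_eq_down_val:
  "n < i \<Longrightarrow> i < 2 * n \<Longrightarrow> k < n \<Longrightarrow> k' < n \<Longrightarrow> up_val i k = down_val i k' \<longleftrightarrow> k' = k + (2 * n - i)"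
  unfolding down_val_def up_val_def using LU_sum[of i]
  by (subst strand_shift[symmetric], subst strand_small_eq_iff) auto

text \<open>The letters \<open>j - 1\<close> and \<open>j\<close> alternate, and the condition says
  that it is the turn of \<open>j\<close>, which lifts the value at place \<open>j\<close>. Places 1
  and 2n are walls, where only one letter acts.\<close>

definition moves_up :: "(nat \<Rightarrow> nat) \<Rightarrow> nat \<Rightarrow> bool" where
  "moves_up m j \<longleftrightarrow> j = 1 \<or> j \<noteq> 2 * n \<and> m (j - 1) = m j + (if lower j then 1 else 0)"

text \<open>The content of place \<open>j\<close> is named after the next letter that will move it,
  which is meaningful because phases do not change between crossings.\<close>

definition state :: "(nat \<Rightarrow> nat) \<Rightarrow> nat \<Rightarrow> nat" where
  "state m j = (if moves_up m j then up_val j (m j) else down_val (j - 1) (m (j - 1)))"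

lemma state_init: "1 \<le> j \<Longrightarrow> j \<le> 2 * n \<Longrightarrow> state (\<lambda>_. 0) j = j"
proof -
  assume j: "1 \<le> j" "j \<le> 2 * n"
  have "state (\<lambda>_. 0) j = strand (phase j)"
    using lower_range[of j] n_pos j by (auto simp: state_def moves_up_def up_val_def down_val_def phase_def add.commute)
  then show ?thesis using strand_phase j by simp
qed

lemma fire_moves_up:
  assumes "fire n cs m k"
  shows "moves_up m k" "\<not> moves_up m (Suc k)"
proof -
  have k: "1 \<le> k" "k \<le> 2 * n - 1"
    and f: "\<And>j. j \<in> {1..2 * n - 1} \<Longrightarrow> \<bar>int j - int k\<bar> = 1 \<Longrightarrow> m j = (if before cs j k then m k + 1 else m k)"
    using assms by (auto simp: fire_def set_cs)
  show "moves_up m k"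
  proof (cases "k = 1")
    case False
    then have "m (k - 1) = (if lower k then m k + 1 else m k)"
      unfolding lower_def using k by (intro f) auto
    then show ?thesis using False k by (auto simp: moves_up_def)
  qed (simp add: moves_up_def)
  show "\<not> moves_up m (Suc k)"
  proof (cases "Suc k = 2 * n")
    case False
    then have *: "m (Suc k) = (if before cs (Suc k) k then m k + 1 else m k)"
      using k by (intro f) auto
    show ?thesis
      using * before_up[of "Suc k"] False k by (auto simp: moves_up_def split: if_splits)
  qed (use k in \<open>auto simp: moves_up_def\<close>)
qed

lemma fire_state: "fire n cs m k \<Longrightarrow> state m k = up_val k (m k)" "fire n cs m k \<Longrightarrow> state m (Suc k) = down_val k (m k)"
  by (simp_all add: state_def fire_moves_up)

lemma fire_range: "fire n cs m k \<Longrightarrow> 1 \<le> k \<and> k \<le> 2 * n - 1 \<and> m k < n"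
  by (auto simp: fire_def set_cs)

text \<open>A strand has one phase whether it is described by the letter that has just delivered it
  or by the letter that will take it away. This is checked at the two places that change; the walls
  need separate treatment.\<close>

lemma state_fire:
  assumes "fire n cs m k" "1 \<le> j" "j \<le> 2 * n"
  shows "state (m(k := Suc (m k))) j = state m (sA k j)"
proof -
  let ?m = "m(k := Suc (m k))"
  have k: "1 \<le> k" "k \<le> 2 * n - 1" using fire_range[OF assms(1)] by auto
  note moves_up = fire_moves_up[OF assms(1)] and state = fire_state[OF assms(1)]
  consider "j = k" | "j = Suc k" | "j \<noteq> k" "j \<noteq> Suc k" by blast
  then show ?thesis
  proof cases
    case 1
    have "state ?m k = down_val k (m k)"
    proof (cases "k = 1")
      case True
      \<comment> \<open>Reflection at wall 1: letter 1 takes the value up again, and both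
        descriptions have phase \<open>m k + 1\<close>.\<close>
      then show ?thesis by (simp add: state_def moves_up_def up_val_def down_val_def add.commute)
    next
      case False
      then have m: "m (k - 1) = m k + (if lower k then 1 else 0)" using moves_up k by (auto simp: moves_up_def)
      then have "\<not> moves_up ?m k" using False k by (auto simp: moves_up_def)
      moreover have "lowers k = lowers (k - 1) + (if lower k then 1 else 0)"
        using lowers_step[of "k - 1"] False k by simp
      moreover have "state ?m k = down_val (k - 1) (m (k - 1))" if "\<not> moves_up ?m k"
      proof -
        have "k - 1 \<noteq> k" using k by linarith
        then show ?thesis using that by (simp add: state_def)
      qed
      moreover have "int (m (k - 1)) + int (lowers (k - 1)) + 1 = int (m k) + int (lowers k) + 1" if "lowers k = lowers (k - 1) + (if lower k then 1 else 0)"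
        unfolding that m by simp
      ultimately show ?thesis
        by (simp add: down_val_def)
    qed
    then show ?thesis unfolding 1 sA_simps state .
  next
    case 2
    have "state ?m (Suc k) = up_val k (m k)"
    proof (cases "Suc k = 2 * n")
      case True
      then have eq: "k = 2 * n - 1" by simp
      have "state ?m (Suc k) = down_val k (Suc (m k))"
      proof -
        have "\<not> moves_up ?m (Suc k)" using True k by (auto simp: moves_up_def)
        then show ?thesis by (simp add: state_def)
      qed
      \<comment> \<open>Reflection at wall 2n: as \<open>lowers\<close> and \<open>uppers\<close>
        both reach \<open>n - 1\<close> here, the two phases differ by exactly one full
        turn.\<close>
      also have "\<dots> = strand ((int (m k) - int (uppers k)) + 2 * int n)"
        unfolding down_val_def eq lowers_last uppers_last using n_pos by (simp add: algebra_simps of_nat_diff)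
      also have "\<dots> = up_val k (m k)"
        unfolding strand_shift up_val_def ..
      finally show ?thesis .
    next
      case False
      then have bound: "Suc k \<le> 2 * n - 1" using k by simp
      have "m (Suc k) = (if before cs (Suc k) k then m k + 1 else m k)"
        using assms(1) k bound unfolding fire_def set_cs by simp
      then have m: "m (Suc k) = (if lower (Suc k) then m k else m k + 1)"
        using before_up[of "Suc k"] bound k by simp
      have "moves_up ?m (Suc k)" unfolding moves_up_def using False m by simp
      then have "state ?m (Suc k) = up_val (Suc k) (m (Suc k))" by (simp add: state_def)
      moreover have "int (m (Suc k)) - int (uppers (Suc k)) = int (m k) - int (uppers k)"
        unfolding m uppers_step[OF k(1)] by simp
      ultimately show ?thesis by (simp add: up_val_def)
    qed
    then show ?thesis unfolding 2 sA_simps state .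
  next
    case 3
    then have "j - 1 \<noteq> k" using k by linarith
    then have "?m j = m j" "?m (j - 1) = m (j - 1)" using 3 by simp_all
    then have "state ?m j = state m j" unfolding state_def moves_up_def by (simp only:)
    then show ?thesis using 3 by (simp add: sA_simps)
  qed
qed

lemma admissible_set_range: "admissible n cs us \<Longrightarrow> set us \<subseteq> {1..2 * n - 1}"
  using admissible_set set_cs by blast

lemma sA_range: "k \<in> {1..2 * n - 1} \<Longrightarrow> j \<in> {1..2 * n} \<Longrightarrow> sA k j \<in> {1..2 * n}"
  using permutes_in_image[OF sA_permutes] by blast

lemma word_prod_state:
  assumes "admissible n cs us" "j \<in> {1..2 * n}"
  shows "word_prod sA us j = state (count_list us) j"
  using assms
proof (induction us arbitrary: j rule: rev_induct)
  case Nil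
  have "count_list ([] :: nat list) = (\<lambda>_. 0)" by (simp add: fun_eq_iff)
  then show ?case using state_init Nil by simp
next
  case (snoc k us)
  then have f: "fire n cs (count_list us) k" and us: "admissible n cs us"
    by (simp_all add: admissible_snoc)
  have "k \<in> {1..2 * n - 1}" using fire_range[OF f] by simp
  then have "word_prod sA (us @ [k]) j = state (count_list us) (sA k j)"
    using snoc.IH[OF us] snoc.prems(2) sA_range by simp
  also have "\<dots> = state ((count_list us)(k := Suc (count_list us k))) j"
    using state_fire[OF f] snoc.prems by simp
  also have "(count_list us)(k := Suc (count_list us k)) = count_list (us @ [k])"
    by (auto simp: fun_eq_iff)
  finally show ?case .
qed

text \<open>With all counts equal to \<open>n\<close>, the value at place \<open>j\<close> has phase
  \<open>phase j + n\<close>. By \<open>UL\<close> the phases of \<open>j\<close> and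
  \<open>2 * n + 1 - j\<close> are half a turn apart.\<close>

lemma admissible_full_longest:
  assumes "admissible n cs us" "\<And>i. i \<in> {1..2 * n - 1} \<Longrightarrow> count_list us i = n" "j \<in> {1..2 * n}"
  shows "word_prod sA us j = 2 * n + 1 - j"
proof -
  have c: "count_list us i = n" if "1 \<le> i" "i \<le> 2 * n - 1" for i using assms(2) that by simp
  have "state (count_list us) j = strand (phase (2 * n + 1 - j))"
  proof -
    consider "j = 1" | "j = 2 * n" | "2 \<le> j" "j \<le> 2 * n - 1" "lower j" | "2 \<le> j" "j \<le> 2 * n - 1" "\<not> lower j"
      using assms(3) by fastforce
    then show ?thesis
    proof cases
      case 1
      then show ?thesis
        using c[of 1] n_pos lowers_last by (simp add: state_def moves_up_def up_val_def phase_def)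
    next
      case 2
      have "state (count_list us) j = strand (int n + int (n - 1) + 1)"
        using 2 c[of "2 * n - 1"] n_pos lowers_last by (simp add: state_def moves_up_def down_val_def)
      also have "int n + int (n - 1) + 1 = 0 + 2 * int n" using n_pos by simp
      also have "strand (0 + 2 * int n) = strand (phase 1)"
        unfolding strand_shift using lower_range[of 1] n_pos by (auto simp: phase_def)
      finally show ?thesis using 2 by simp
    next
      case 3
      have "state (count_list us) j = strand (int n + int (lowers (j - 1)) + 1)"
        using 3 c[of j] c[of "j - 1"] by (simp add: state_def moves_up_def down_val_def)
      also have "int n + int (lowers (j - 1)) + 1 = - int (uppers (2 * n + 1 - j)) + 2 * int n"
      proof -
        have "1 \<le> j - 1" "j - 1 \<le> 2 * n - 1" "2 * n - (j - 1) = 2 * n + 1 - j"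
          using 3 by linarith+
        then have "uppers (2 * n + 1 - j) + lowers (j - 1) = n - 1" using UL[of "j - 1"] by simp
        then show ?thesis using n_pos by linarith
      qed
      also have "strand \<dots> = strand (phase (2 * n + 1 - j))"
      proof -
        have "2 * n + 1 - j \<noteq> 2 * n" using 3 by linarith
        then show ?thesis unfolding strand_shift using lower_sym[of j] 3 by (simp add: phase_def)
      qed
      finally show ?thesis .
    next
      case 4
      have "state (count_list us) j = strand (int n - int (uppers j))"
      proof -
        have "1 \<le> j - 1" "j - 1 \<le> 2 * n - 1" "1 \<le> j" "j \<noteq> 2 * n"
          using 4 n_pos by linarith+
        then show ?thesis
          using 4 c[of j] c[of "j - 1"] by (simp add: state_def moves_up_def up_val_def)
      qed
      also have "int n - int (uppers j) = int (lowers (2 * n - j)) + 1"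
      proof -
        have "1 \<le> 2 * n - j" "2 * n - j \<le> 2 * n - 1" "2 * n - (2 * n - j) = j"
          using 4 by linarith+
        then have "uppers j + lowers (2 * n - j) = n - 1" using UL[of "2 * n - j"] by simp
        then show ?thesis using n_pos by linarith
      qed
      also have "\<dots> = phase (2 * n + 1 - j)"
        using lower_sym[of j] 4 by (simp add: phase_def)
      finally show ?thesis .
    qed
  qed
  moreover have "1 \<le> 2 * n + 1 - j" "2 * n + 1 - j \<le> 2 * n"
    using assms(3) by auto
  ultimately show ?thesis
    unfolding word_prod_state[OF assms(1,3)] by (simp only: strand_phase)
qed

text \<open>An excluded column is upper-barred, and a value of that kind is reached only by wrapping
  past phase \<open>n\<close>. It then lies so far to the right that \<open>2 * n - j < i\<close>,
  so the exclusion does not apply to row \<open>i\<close>.\<close>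

lemma down_val_recorded:
  assumes "1 \<le> i" "i \<le> n" "k < n"
  shows "(i, down_val i k) \<in> set (recorded n cs)"
proof -
  define x where "x = int k + int (lowers i) + 1"
  define j where "j = down_val i k"
  have j: "j = strand x" by (simp add: j_def down_val_def x_def)
  have jr: "1 \<le> j" "j \<le> 2 * n" using strand_mem j by auto
  have Li: "lowers i \<le> n - 1" using assms by (intro lowers_le) simp
  have lb: "lower_barred cs j \<longleftrightarrow> lower j"
    by (simp add: lower_barred_def lower_def before_def)
  have main: "i < j \<and> \<not> (upper_barred n cs j \<and> i \<le> min (j - 1) (2 * n - j))"
  proof (cases "x \<le> int n")
    case True
    have "phase j = x"
      unfolding j phase_strand using True n_pos by (auto simp: x_def)
    then have l: "j = 2 * n \<or> lower j" and "int (lowers i) + 1 \<le> phase j"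
      by (auto simp: phase_def x_def split: if_splits)
    then have Lj: "lowers i \<le> lowers (j - 1)" by (simp add: phase_def)
    have "i < j"
    proof (cases "j = 2 * n")
      case False
      then have "lower j" using l by simp
      then have "lowers (j - 1) < lowers j"
        by (rule lowers_pred)
      then have "lowers i < lowers j" using Lj by simp
      then show ?thesis using lowers_mono[of j i] by (metis linorder_not_less)
    qed (use assms in simp)
    then show ?thesis
      using l lb by (auto simp: upper_barred_def)
  next
    case False
    \<comment> \<open>Here \<open>n < x < 2 * n\<close>, so the reduction removes exactly one
      turn.\<close>
    have "(x + int n - 1) mod (2 * int n) = x + int n - 1 - 2 * int n"
      by (rule int_mod_pos_eq[where q = 1]) (use False Li assms n_pos in \<open>auto simp: x_def of_nat_diff\<close>)
    then have kj: "phase j = x - 2 * int n"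
      unfolding j phase_strand by simp
    then have "phase j < 0" using Li assms n_pos by (auto simp: x_def)
    then have l: "j \<noteq> 2 * n" "\<not> lower j" and "phase j = - int (uppers j)"
      by (auto simp: phase_def split: if_splits)
    then have uppers: "uppers j + lowers i \<ge> n" using kj assms by (simp add: x_def)
    have "uppers (2 * n - (2 * n - j)) + lowers (2 * n - j) = n - 1"
      using l jr by (intro UL) auto
    then have "lowers (2 * n - j) < lowers i" using uppers jr n_pos by simp
    then have "2 * n - j < i" using lowers_mono[of i "2 * n - j"] by (metis linorder_not_less)
    then show ?thesis using assms by auto
  qed
  then show ?thesis
    unfolding j_def[symmetric] recorded_def using assms jr by auto
qed

end

section \<open>Permutation matrices and heap coordinates\<close>

context symmetric_orientation begin

text \<open>The coefficient of \<open>e_i - e_(i+1)\<close> in column \<open>j\<close>. The value 0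
  at \<open>i = 0\<close> and \<open>i = 2 * n\<close> lets one formula in \<open>matrix\<close>
  cover the first and the last row.\<close>

definition column_sum :: "(nat \<Rightarrow> nat \<Rightarrow> real) \<Rightarrow> nat \<Rightarrow> nat \<Rightarrow> real" where
  "column_sum z i j = (if 1 \<le> i \<and> i \<le> 2 * n - 1
    then \<Sum>k<n. z i k * (of_bool (j = down_val i k) - of_bool (j = up_val i k)) else 0)"

definition matrix :: "(nat \<Rightarrow> nat \<Rightarrow> real) \<Rightarrow> nat \<times> nat \<Rightarrow> real" where
  "matrix z = (\<lambda>(r, j). if r \<in> {1..2 * n} then of_bool (j = r) + column_sum z r j - column_sum z (r - 1) j else 0)"

lemma column_sum_fire:
  assumes "fire n cs m k"
  shows "column_sum (\<lambda>i l. of_bool (l < (m(k := Suc (m k))) i)) i j =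
    column_sum (\<lambda>i l. of_bool (l < m i)) i j +
      (if i = k then of_bool (j = down_val k (m k)) - of_bool (j = up_val k (m k)) else 0)"
proof (cases "i = k")
  case True
  note r = fire_range[OF assms]
  let ?f = "\<lambda>l. of_bool (j = down_val k l) - of_bool (j = up_val k l) :: real"
  have "(\<Sum>l<n. of_bool (l < Suc (m k)) * ?f l) =
      (\<Sum>l<n. of_bool (l < m k) * ?f l + (if l = m k then ?f l else 0))"
    by (rule sum.cong) auto
  also have "\<dots> = (\<Sum>l<n. of_bool (l < m k) * ?f l) + ?f (m k)"
    using r by (simp add: sum.distrib)
  finally show ?thesis using r True by (simp add: column_sum_def)
qed (simp add: column_sum_def)

lemma perm_matrix_matrix:
  assumes "admissible n cs us"
  shows "perm_matrix n (word_prod sA us) = matrix (\<lambda>i k. of_bool (k < count_list us i))"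
  using assms
proof (induction us rule: rev_induct)
  case Nil
  have "column_sum (\<lambda>i k. of_bool (k < (0 :: nat))) i j = 0" for i j
    by (simp add: column_sum_def)
  then show ?case by (auto simp: perm_matrix_def matrix_def fun_eq_iff)
next
  case (snoc k us)
  then have f: "fire n cs (count_list us) k" and us: "admissible n cs us"
    by (simp_all add: admissible_snoc)
  have k: "1 \<le> k" "k \<le> 2 * n - 1" using fire_range[OF f] by auto
  define w where "w = word_prod sA us"
  define m where "m = count_list us"
  have wk: "w k = up_val k (m k)" "w (Suc k) = down_val k (m k)"
    using k by (simp_all add: w_def m_def word_prod_state[OF us] fire_state[OF f])
  have m': "count_list (us @ [k]) = m(k := Suc (m k))"
    by (auto simp: fun_eq_iff m_def)
  have IH: "of_bool (j = w r) = of_bool (j = r) + column_sum (\<lambda>i k. of_bool (k < m i)) r j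
      - column_sum (\<lambda>i k. of_bool (k < m i)) (r - 1) j" if "r \<in> {1..2 * n}" for r j
    using fun_cong[OF snoc.IH[OF us], of "(r, j)"] that
    by (simp add: perm_matrix_def matrix_def w_def m_def of_bool_def)
  have "perm_matrix n (w \<circ> sA k) (r, j) = matrix (\<lambda>i l. of_bool (l < (m(k := Suc (m k))) i)) (r, j)" for r j
  proof (cases "r \<in> {1..2 * n}")
    case True
    have "matrix (\<lambda>i l. of_bool (l < (m(k := Suc (m k))) i)) (r, j) = of_bool (j = w r)
       + (if r = k then of_bool (j = down_val k (m k)) - of_bool (j = up_val k (m k)) else 0)
       - (if r - 1 = k then of_bool (j = down_val k (m k)) - of_bool (j = up_val k (m k)) else 0)"
      using True unfolding matrix_def column_sum_fire[OF f[folded m_def]] IH[OF True] by simp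
    also have "\<dots> = of_bool (j = w (sA k r))"
    proof -
      have k1: "k - 1 \<noteq> k" using k by linarith
      consider "r = k" | "r = Suc k" | "r \<noteq> k" "r \<noteq> Suc k" "r - 1 \<noteq> k"
        using True by fastforce
      then show ?thesis
        by cases (use k1 in \<open>simp_all add: sA_simps wk\<close>)
    qed
    also have "\<dots> = perm_matrix n (w \<circ> sA k) (r, j)"
      using True by (simp add: perm_matrix_def of_bool_def)
    finally show ?thesis by simp
  qed (auto simp: perm_matrix_def matrix_def)
  then have "perm_matrix n (w \<circ> sA k) = matrix (\<lambda>i l. of_bool (l < (m(k := Suc (m k))) i))"
    by (metis surj_pair ext)
  moreover have "word_prod sA (us @ [k]) = w \<circ> sA k"
    by (simp add: w_def)
  ultimately show ?case
    unfolding m' by (simp only:)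
qed

text \<open>Summation over rows telescopes the differences in \<open>matrix\<close>; the subtracted
  identity is the matrix of the empty ideal.\<close>

definition row_sum :: "(nat \<times> nat \<Rightarrow> real) \<Rightarrow> nat \<Rightarrow> nat \<Rightarrow> real" where
  "row_sum X i j = (\<Sum>r=1..i. X (r, j) - of_bool (j = r))"

lemma row_sum_matrix: "i \<le> 2 * n \<Longrightarrow> row_sum (matrix z) i j = column_sum z i j"
proof (induction i)
  case (Suc i)
  then show ?case by (simp add: row_sum_def matrix_def)
qed (simp add: row_sum_def column_sum_def)

text \<open>For \<open>i \<le> n\<close> the partial sum in column \<open>down_val i k\<close> is
  \<open>z i k - z i (k + i)\<close>, since the only other value coinciding with it is
  \<open>up_val i (k + i)\<close>. For larger \<open>i\<close> column \<open>up_val i k\<close>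
  holds \<open>z i (k + (2 * n - i)) - z i k\<close>. Solving for \<open>z i k\<close> gives the
  recursion. The default 0 at \<open>i = 0\<close> and \<open>i \<ge> 2 * n\<close> keeps its steps
  positive.\<close>

function coord :: "(nat \<times> nat \<Rightarrow> real) \<Rightarrow> nat \<Rightarrow> nat \<Rightarrow> real" where
  "coord X i k = (if k \<ge> n \<or> i = 0 \<or> i \<ge> 2 * n then 0
     else if i \<le> n then row_sum X i (down_val i k) + coord X i (k + i)
     else - row_sum X i (up_val i k) + coord X i (k + (2 * n - i)))"
  by auto
termination by (relation "measure (\<lambda>(X, i, k). n - k)") auto

declare coord.simps [simp del]

lemma coord_induct [case_names beyond left right]:
  assumes "\<And>k. k \<ge> n \<Longrightarrow> P k"
    and "\<And>k. k < n \<Longrightarrow> i \<le> n \<Longrightarrow> P (k + i) \<Longrightarrow> P k"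
    and "\<And>k. k < n \<Longrightarrow> n < i \<Longrightarrow> P (k + (2 * n - i)) \<Longrightarrow> P k"
    and "1 \<le> i" "i \<le> 2 * n - 1"
  shows "P (k :: nat)"
proof (induction "n - k" arbitrary: k rule: less_induct)
  case less
  show ?case
  proof (cases "k \<ge> n"; cases "i \<le> n")
    assume k: "\<not> k \<ge> n" and i: "i \<le> n"
    then have "P (k + i)" using assms(4) by (intro less) simp
    then show ?thesis using assms(2) k i by simp
  next
    assume k: "\<not> k \<ge> n" and i: "\<not> i \<le> n"
    have "0 < 2 * n - i" using assms(4,5) by linarith
    then have "P (k + (2 * n - i))" using k by (intro less) simp
    then show ?thesis using assms(3) k i by simp
  qed (use assms(1) in auto)
qed

lemma coord_out: "k \<ge> n \<Longrightarrow> coord X i k = 0"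
  by (simp add: coord.simps)

lemma coord_low: "1 \<le> i \<Longrightarrow> i \<le> n \<Longrightarrow> k < n \<Longrightarrow> coord X i k = row_sum X i (down_val i k) + coord X i (k + i)"
  using n_pos by (subst coord.simps) auto

lemma coord_high:
  "n < i \<Longrightarrow> i \<le> 2 * n - 1 \<Longrightarrow> k < n \<Longrightarrow> coord X i k = - row_sum X i (up_val i k) + coord X i (k + (2 * n - i))"
  by (subst coord.simps) auto

lemma coord_matrix:
  assumes "1 \<le> i" "i \<le> 2 * n - 1"
  shows "coord (matrix z) i k = (if k < n then z i k else 0)"
proof (induction k rule: coord_induct[where i = i])
  case (left k)
  have "column_sum z i (down_val i k) = (\<Sum>l<n. (if l = k then z i l else 0) - (if l = k + i then z i l else 0))"
    unfolding column_sum_def using assms left by (auto intro!: sum.cong simp: down_val_eq_down_val down_val_eq_up_val)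
  also have "\<dots> = z i k - (if k + i < n then z i (k + i) else 0)"
    using left by (simp add: sum_subtractf)
  finally show ?case
    using left assms by (simp add: coord_low row_sum_matrix)
next
  case (right k)
  have "column_sum z i (up_val i k) =
      (\<Sum>l<n. (if l = k + (2 * n - i) then z i l else 0) - (if l = k then z i l else 0))"
    unfolding column_sum_def using assms right by (auto intro!: sum.cong simp: up_val_eq_up_val up_val_eq_down_val)
  also have "\<dots> = (if k + (2 * n - i) < n then z i (k + (2 * n - i)) else 0) - z i k"
    using right by (simp add: sum_subtractf)
  finally show ?case
    using right assms by (simp add: coord_high row_sum_matrix)
qed (use assms in \<open>auto simp: coord_out\<close>)

lemma row_sum_affine:
  assumes "u + v = (1 :: real)"
  shows "row_sum (\<lambda>p. u * X p + v * Y p) i j = u * row_sum X i j + v * row_sum Y i j"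
proof -
  have "u * X (r, j) + v * Y (r, j) - of_bool (j = r) =
      u * (X (r, j) - of_bool (j = r)) + v * (Y (r, j) - of_bool (j = r))" for r
    using arg_cong[OF assms, of "\<lambda>t. t * of_bool (j = r)"] by (simp add: algebra_simps)
  then show ?thesis
    by (simp only: row_sum_def sum.distrib sum_distrib_left)
qed

lemma coord_affine:
  assumes "u + v = (1 :: real)" "1 \<le> i" "i \<le> 2 * n - 1"
  shows "coord (\<lambda>p. u * X p + v * Y p) i k = u * coord X i k + v * coord Y i k"
proof (induction k rule: coord_induct[where i = i])
  case (left k)
  then show ?case using assms(2) by (simp add: coord_low row_sum_affine[OF assms(1)] algebra_simps)
next
  case (right k)
  then show ?case using assms(3) by (simp add: coord_high row_sum_affine[OF assms(1)] algebra_simps)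
qed (use assms in \<open>auto simp: coord_out\<close>)

lemma coord_Ints:
  assumes "\<And>p. X p \<in> \<int>" "1 \<le> i" "i \<le> 2 * n - 1"
  shows "coord X i k \<in> \<int>"
proof -
  have row_sum: "row_sum X i j \<in> \<int>" for j
    unfolding row_sum_def using assms(1) by (intro Ints_sum Ints_diff) (auto simp: of_bool_def)
  show ?thesis
  proof (induction k rule: coord_induct[where i = i])
    case (left k)
    then show ?case using assms(2) row_sum by (simp add: coord_low)
  next
    case (right k)
    then show ?case using assms(3) row_sum coord_high[of i k X] by (simp add: Ints_diff)
  qed (use assms in \<open>auto simp: coord_out\<close>)
qed

lemma column_sum_cong: "(\<And>k. k < n \<Longrightarrow> z i k = z' i k) \<Longrightarrow> column_sum z i j = column_sum z' i j"
  by (simp add: column_sum_def)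

lemma matrix_cong:
  assumes "\<And>i k. 1 \<le> i \<Longrightarrow> i \<le> 2 * n - 1 \<Longrightarrow> k < n \<Longrightarrow> z i k = z' i k"
  shows "matrix z = matrix z'"
proof -
  have "column_sum z i j = column_sum z' i j" for i j
    unfolding column_sum_def using assms by (auto intro!: sum.cong)
  then have eq: "column_sum z = column_sum z'" by blast
  show ?thesis unfolding matrix_def eq ..
qed

lemma column_sum_linear: "column_sum (\<lambda>i k. u * z i k + v * z' i k) i j = u * column_sum z i j + v * column_sum z' i j"
proof -
  have "(u * z i k + v * z' i k) * d = u * (z i k * d) + v * (z' i k * d)" for k d
    by (simp add: algebra_simps)
  then show ?thesis
    by (simp only: column_sum_def sum.distrib sum_distrib_left[symmetric]) simp
qed

lemma matrix_affine:
  assumes "u + v = (1 :: real)"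
  shows "matrix (\<lambda>i k. u * z i k + v * z' i k) = (\<lambda>p. u * matrix z p + v * matrix z' p)"
proof -
  have "of_bool b = u * of_bool b + v * of_bool b" for b
    using assms by (metis distrib_right mult_1)
  then show ?thesis
    by (auto simp: matrix_def fun_eq_iff column_sum_linear algebra_simps)
qed

lemma matrix_Ints:
  assumes "\<And>i k. 1 \<le> i \<Longrightarrow> i \<le> 2 * n - 1 \<Longrightarrow> k < n \<Longrightarrow> z i k \<in> \<int>"
  shows "matrix z p \<in> \<int>"
proof -
  have "column_sum z i j \<in> \<int>" for i j
    unfolding column_sum_def using assms by (auto intro!: Ints_sum Ints_mult Ints_diff simp: of_bool_def)
  then show ?thesis
    by (auto simp: matrix_def of_bool_def split: prod.split)
qed

text \<open>\<open>coord\<close> reads the counts off the permutation matrix; conversely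
  \<open>state\<close> computes the permutation from the counts alone.\<close>

lemma word_prod_determined:
  assumes "admissible n cs us" "admissible n cs vs"
  shows "word_prod sA us = word_prod sA vs \<longleftrightarrow> count_list us = count_list vs"
proof
  assume "word_prod sA us = word_prod sA vs"
  then have *: "matrix (\<lambda>i k. of_bool (k < count_list us i)) = matrix (\<lambda>i k. of_bool (k < count_list vs i))"
    using perm_matrix_matrix assms by metis
  have "count_list us i = count_list vs i" for i
  proof (cases "i \<in> {1..2 * n - 1}")
    case True
    have "k < count_list us i \<longleftrightarrow> k < count_list vs i" if "k < n" for k
    proof -
      have "of_bool (k < count_list us i) = (of_bool (k < count_list vs i) :: real)"
        using arg_cong[OF *, of "\<lambda>X. coord X i k"] True that by (simp add: coord_matrix)
      then show ?thesis by (simp add: of_bool_eq_iff)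
    qed
    then show ?thesis
      using admissible_count_le[OF assms(1), of i] admissible_count_le[OF assms(2), of i]
      by (meson linorder_not_less nle_le order_le_less_trans order_less_irrefl order_less_le_trans)
  next
    case False
    then have "i \<notin> set us" "i \<notin> set vs"
      using assms admissible_set_range by blast+
    then show ?thesis by simp
  qed
  then show "count_list us = count_list vs" by blast
next
  assume c: "count_list us = count_list vs"
  have "word_prod sA us j = word_prod sA vs j" for j
  proof (cases "j \<in> {1..2 * n}")
    case True
    then show ?thesis using word_prod_state assms c by simp
  next
    case False
    then show ?thesis
      using word_prod_sA_permutes[OF admissible_set_range[OF assms(1)]]
        word_prod_sA_permutes[OF admissible_set_range[OF assms(2)]] by (simp add: permutes_not_in)
  qed
  then show "word_prod sA us = word_prod sA vs" by blast
qed

end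

section \<open>Lengths in types A and B\<close>

definition inversions :: "nat \<Rightarrow> (nat \<Rightarrow> nat) \<Rightarrow> (nat \<times> nat) set" where
  "inversions N w = {(i, j). 1 \<le> i \<and> i < j \<and> j \<le> N \<and> w j < w i}"

definition pairs :: "nat \<Rightarrow> (nat \<times> nat) set" where
  "pairs N = {(i, j). 1 \<le> i \<and> i < j \<and> j \<le> N}"

lemma finite_pairs: "finite (pairs N)"
  by (rule finite_subset[of _ "{..N} \<times> {..N}"]) (auto simp: pairs_def)

lemma finite_inversions: "finite (inversions N w)"
  by (rule finite_subset[OF _ finite_pairs[of N]]) (auto simp: inversions_def pairs_def)

lemma sA_comp: "sA k \<circ> sA k = id"
  by (simp add: sA_def fun_eq_iff)

lemma sA_sA [simp]: "sA k (sA k j) = j"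
  by (simp add: sA_def)

lemma sA_less:
  assumes "i < j" "(i, j) \<noteq> (k, Suc k)"
  shows "sA k i < sA k j"
  using assms unfolding sA_def Transposition.transpose_def by auto

text \<open>Swapping the places \<open>k\<close> and \<open>k + 1\<close> preserves the order of
  every other pair of places, so it maps the remaining inversions injectively. Since it is an
  involution, the inequality can be used in both directions.\<close>

lemma inversions_step_aux:
  assumes "1 \<le> k" "Suc k \<le> N"
  shows "card (inversions N (w \<circ> sA k) - {(k, Suc k)}) \<le> card (inversions N w - {(k, Suc k)})"
proof (rule card_inj_on_le)
  show "inj_on (map_prod (sA k) (sA k)) (inversions N (w \<circ> sA k) - {(k, Suc k)})"
    by (rule inj_on_inverseI[where g = "map_prod (sA k) (sA k)"]) auto
  show "map_prod (sA k) (sA k) ` (inversions N (w \<circ> sA k) - {(k, Suc k)})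
      \<subseteq> inversions N w - {(k, Suc k)}"
  proof
    fix p assume "p \<in> map_prod (sA k) (sA k) ` (inversions N (w \<circ> sA k) - {(k, Suc k)})"
    then obtain i j where p: "p = (sA k i, sA k j)"
      and ij: "(i, j) \<in> inversions N (w \<circ> sA k)" "(i, j) \<noteq> (k, Suc k)" by auto
    then have r: "1 \<le> i" "i < j" "j \<le> N" by (auto simp: inversions_def)
    have s: "sA k i < sA k j" by (rule sA_less[OF r(2) ij(2)])
    have "1 \<le> sA k i" "sA k j \<le> N"
      using r assms unfolding sA_def Transposition.transpose_def by auto
    then have "(sA k i, sA k j) \<in> inversions N w"
      using s ij by (simp add: inversions_def)
    moreover have "(sA k i, sA k j) \<noteq> (k, Suc k)"
    proof
      assume "(sA k i, sA k j) = (k, Suc k)"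
      then have "i = Suc k" "j = k" by (metis Pair_inject sA_sA sA_simps(1), metis Pair_inject sA_sA sA_simps(2))
      then show False using r by simp
    qed
    ultimately show "p \<in> inversions N w - {(k, Suc k)}" unfolding p by simp
  qed
qed (simp add: finite_inversions)

lemma inversions_step:
  assumes "1 \<le> k" "Suc k \<le> N"
  shows "w k < w (Suc k) \<Longrightarrow> card (inversions N (w \<circ> sA k)) = Suc (card (inversions N w))"
    and "w (Suc k) < w k \<Longrightarrow> card (inversions N w) = Suc (card (inversions N (w \<circ> sA k)))"
proof -
  have eq: "card (inversions N (w \<circ> sA k) - {(k, Suc k)}) = card (inversions N w - {(k, Suc k)})"
    using inversions_step_aux[OF assms, of w] inversions_step_aux[OF assms, of "w \<circ> sA k"]
    unfolding comp_assoc sA_comp comp_id by (rule antisym)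
  have m: "(k, Suc k) \<in> inversions N u \<longleftrightarrow> u (Suc k) < u k" for u
    using assms by (simp add: inversions_def)
  have c: "card (inversions N u) = card (inversions N u - {(k, Suc k)}) + (if u (Suc k) < u k then 1 else 0)" for u
    using card_Suc_Diff1[OF finite_inversions, of "(k, Suc k)" N u] m[of u] by auto
  show "w k < w (Suc k) \<Longrightarrow> card (inversions N (w \<circ> sA k)) = Suc (card (inversions N w))"
    "w (Suc k) < w k \<Longrightarrow> card (inversions N w) = Suc (card (inversions N (w \<circ> sA k)))"
    using eq c[of w] c[of "w \<circ> sA k"] by (simp_all add: sA_simps)
qed

lemma ascending_permutation_id:
  assumes "w permutes {1..N}" "\<And>k. 1 \<le> k \<Longrightarrow> Suc k \<le> N \<Longrightarrow> w k < w (Suc k)"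
  shows "w = id"
proof (rule permutes_natset_ge[OF assms(1)], rule ballI)
  fix j assume "j \<in> {1..N}"
  then have "1 \<le> j" "j \<le> N" by simp_all
  then show "j \<le> w j"
  proof (induction j rule: nat_induct_at_least)
    case base
    then have "w 1 \<in> {1..N}" using permutes_in_image[OF assms(1)] by simp
    then show ?case by simp
  next
    case (Suc j)
    then have "j \<le> w j" "w j < w (Suc j)" using assms(2)[of j] by simp_all
    then show ?case by simp
  qed
qed

lemma permutation_descent:
  assumes "w permutes {1..N}" "w \<noteq> id"
  obtains k where "1 \<le> k" "Suc k \<le> N" "w (Suc k) < w k"
proof -
  have "\<exists>k. 1 \<le> k \<and> Suc k \<le> N \<and> \<not> w k < w (Suc k)"
    using ascending_permutation_id assms by blast
  then obtain k where k: "1 \<le> k" "Suc k \<le> N" "\<not> w k < w (Suc k)" by blast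
  moreover have "w k \<noteq> w (Suc k)"
    using inj_eq[OF permutes_inj[OF assms(1)], of k "Suc k"] by simp
  ultimately show thesis using that by fastforce
qed

definition reversal :: "nat \<Rightarrow> nat \<Rightarrow> nat" where
  "reversal N j = (if j \<in> {1..N} then N + 1 - j else j)"

lemma reversal_reversal [simp]: "reversal N (reversal N j) = j"
  by (auto simp: reversal_def)

lemma reversal_permutes: "reversal N permutes {1..N}"
  by (rule bij_imp_permutes) (auto simp: reversal_def intro!: bij_betwI[where g = "reversal N"])

lemma card_pairs: "card (pairs N) * 2 = N * (N - 1)"
proof (induction N)
  case 0
  have "pairs 0 = {}" by (auto simp: pairs_def)
  then show ?case by simp
next
  case (Suc N)
  have "pairs (Suc N) = pairs N \<union> (\<lambda>i. (i, Suc N)) ` {1..N}"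
    by (auto simp: pairs_def le_Suc_eq)
  moreover have "card (pairs N \<union> (\<lambda>i. (i, Suc N)) ` {1..N}) =
      card (pairs N) + card ((\<lambda>i. (i, Suc N)) ` {1..N})"
    by (rule card_Un_disjoint[OF finite_pairs]) (auto simp: pairs_def)
  moreover have "card ((\<lambda>i. (i, Suc N)) ` {1..N}) = N"
    by (subst card_image) (auto simp: inj_on_def)
  ultimately show ?case
    using Suc by (cases N) auto
qed

lemma inversions_reversal: "inversions N (reversal N) = pairs N"
  by (auto simp: inversions_def reversal_def pairs_def)

text \<open>Composition with the reversal turns ascents into descents, so a permutation other than
  the reversal has an ascent, and that pair is missing from its inversions.\<close>

lemma inversions_less_reversal:
  assumes "w permutes {1..N}" "w \<noteq> reversal N"
  shows "card (inversions N w) < card (inversions N (reversal N))"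
proof (rule psubset_card_mono[OF finite_inversions])
  have "\<exists>k. 1 \<le> k \<and> Suc k \<le> N \<and> w k < w (Suc k)"
  proof -
    have "reversal N \<circ> w \<noteq> id"
    proof
      assume "reversal N \<circ> w = id"
      then have "w j = reversal N j" for j by (metis comp_apply id_apply reversal_reversal)
      with assms(2) show False by blast
    qed
    then obtain k where k: "1 \<le> k" "Suc k \<le> N" "(reversal N \<circ> w) (Suc k) < (reversal N \<circ> w) k"
      using permutation_descent[OF permutes_compose[OF assms(1) reversal_permutes]] by metis
    have "w k \<in> {1..N}" "w (Suc k) \<in> {1..N}"
      using permutes_in_image[OF assms(1)] k by simp_all
    then have "w k < w (Suc k)"
      using k by (auto simp: reversal_def)
    with k show ?thesis by blast
  qed
  then obtain k where k: "1 \<le> k" "Suc k \<le> N" "w k < w (Suc k)" by blast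
  have "(k, Suc k) \<in> pairs N - inversions N w"
    using k by (simp add: pairs_def inversions_def)
  moreover have "inversions N w \<subseteq> pairs N"
    by (auto simp: pairs_def inversions_def)
  ultimately show "inversions N w \<subset> inversions N (reversal N)"
    unfolding inversions_reversal by blast
qed

lemma length_statistic_A:
  "length_statistic sA (JA n) (groupA n) (\<lambda>w. card (inversions (2 * n) w))"
proof
  show "id \<in> groupA n" by (simp add: groupA_def permutes_id)
  have "inversions (2 * n) id = {}" by (auto simp: inversions_def)
  then show "card (inversions (2 * n) id) = 0" by simp
  fix w i assume w: "w \<in> groupA n"
  show "w \<circ> sA i \<in> groupA n" "card (inversions (2 * n) (w \<circ> sA i)) \<le> Suc (card (inversions (2 * n) w))"
    if i: "i \<in> JA n"
  proof -
    show "w \<circ> sA i \<in> groupA n"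
      using w i sA_permutes[of i n] by (auto simp: groupA_def JA_def intro: permutes_compose)
    have "inj w" using w permutes_inj by (auto simp: groupA_def)
    then have "w i \<noteq> w (Suc i)" by (simp add: inj_eq)
    then show "card (inversions (2 * n) (w \<circ> sA i)) \<le> Suc (card (inversions (2 * n) w))"
      using inversions_step[of i "2 * n" w] i by (cases "w i < w (Suc i)") (auto simp: JA_def)
  qed
  show "\<exists>i\<in>JA n. card (inversions (2 * n) w) = Suc (card (inversions (2 * n) (w \<circ> sA i)))" if "w \<noteq> id"
  proof -
    obtain k where "1 \<le> k" "Suc k \<le> 2 * n" "w (Suc k) < w k"
      using permutation_descent[of w "2 * n"] \<open>w \<noteq> id\<close> w unfolding groupA_def by blast
    then show ?thesis
      using inversions_step(2)[of k "2 * n" w] by (auto simp: JA_def intro!: bexI[of _ k])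
  qed
qed (rule sA_comp)

lemma longest_A: "longest_element sA (JA n) (groupA n) = reversal (2 * n)"
  by (rule length_statistic.longest_element_eq[OF length_statistic_A])
    (use reversal_permutes inversions_less_reversal in \<open>auto simp: groupA_def\<close>)

lemma cox_length_longest_A: "cox_length sA (JA n) (reversal (2 * n)) = n * (2 * n - 1)"
proof -
  have "reversal (2 * n) \<in> groupA n" using reversal_permutes by (simp add: groupA_def)
  then have "cox_length sA (JA n) (reversal (2 * n)) = card (pairs (2 * n))"
    by (simp only: length_statistic.cox_length_eq[OF length_statistic_A] inversions_reversal)
  then show ?thesis using card_pairs[of "2 * n"] by simp
qed

section \<open>Signed permutations and their unfolding\<close>

lemma groupB_mem: "v \<in> groupB n \<Longrightarrow> k \<in> signed_set n \<Longrightarrow> v k \<in> signed_set n"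
  by (auto simp: groupB_def permutes_in_image)

lemma eta_comp:
  assumes "u \<in> groupB n"
  shows "eta n (v \<circ> u) = eta n v \<circ> eta n u"
  by (rule eta_eqI) (use assms in \<open>auto simp: eta_theta groupB_mem eta_outside\<close>)

lemma eta_id: "eta n id = id"
  by (rule eta_eqI) auto

lemma eta_inj:
  assumes "u \<in> groupB n" "v \<in> groupB n" "eta n u = eta n v"
  shows "u = v"
proof
  fix k
  show "u k = v k"
  proof (cases "k \<in> signed_set n")
    case True
    then have "theta n (u k) = theta n (v k)"
      using assms(3) eta_theta by metis
    then show ?thesis
      using inj_on_theta groupB_mem assms True by (meson inj_onD)
  next
    case False
    then show ?thesis using assms(1,2) by (auto simp: groupB_def permutes_not_in)
  qed
qed

lemma theta_uminus: "k \<in> signed_set n \<Longrightarrow> theta n (- k) = 2 * n + 1 - theta n k"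
  by (auto simp: theta_def signed_set_def nat_diff_distrib)

lemma theta_mem: "k \<in> signed_set n \<Longrightarrow> theta n k \<in> {1..2 * n}"
  using theta_image by blast

lemma eta_permutes:
  assumes "v \<in> groupB n"
  shows "eta n v permutes {1..2 * n}"
  unfolding eta_def
proof (rule map_permutation_permutes)
  show "v permutes signed_set n" using assms by (simp add: groupB_def)
qed (use inj_on_theta theta_image in \<open>auto simp: bij_betw_def\<close>)

lemma eta_symmetric:
  assumes "v \<in> groupB n" "j \<in> {1..2 * n}"
  shows "eta n v (2 * n + 1 - j) = 2 * n + 1 - eta n v j"
proof -
  obtain k where k: "k \<in> signed_set n" "j = theta n k"
    using assms(2) theta_image by blast
  have mk: "- k \<in> signed_set n" using k by (auto simp: signed_set_def)
  have "eta n v (2 * n + 1 - j) = theta n (v (- k))"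
    using k mk theta_uminus eta_theta by metis
  also have "v (- k) = - v k" using assms(1) by (simp add: groupB_def)
  also have "theta n (- v k) = 2 * n + 1 - theta n (v k)"
    by (rule theta_uminus[OF groupB_mem[OF assms(1) k(1)]])
  also have "theta n (v k) = eta n v j" using k eta_theta by metis
  finally show ?thesis .
qed

lemma sB_simps: "i \<ge> 1 \<Longrightarrow> sB i l =
    (if l = - int i - 1 then - int i else if l = - int i then - int i - 1
     else if l = int i then int i + 1 else if l = int i + 1 then int i else l)"
  "sB 0 l = (if l = 1 then -1 else if l = -1 then 1 else l)"
  by (auto simp: sB_def Transposition.transpose_def)

lemma sB_sB [simp]: "sB i (sB i l) = l"
  by (cases "i = 0") (auto simp: sB_simps)

lemma sB_mem: "i < n \<Longrightarrow> sB i \<in> groupB n"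
  unfolding groupB_def
proof (intro CollectI conjI allI)
  assume i: "i < n"
  show "sB i permutes signed_set n"
  proof (rule bij_imp_permutes)
    have "sB i l \<in> signed_set n" if "l \<in> signed_set n" for l
      using that i by (cases "i = 0") (auto simp: sB_simps signed_set_def)
    then show "bij_betw (sB i) (signed_set n) (signed_set n)"
      by (intro bij_betwI[where g = "sB i"]) auto
    show "sB i l = l" if "l \<notin> signed_set n" for l
      using that i by (cases "i = 0") (auto simp: sB_simps signed_set_def)
  qed
  show "sB i (- k) = - sB i k" for k
    by (cases "i = 0") (auto simp: sB_simps)
qed

lemma groupB_comp: "u \<in> groupB n \<Longrightarrow> v \<in> groupB n \<Longrightarrow> u \<circ> v \<in> groupB n"
  by (auto simp: groupB_def intro: permutes_compose)

lemma id_groupB: "id \<in> groupB n"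
  unfolding groupB_def using permutes_id by (intro CollectI conjI) (assumption | simp)+

lemma word_prod_sB_mem: "set bs \<subseteq> JB n \<Longrightarrow> word_prod sB bs \<in> groupB n"
proof (induction bs)
  case Nil
  show ?case by (simp only: word_prod_Nil id_groupB)
qed (auto simp: JB_def intro!: groupB_comp sB_mem)

definition unfold_word :: "nat \<Rightarrow> nat list \<Rightarrow> nat list" where
  "unfold_word n bs = concat (map (\<lambda>i. if i = 0 then [n] else [n + i, n - i]) bs)"

lemma unfold_word_simps [simp]:
  "unfold_word n [] = []" "unfold_word n (i # bs) = (if i = 0 then [n] else [n + i, n - i]) @ unfold_word n bs"
  "unfold_word n (bs @ bs') = unfold_word n bs @ unfold_word n bs'"
  by (simp_all add: unfold_word_def)

lemma eta_word_prod:
  assumes "set bs \<subseteq> JB n"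
  shows "eta n (word_prod sB bs) = word_prod sA (unfold_word n bs)"
  using assms
proof (induction bs)
  case (Cons i bs)
  then have "i < n" and mem: "word_prod sB bs \<in> groupB n"
    using word_prod_sB_mem by (auto simp: JB_def)
  then have "eta n (sB i) = word_prod sA (if i = 0 then [n] else [n + i, n - i])"
    using eta_sB_0[of n] eta_sB[of i n] by simp
  then show ?case
    using Cons eta_comp[OF mem, of "sB i"] by (simp only: word_prod_Cons unfold_word_simps word_prod_append) simp
qed (simp add: eta_id)

definition sign_changes :: "nat \<Rightarrow> (nat \<Rightarrow> nat) \<Rightarrow> nat" where
  "sign_changes n w = card {j \<in> {n + 1..2 * n}. w j \<le> n}"

text \<open>Inversions of the unfolding come in symmetric pairs, except for those of the form \<open>(-k, k)\<close>, which
  correspond to the sign changes; so the following sum is twice the length of \<open>v\<close>.\<close>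

definition twice_length :: "nat \<Rightarrow> (int \<Rightarrow> int) \<Rightarrow> nat" where
  "twice_length n v = card (inversions (2 * n) (eta n v)) + sign_changes n (eta n v)"

lemma sign_changes_cong_image:
  assumes "\<And>j. s (s j) = j" "\<And>j. j \<in> {n + 1..2 * n} \<Longrightarrow> s j \<in> {n + 1..2 * n}"
  shows "sign_changes n (w \<circ> s) = sign_changes n w"
proof -
  have "{j \<in> {n + 1..2 * n}. (w \<circ> s) j \<le> n} = s ` {j \<in> {n + 1..2 * n}. w j \<le> n}"
  proof (intro equalityI subsetI)
    fix j assume "j \<in> {j \<in> {n + 1..2 * n}. (w \<circ> s) j \<le> n}"
    then have "s j \<in> {j \<in> {n + 1..2 * n}. w j \<le> n}" using assms(2)[of j] by simp
    then have "s (s j) \<in> s ` {j \<in> {n + 1..2 * n}. w j \<le> n}" by (rule imageI)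
    then show "j \<in> s ` {j \<in> {n + 1..2 * n}. w j \<le> n}" unfolding assms(1) .
  next
    fix j assume "j \<in> s ` {j \<in> {n + 1..2 * n}. w j \<le> n}"
    then obtain i where i: "i \<in> {n + 1..2 * n}" "w i \<le> n" "j = s i" by blast
    then show "j \<in> {j \<in> {n + 1..2 * n}. (w \<circ> s) j \<le> n}"
      using assms(2)[OF i(1)] assms(1)[of i] by simp
  qed
  moreover have "inj s" by (metis assms(1) injI)
  ultimately show ?thesis
    unfolding sign_changes_def by (simp add: card_image inj_on_subset)
qed

text \<open>For \<open>i = 0\<close> one inversion and one sign change come or go together. For
  \<open>i > 0\<close> the letters \<open>n + i\<close> and \<open>n - i\<close> each change the
  number of inversions by 1, in the same direction by symmetry, and the number of sign changes
  stays.\<close>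

lemma twice_length_step:
  assumes v: "v \<in> groupB n" and i: "i < n"
  defines "w \<equiv> eta n v"
  shows "w (n + i) < w (n + i + 1) \<Longrightarrow> twice_length n (v \<circ> sB i) = twice_length n v + 2"
    and "w (n + i + 1) < w (n + i) \<Longrightarrow> twice_length n v = twice_length n (v \<circ> sB i) + 2"
proof -
  have eta: "eta n (v \<circ> sB i) = w \<circ> eta n (sB i)"
    unfolding w_def by (rule eta_comp[OF sB_mem[OF i]])
  have wp: "w permutes {1..2 * n}" unfolding w_def by (rule eta_permutes[OF v])
  have ws: "w (2 * n + 1 - j) = 2 * n + 1 - w j" if "j \<in> {1..2 * n}" for j
    unfolding w_def by (rule eta_symmetric[OF v that])
  have wm: "w j \<in> {1..2 * n}" if "j \<in> {1..2 * n}" for j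
    using permutes_in_image[OF wp] that by simp
  have "(w (n + i) < w (n + i + 1) \<longrightarrow> twice_length n (v \<circ> sB i) = twice_length n v + 2) \<and>
      (w (n + i + 1) < w (n + i) \<longrightarrow> twice_length n v = twice_length n (v \<circ> sB i) + 2)"
  proof (cases "i = 0")
    case True
    have n: "1 \<le> n" "Suc n \<le> 2 * n" using i by simp_all
    have w1: "w (Suc n) = 2 * n + 1 - w n" and wn: "w n \<in> {1..2 * n}"
      using ws[of n] wm[of n] n by (simp_all add: algebra_simps)
    \<comment> \<open>The letter \<open>n\<close> moves only the places \<open>n\<close> and
      \<open>n + 1\<close>, so sign changes at later places form a common part.\<close>
    let ?R = "{j \<in> {n + 2..2 * n}. w j \<le> n}"
    have split: "{j \<in> {n + 1..2 * n}. u j \<le> n} =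
        (if u (Suc n) \<le> n then insert (Suc n) else id) ?R" if "\<And>j. j \<ge> n + 2 \<Longrightarrow> u j = w j" for u
    proof -
      have "{n + 1..2 * n} = insert (Suc n) {n + 2..2 * n}" using n by auto
      then have "{j \<in> {n + 1..2 * n}. u j \<le> n} =
          (if u (Suc n) \<le> n then insert (Suc n) else id) {j \<in> {n + 2..2 * n}. u j \<le> n}"
        by (simp only:) auto
      also have "{j \<in> {n + 2..2 * n}. u j \<le> n} = ?R"
        by (rule Collect_cong) (use that in auto)
      finally show ?thesis .
    qed
    have "sign_changes n u = card ?R + (if u (Suc n) \<le> n then 1 else 0)" if uw: "\<And>j. j \<ge> n + 2 \<Longrightarrow> u j = w j" for u
    proof -
      have "sign_changes n u = card ((if u (Suc n) \<le> n then insert (Suc n) else id) ?R)"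
        unfolding sign_changes_def by (rule arg_cong[where f = card], rule split) (rule uw)
      then show ?thesis by simp
    qed
    then have sign_changes: "sign_changes n w = card ?R + (if w (Suc n) \<le> n then 1 else 0)"
      "sign_changes n (w \<circ> sA n) = card ?R + (if w n \<le> n then 1 else 0)"
      by (simp_all add: sA_simps)
    have e: "twice_length n (v \<circ> sB i) = card (inversions (2 * n) (w \<circ> sA n)) + sign_changes n (w \<circ> sA n)"
      unfolding twice_length_def eta unfolding True eta_sB_0[OF n(1)] ..
    show ?thesis
      unfolding e unfolding twice_length_def w_def[symmetric] sign_changes
      using inversions_step[OF n, of w] w1 wn True by auto
  next
    case False
    then have i1: "1 \<le> i" by simp
    define u where "u = w \<circ> sA (n + i)"
    have a: "1 \<le> n + i" "Suc (n + i) \<le> 2 * n" "1 \<le> n - i" "Suc (n - i) \<le> 2 * n"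
      using i by auto
    have "sA (n + i) (n - i) = n - i" "sA (n + i) (Suc (n - i)) = Suc (n - i)"
      using i1 i by (auto intro!: sA_simps)
    then have u: "u (n - i) = w (n - i)" "u (Suc (n - i)) = w (Suc (n - i))"
      by (simp_all add: u_def)
    have r: "2 * n + 1 - (n + i) = Suc (n - i)" "2 * n + 1 - (n + i + 1) = n - i"
      using i by auto
    have m: "w (Suc (n - i)) = 2 * n + 1 - w (n + i)" "w (n - i) = 2 * n + 1 - w (n + i + 1)"
      using ws[of "n + i"] ws[of "n + i + 1"] a unfolding r by auto
    have wmi: "w (n + i) \<in> {1..2 * n}" "w (n + i + 1) \<in> {1..2 * n}"
      using wm a by auto
    have eq: "w \<circ> eta n (sB i) = u \<circ> sA (n - i)"
      unfolding u_def eta_sB[OF i1 i] by (simp add: comp_assoc)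
    \<comment> \<open>\<open>n - i\<close> acts only on places up to \<open>n\<close>, which are not
      counted, while \<open>n + i\<close> permutes the counted places among themselves.\<close>
    have "sign_changes n (u \<circ> sA (n - i)) = sign_changes n u"
      unfolding sign_changes_def
      by (rule arg_cong[where f = card]) (use i i1 in \<open>auto simp: sA_simps\<close>)
    also have "sign_changes n u = sign_changes n w"
      unfolding u_def
      by (rule sign_changes_cong_image) (use i i1 in \<open>auto simp: sA_def Transposition.transpose_def\<close>)
    finally have e: "twice_length n (v \<circ> sB i) = card (inversions (2 * n) (u \<circ> sA (n - i))) + sign_changes n w"
      unfolding twice_length_def eta eq by simp
    have uw: "u (n - i) < u (Suc (n - i)) \<longleftrightarrow> w (n + i) < w (n + i + 1)"
      "u (Suc (n - i)) < u (n - i) \<longleftrightarrow> w (n + i + 1) < w (n + i)"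
      unfolding u m using wmi by auto
    have s: "twice_length n v = card (inversions (2 * n) w) + sign_changes n w"
      by (simp add: twice_length_def w_def)
    show ?thesis
    proof (intro conjI impI)
      assume less: "w (n + i) < w (n + i + 1)"
      have "card (inversions (2 * n) u) = Suc (card (inversions (2 * n) w))"
        unfolding u_def by (rule inversions_step(1)[OF a(1,2)]) (use less in simp)
      moreover have "card (inversions (2 * n) (u \<circ> sA (n - i))) = Suc (card (inversions (2 * n) u))"
        by (rule inversions_step(1)[OF a(3,4)]) (use less uw in simp)
      ultimately show "twice_length n (v \<circ> sB i) = twice_length n v + 2"
        unfolding e s by linarith
    next
      assume less: "w (n + i + 1) < w (n + i)"
      have "card (inversions (2 * n) w) = Suc (card (inversions (2 * n) u))"
        unfolding u_def by (rule inversions_step(2)[OF a(1,2)]) (use less in simp)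
      moreover have "card (inversions (2 * n) u) = Suc (card (inversions (2 * n) (u \<circ> sA (n - i))))"
        by (rule inversions_step(2)[OF a(3,4)]) (use less uw in simp)
      ultimately show "twice_length n v = twice_length n (v \<circ> sB i) + 2"
        unfolding e s by linarith
    qed
  qed
  then show "w (n + i) < w (n + i + 1) \<Longrightarrow> twice_length n (v \<circ> sB i) = twice_length n v + 2"
    "w (n + i + 1) < w (n + i) \<Longrightarrow> twice_length n v = twice_length n (v \<circ> sB i) + 2" by auto
qed

lemma length_statistic_B:
  "length_statistic sB (JB n) (groupB n) (\<lambda>v. twice_length n v div 2)"
proof
  show "id \<in> groupB n" by (rule id_groupB)
  have "{j \<in> {n + 1..2 * n}. id j \<le> n} = {}" "inversions (2 * n) id = {}"
    by (auto simp: inversions_def)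
  then show "twice_length n id div 2 = 0"
    unfolding twice_length_def eta_id sign_changes_def by (simp only: card.empty)
  fix v i assume v: "v \<in> groupB n"
  show "v \<circ> sB i \<in> groupB n" "twice_length n (v \<circ> sB i) div 2 \<le> Suc (twice_length n v div 2)" if i: "i \<in> JB n"
  proof -
    have i': "i < n" using i by (simp add: JB_def)
    show "v \<circ> sB i \<in> groupB n" by (rule groupB_comp[OF v sB_mem[OF i']])
    have "inj (eta n v)" using permutes_inj[OF eta_permutes[OF v]] .
    then have "eta n v (n + i) \<noteq> eta n v (n + i + 1)" by (simp add: inj_eq)
    then show "twice_length n (v \<circ> sB i) div 2 \<le> Suc (twice_length n v div 2)"
      using twice_length_step[OF v i'] by (cases "eta n v (n + i) < eta n v (n + i + 1)") auto
  qed
  show "\<exists>i\<in>JB n. twice_length n v div 2 = Suc (twice_length n (v \<circ> sB i) div 2)" if "v \<noteq> id"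
  proof -
    have "eta n v \<noteq> id"
      using eta_inj[OF v id_groupB] that eta_id by metis
    then obtain k where k: "1 \<le> k" "Suc k \<le> 2 * n" "eta n v (Suc k) < eta n v k"
      using permutation_descent[OF eta_permutes[OF v]] by metis
    obtain i where i: "i < n" "eta n v (n + i + 1) < eta n v (n + i)"
    proof (cases "n \<le> k")
      case True
      then show thesis using that[of "k - n"] k by simp
    next
      case False
      \<comment> \<open>A descent at \<open>k\<close> has a mirror image at
        \<open>2 * n - k\<close>, so one can always be found in the right half.\<close>
      have "2 * n + 1 - k = n + (n - k) + 1" "2 * n + 1 - Suc k = n + (n - k)"
        using False by auto
      then have e: "eta n v (n + (n - k) + 1) = 2 * n + 1 - eta n v k"
        "eta n v (n + (n - k)) = 2 * n + 1 - eta n v (Suc k)"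
        using eta_symmetric[OF v, of k] eta_symmetric[OF v, of "Suc k"] k by simp_all
      have "eta n v k \<in> {1..2 * n}"
        using permutes_in_image[OF eta_permutes[OF v], of k] k by simp
      then have "eta n v (n + (n - k) + 1) < eta n v (n + (n - k))"
        unfolding e using k(3) by auto
      moreover have "n - k < n" using False k by linarith
      ultimately show thesis by (rule that[rotated])
    qed
    then show ?thesis
      using twice_length_step(2)[OF v i] by (intro bexI[of _ i]) (auto simp: JB_def)
  qed
qed (simp add: fun_eq_iff)

definition reversalB :: "nat \<Rightarrow> int \<Rightarrow> int" where
  "reversalB n k = (if k \<in> signed_set n then - k else k)"

lemma uminus_signed_set: "- k \<in> signed_set n \<longleftrightarrow> k \<in> signed_set n"
  by (auto simp: signed_set_def)

lemma reversalB_mem: "reversalB n \<in> groupB n"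
  unfolding groupB_def
proof (intro CollectI conjI allI)
  show "reversalB n permutes signed_set n"
    by (rule bij_imp_permutes)
      (auto simp: reversalB_def uminus_signed_set intro!: bij_betw_byWitness[where f' = uminus])
  show "reversalB n (- k) = - reversalB n k" for k
    by (auto simp: reversalB_def signed_set_def)
qed

lemma eta_reversalB: "eta n (reversalB n) = reversal (2 * n)"
  by (rule eta_eqI) (use theta_mem theta_uminus in \<open>auto simp: reversalB_def reversal_def\<close>)

lemma twice_length_reversalB: "twice_length n (reversalB n) = 2 * n\<^sup>2"
proof -
  have "{j \<in> {n + 1..2 * n}. reversal (2 * n) j \<le> n} = {n + 1..2 * n}"
    by (auto simp: reversal_def)
  then have "sign_changes n (reversal (2 * n)) = n" unfolding sign_changes_def by simp
  moreover have "card (inversions (2 * n) (reversal (2 * n))) * 2 = 2 * n * (2 * n - 1)"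
    unfolding inversions_reversal card_pairs ..
  ultimately show ?thesis
    unfolding twice_length_def eta_reversalB by (cases n) (auto simp: power2_eq_square algebra_simps)
qed

lemma sign_changes_le: "sign_changes n w \<le> n"
proof -
  have "sign_changes n w \<le> card {n + 1..2 * n}"
    unfolding sign_changes_def by (rule card_mono) auto
  then show ?thesis by simp
qed

lemma longest_B: "longest_element sB (JB n) (groupB n) = reversalB n"
proof (rule length_statistic.longest_element_eq[OF length_statistic_B reversalB_mem])
  fix u assume u: "u \<in> groupB n" "u \<noteq> reversalB n"
  then have "eta n u \<noteq> reversal (2 * n)"
    using eta_inj[OF _ reversalB_mem] eta_reversalB by metis
  then have "card (inversions (2 * n) (eta n u)) < card (inversions (2 * n) (reversal (2 * n)))"
    by (rule inversions_less_reversal[OF eta_permutes[OF u(1)]])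
  moreover have "sign_changes n (reversal (2 * n)) = n"
  proof -
    have "{j \<in> {n + 1..2 * n}. reversal (2 * n) j \<le> n} = {n + 1..2 * n}"
      by (auto simp: reversal_def)
    then show ?thesis unfolding sign_changes_def by simp
  qed
  ultimately have "twice_length n u < twice_length n (reversalB n)"
    using sign_changes_le[of n "eta n u"] by (simp add: twice_length_def eta_reversalB)
  \<comment> \<open>The maximal value \<open>2 * n^2\<close> is even, so the strict inequality
    survives the halving.\<close>
  then show "twice_length n u div 2 < twice_length n (reversalB n) div 2"
    unfolding twice_length_reversalB by simp
qed

lemma cox_length_longest_B: "cox_length sB (JB n) (reversalB n) = n\<^sup>2"
  using length_statistic.cox_length_eq[OF length_statistic_B reversalB_mem] by (simp add: twice_length_reversalB)

section \<open>Coxeter words\<close>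

lemma sA_threshold:
  assumes "k \<noteq> j"
  shows "sA k x \<le> j \<longleftrightarrow> x \<le> j"
  using assms unfolding sA_def Transposition.transpose_def by auto

text \<open>Only the letter \<open>j\<close> moves points across the cut between \<open>j\<close>
  and \<open>j + 1\<close>.\<close>

lemma word_prod_threshold:
  assumes "j \<notin> set ws"
  shows "word_prod sA ws x \<le> j \<longleftrightarrow> x \<le> j"
  using assms by (induction ws) (auto simp: sA_threshold)

lemma word_prod_fixes:
  assumes "j \<notin> set ws" "j - 1 \<notin> set ws" "j \<ge> 1"
  shows "word_prod sA ws j = j"
proof -
  have "word_prod sA ws j \<le> j" "\<not> word_prod sA ws j \<le> j - 1"
    using word_prod_threshold[OF assms(1), of j] word_prod_threshold[OF assms(2), of j] assms(3)
    by simp_all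
  then show ?thesis by simp
qed

text \<open>A word with exactly one \<open>j\<close> carries some point across the cut above
  \<open>j\<close>, and a word without \<open>j\<close> cannot do so.\<close>

lemma word_prod_letter_once:
  assumes "distinct cs" "j \<in> set cs" "word_prod sA us = word_prod sA cs"
  shows "j \<in> set us"
proof (rule ccontr)
  assume j: "j \<notin> set us"
  obtain xs ys where cs: "cs = xs @ j # ys" "j \<notin> set xs" "j \<notin> set ys"
    using split_list[OF assms(2)] assms(1) by auto
  \<comment> \<open>The point that the letters to the right of \<open>j\<close> bring to place
    \<open>j\<close>, just before \<open>j\<close> acts.\<close>
  define x where "x = inv (word_prod sA ys) j"
  have "word_prod sA ys permutes UNIV"
    by (rule word_prod_permutes) (simp add: sA_def permutes_swap_id)
  then have "word_prod sA ys x = j"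
    unfolding x_def by (rule permutes_inverses)
  then have "word_prod sA cs x = word_prod sA xs (Suc j)" "x \<le> j"
    using word_prod_threshold[OF cs(3), of x] by (simp_all add: cs sA_simps)
  then show False
    using word_prod_threshold[OF cs(2), of "Suc j"] word_prod_threshold[OF j, of x] assms(3) by simp
qed

text \<open>Letters act from the right: \<open>j\<close> stays fixed until the letter
  \<open>j\<close> lifts it over the cut, and no letter further left brings it back.\<close>

lemma coxeter_up:
  assumes "distinct cs" "2 \<le> j" "before cs (j - 1) j"
  shows "j < word_prod sA cs j"
proof -
  obtain xs ys zs where cs: "cs = xs @ (j - 1) # ys @ j # zs"
    using assms(3) by (auto simp: before_iff_split)
  have n: "j \<notin> set xs" "j \<notin> set ys" "j \<notin> set zs" "j - 1 \<notin> set zs"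
    using assms(1) by (auto simp: cs)
  have "word_prod sA cs j = word_prod sA (xs @ (j - 1) # ys) (Suc j)"
    using word_prod_fixes[OF n(3,4)] assms(2) by (simp add: cs sA_simps)
  moreover have "j \<notin> set (xs @ (j - 1) # ys)"
    using n assms(2) by auto
  ultimately show ?thesis
    using word_prod_threshold[of j "xs @ (j - 1) # ys" "Suc j"] by simp
qed

lemma coxeter_down:
  assumes "distinct cs" "2 \<le> j" "before cs j (j - 1)"
  shows "word_prod sA cs j < j"
proof -
  obtain xs ys zs where cs: "cs = xs @ j # ys @ (j - 1) # zs"
    using assms(3) by (auto simp: before_iff_split)
  have n: "j - 1 \<notin> set xs" "j - 1 \<notin> set ys" "j \<notin> set zs" "j - 1 \<notin> set zs"
    using assms(1) by (auto simp: cs)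
  have "sA (j - 1) j = j - 1" using assms(2) sA_simps(2)[of "j - 1"] by simp
  then have "word_prod sA cs j = word_prod sA (xs @ j # ys) (j - 1)"
    using word_prod_fixes[OF n(3,4)] assms(2) by (simp add: cs)
  moreover have "j - 1 \<notin> set (xs @ j # ys)"
    using n assms(2) by auto
  ultimately show ?thesis
    using word_prod_threshold[of "j - 1" "xs @ j # ys" "j - 1"] assms(2) by simp
qed

text \<open>The orientation can thus be read off the permutation, so all words for one Coxeter
  element that use each letter once agree on it.\<close>

lemma coxeter_bef:
  assumes "distinct cs" "2 \<le> j" "j \<in> set cs" "j - 1 \<in> set cs"
  shows "before cs (j - 1) j \<longleftrightarrow> j < word_prod sA cs j"
  using before_total[OF assms(3,4)] coxeter_up[OF assms(1,2)] coxeter_down[OF assms(1,2)] assms(2)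
  by fastforce

text \<open>Reducedness bounds the length by the number of letters, and every letter occurs, so none
  is repeated.\<close>

lemma reduced_coxeter_word:
  assumes "distinct ds" "set ds = J" "finite J" "reduced_word s J cs (word_prod s ds)" "J \<subseteq> set cs"
  shows "distinct cs \<and> set cs = J"
proof -
  have "length cs \<le> length ds"
    using assms unfolding reduced_word_def cox_length_def by (auto intro!: Least_le exI[of _ ds])
  moreover have "length ds = card J" using assms(1,2) distinct_card by metis
  moreover have "set cs = J" using assms by (auto simp: reduced_word_def)
  ultimately show ?thesis
    using card_distinct[of cs] card_length[of cs] by simp
qed

lemma set_unfold: "set (unfold_word n bs) = (\<lambda>i. n + i) ` set bs \<union> (\<lambda>i. n - i) ` set bs"
  by (induction bs) auto

lemma unfold_word_mem:
  "set bs \<subseteq> JB n \<Longrightarrow> i < n \<Longrightarrow> n + i \<in> set (unfold_word n bs) \<longleftrightarrow> i \<in> set bs"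
  "set bs \<subseteq> JB n \<Longrightarrow> i < n \<Longrightarrow> n - i \<in> set (unfold_word n bs) \<longleftrightarrow> i \<in> set bs"
proof -
  assume bs: "set bs \<subseteq> JB n" and i: "i < n"
  have "n + i = n - j \<longleftrightarrow> i = 0 \<and> j = 0" "n - i = n - j \<longleftrightarrow> i = j" "n - i = n + j \<longleftrightarrow> i = 0 \<and> j = 0"
    if "j \<in> set bs" for j
    using that bs i by (auto simp: JB_def subset_iff)
  then show "n + i \<in> set (unfold_word n bs) \<longleftrightarrow> i \<in> set bs" "n - i \<in> set (unfold_word n bs) \<longleftrightarrow> i \<in> set bs"
    unfolding set_unfold by auto
qed

lemma distinct_unfold:
  assumes "distinct bs" "set bs \<subseteq> JB n"
  shows "distinct (unfold_word n bs)"
  using assms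
proof (induction bs)
  case (Cons i bs)
  then have "i < n" "set bs \<subseteq> JB n" "i \<notin> set bs" by (auto simp: JB_def)
  then have "n + i \<notin> set (unfold_word n bs)" "n - i \<notin> set (unfold_word n bs)"
    using unfold_word_mem by blast+
  then show ?case using Cons \<open>i < n\<close> by auto
qed simp

lemma set_unfold_full:
  assumes "n \<ge> 1" "set bs = JB n"
  shows "set (unfold_word n bs) = {1..2 * n - 1}"
proof (intro equalityI subsetI)
  fix j assume j: "j \<in> {1..2 * n - 1}"
  show "j \<in> set (unfold_word n bs)"
  proof (cases "j \<le> n")
    case True
    then have "j = n - (n - j)" "n - j \<in> JB n" using j by (auto simp: JB_def)
    then show ?thesis unfolding set_unfold assms(2) by blast
  next
    case False
    then have "j = n + (j - n)" "j - n \<in> JB n" using j by (auto simp: JB_def)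
    then show ?thesis unfolding set_unfold assms(2) by blast
  qed
next
  fix j assume "j \<in> set (unfold_word n bs)"
  then obtain i where "i < n" "j = n + i \<or> j = n - i"
    unfolding set_unfold assms(2) JB_def by blast
  then show "j \<in> {1..2 * n - 1}" by auto
qed

lemma before_unfold:
  assumes "before bs i j" "i \<noteq> j"
  shows "before (unfold_word n bs) (n + i) (n + j)" "before (unfold_word n bs) (n - i) (n - j)"
proof -
  obtain xs ys zs where bs: "bs = xs @ i # ys @ j # zs"
    using assms(1) by (auto simp: before_iff_split)
  have app: "before (as @ us @ cs) p q" if b: "before us p q" for as us cs :: "nat list" and p q
  proof -
    obtain u v w where "us = u @ p # v @ q # w" using b by (auto simp: before_iff_split)
    then have "as @ us @ cs = (as @ u) @ p # v @ q # (w @ cs)" by simp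
    then show ?thesis unfolding before_iff_split by blast
  qed
  have two: "before (us @ vs @ ws) p q" if m: "p \<in> set us" "q \<in> set ws" for us vs ws :: "nat list" and p q
  proof -
    obtain u u' w w' where "us = u @ p # u'" "ws = w @ q # w'"
      using m by (meson split_list)
    then have "us @ vs @ ws = u @ p # (u' @ vs @ w) @ q # w'" by simp
    then show ?thesis unfolding before_iff_split by blast
  qed
  let ?e = "\<lambda>i. if i = 0 then [n] else [n + i, n - i]"
  have eq: "unfold_word n bs = unfold_word n xs @ (?e i @ unfold_word n ys @ ?e j) @ unfold_word n zs"
    by (simp add: bs)
  show "before (unfold_word n bs) (n + i) (n + j)" "before (unfold_word n bs) (n - i) (n - j)"
    unfolding eq by (intro app two; auto)+
qed

section \<open>The Coxeter words of types A and B\<close>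

locale coxeter_pair =
  fixes n :: nat and csA csB :: "nat list" and cB :: "int \<Rightarrow> int"
  assumes n_pos: "n \<ge> 1"
    and cox: "coxeter_element sB (JB n) cB"
    and redB: "reduced_word sB (JB n) csB cB"
    and redA: "reduced_word sA (JA n) csA (eta n cB)"
begin

text \<open>That every letter occurs is settled in type A: a missing \<open>i\<close> would make
  \<open>n + i\<close> missing from a word for the unfolded Coxeter element.\<close>

lemma csB: "distinct csB" "set csB = JB n"
proof -
  obtain ds where ds: "distinct ds" "set ds = JB n" "word_prod sB ds = cB"
    using cox by (auto simp: coxeter_element_def)
  have csB: "set csB \<subseteq> JB n" "word_prod sB csB = cB" using redB by (auto simp: reduced_word_def)
  have "word_prod sA (unfold_word n csB) = word_prod sA (unfold_word n ds)"
    using csB ds eta_word_prod by (metis order_refl)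
  then have "n + i \<in> set (unfold_word n csB)" if "i < n" for i
    using word_prod_letter_once[OF distinct_unfold[OF ds(1)], of n "n + i"] ds(2) that
      unfold_word_mem(1)[of ds n i] by (auto simp: JB_def)
  then have "JB n \<subseteq> set csB"
    using unfold_word_mem(1)[OF csB(1)] by (auto simp: JB_def)
  then have "distinct csB \<and> set csB = JB n"
    using reduced_coxeter_word[OF ds(1,2)] redB ds(3) by (auto simp: JB_def)
  then show "distinct csB" "set csB = JB n" by auto
qed

text \<open>A concrete word for \<open>eta n cB\<close>. It mediates between \<open>csB\<close> and
  the arbitrary reduced word \<open>csA\<close>, which need not be an unfolding letter by
  letter.\<close>

definition unfolded_csB :: "nat list" where "unfolded_csB = unfold_word n csB"

lemma unfolded_csB: "distinct unfolded_csB" "set unfolded_csB = {1..2 * n - 1}" "word_prod sA unfolded_csB = eta n cB"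
proof -
  show "distinct unfolded_csB" unfolding unfolded_csB_def using csB by (intro distinct_unfold) auto
  show "set unfolded_csB = {1..2 * n - 1}" unfolding unfolded_csB_def by (rule set_unfold_full[OF n_pos csB(2)])
  show "word_prod sA unfolded_csB = eta n cB"
    unfolding unfolded_csB_def using eta_word_prod[of csB n] csB redB by (simp add: reduced_word_def)
qed

lemma csA: "distinct csA" "set csA = {1..2 * n - 1}"
proof -
  have "{1..2 * n - 1} \<subseteq> set csA"
    using word_prod_letter_once[OF unfolded_csB(1), of _ csA] unfolded_csB redA by (auto simp: reduced_word_def)
  then have "distinct csA \<and> set csA = {1..2 * n - 1}"
    using reduced_coxeter_word[OF unfolded_csB(1,2), of sA csA] redA unfolded_csB(3) by (simp add: JA_def)
  then show "distinct csA" "set csA = {1..2 * n - 1}" by auto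
qed

lemma before_uc_up:
  assumes "2 \<le> j" "j \<le> 2 * n - 1"
  shows "before csA (j - 1) j \<longleftrightarrow> before unfolded_csB (j - 1) j"
proof -
  have "j \<in> {1..2 * n - 1}" "j - 1 \<in> {1..2 * n - 1}" using assms by auto
  then have "before csA (j - 1) j \<longleftrightarrow> j < word_prod sA csA j" "before unfolded_csB (j - 1) j \<longleftrightarrow> j < word_prod sA unfolded_csB j"
    using coxeter_bef[OF csA(1) assms(1)] coxeter_bef[OF unfolded_csB(1) assms(1)] csA(2) unfolded_csB(2) by simp_all
  then show ?thesis using redA unfolded_csB(3) by (simp add: reduced_word_def)
qed

lemma before_uc:
  assumes "i \<in> {1..2 * n - 1}" "j \<in> {1..2 * n - 1}" "\<bar>int i - int j\<bar> = 1"
  shows "before unfolded_csB i j \<longleftrightarrow> before csA i j"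
proof -
  have moves_up: "before unfolded_csB (k - 1) k \<longleftrightarrow> before csA (k - 1) k" "before unfolded_csB k (k - 1) \<longleftrightarrow> before csA k (k - 1)"
    if k: "2 \<le> k" "k \<le> 2 * n - 1" for k
  proof -
    show 1: "before unfolded_csB (k - 1) k \<longleftrightarrow> before csA (k - 1) k" using before_uc_up[OF k] by simp
    have m: "k \<in> {1..2 * n - 1}" "k - 1 \<in> {1..2 * n - 1}" "k \<noteq> k - 1" using k by auto
    have "before unfolded_csB k (k - 1) \<longleftrightarrow> \<not> before unfolded_csB (k - 1) k" "before csA k (k - 1) \<longleftrightarrow> \<not> before csA (k - 1) k"
      using before_total[of k unfolded_csB "k - 1"] before_total[of k csA "k - 1"] before_asym[OF unfolded_csB(1)]
        before_asym[OF csA(1)] m unfolded_csB(2) csA(2) by metis+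
    then show "before unfolded_csB k (k - 1) \<longleftrightarrow> before csA k (k - 1)" using 1 by simp
  qed
  consider "i = j - 1" "2 \<le> j" | "j = i - 1" "2 \<le> i" using assms by fastforce
  then show ?thesis
    using moves_up[of j] moves_up[of i] assms by cases auto
qed

lemma before_csB:
  assumes "i < n" "j < n" "\<bar>int i - int j\<bar> = 1"
  shows "before csB i j \<longleftrightarrow> before csA (n + i) (n + j)" "before csB i j \<longleftrightarrow> before csA (n - i) (n - j)"
proof -
  have ij: "i \<noteq> j" using assms by auto
  have tot: "before csB i j \<or> before csB j i"
    using before_total[of i csB j] assms ij csB by (auto simp: JB_def)
  have "before csB i j \<longleftrightarrow> before unfolded_csB (n + i) (n + j)" "before csB i j \<longleftrightarrow> before unfolded_csB (n - i) (n - j)"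
    using tot before_unfold[of csB i j n] before_unfold[of csB j i n] ij before_asym[OF unfolded_csB(1)]
    unfolding unfolded_csB_def[symmetric] by metis+
  moreover have "before unfolded_csB (n + i) (n + j) \<longleftrightarrow> before csA (n + i) (n + j)"
    by (rule before_uc) (use assms in auto)
  moreover have "before unfolded_csB (n - i) (n - j) \<longleftrightarrow> before csA (n - i) (n - j)"
    by (rule before_uc) (use assms in auto)
  ultimately show "before csB i j \<longleftrightarrow> before csA (n + i) (n + j)" "before csB i j \<longleftrightarrow> before csA (n - i) (n - j)"
    by simp_all
qed

text \<open>Both edges come from one edge of the diagram of type B and inherit its orientation, but
  passing from \<open>n + i\<close> to \<open>n - i\<close> reverses the numerical order.\<close>

lemma orientation_sym:
  assumes "2 \<le> j" "j \<le> 2 * n - 1"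
  shows "before csA (j - 1) j \<longleftrightarrow> \<not> before csA (2 * n - j) (2 * n + 1 - j)"
proof -
  have asym: "before csA p q \<longleftrightarrow> \<not> before csA q p" if "p \<in> {1..2 * n - 1}" "q \<in> {1..2 * n - 1}" "p \<noteq> q" for p q
    using that before_total[of p csA q] before_asym[OF csA(1)] csA(2) by metis
  have swap: "before csA (2 * n - j) (2 * n + 1 - j) \<longleftrightarrow> \<not> before csA (2 * n + 1 - j) (2 * n - j)"
    by (rule asym) (use assms in auto)
  show ?thesis
  proof (cases "j \<le> n")
    case True
    define i where "i = n - j"
    have eqs: "j - 1 = n - (i + 1)" "j = n - i" "2 * n - j = n + i" "2 * n + 1 - j = n + (i + 1)"
      using True assms by (auto simp: i_def)
    have "i + 1 < n" "i < n" "\<bar>int (i + 1) - int i\<bar> = 1" using assms True by (auto simp: i_def)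
    then show ?thesis
      using before_csB[of "i + 1" i] unfolding eqs[symmetric] swap by blast
  next
    case False
    define i where "i = j - 1 - n"
    have eqs: "j - 1 = n + i" "j = n + (i + 1)" "2 * n - j = n - (i + 1)" "2 * n + 1 - j = n - i"
      using False assms by (auto simp: i_def)
    have "i < n" "i + 1 < n" "\<bar>int i - int (i + 1)\<bar> = 1" using assms False by (auto simp: i_def)
    then show ?thesis
      using before_csB[of i "i + 1"] unfolding eqs[symmetric] swap by blast
  qed
qed

end

sublocale coxeter_pair \<subseteq> symmetric_orientation n csA
  by unfold_locales (use n_pos csA orientation_sym in auto)

section \<open>The transformation\<close>

text \<open>The points of agreement form an affine set that contains the generators.\<close>

lemma affine_map_on_agree:
  assumes "affine_map_on (affine hull P) T" "affine_map_on (affine hull P) T'"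
    and "\<And>x. x \<in> P \<Longrightarrow> T x = T' x" "x \<in> affine hull P"
  shows "T x = T' x"
proof -
  have "x \<in> affine hull P \<and> T x = T' x"
  proof (rule hull_induct[OF assms(4), where P = "\<lambda>x. x \<in> affine hull P \<and> T x = T' x"])
    show "affine {x. x \<in> affine hull P \<and> T x = T' x}"
      unfolding affine_def[of "{x. _ x}"]
    proof (intro ballI allI impI CollectI)
      fix x y and u v :: real
      assume xy: "x \<in> {x. x \<in> affine hull P \<and> T x = T' x}"
        "y \<in> {x. x \<in> affine hull P \<and> T x = T' x}" "u + v = 1"
      then have "u *\<^sub>R x + v *\<^sub>R y \<in> affine hull P"
        using mem_affine[OF affine_affine_hull] by blast
      then show "u *\<^sub>R x + v *\<^sub>R y \<in> affine hull P \<and>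
          T (u *\<^sub>R x + v *\<^sub>R y) = T' (u *\<^sub>R x + v *\<^sub>R y)"
        using xy assms(1,2) unfolding affine_map_on_def by simp
    qed
  qed (use assms(3) hull_inc in auto)
  then show ?thesis ..
qed

lemma affine_map_on_convex_hull:
  assumes T: "affine_map_on (affine hull P) T"
  shows "T ` (convex hull P) = convex hull (T ` P)"
proof
  have "x \<in> affine hull P \<and> T x \<in> convex hull (T ` P)" if "x \<in> convex hull P" for x
  proof (rule hull_induct[OF that, where P = "\<lambda>x. x \<in> affine hull P \<and> T x \<in> convex hull (T ` P)"])
    show "convex {x. x \<in> affine hull P \<and> T x \<in> convex hull (T ` P)}"
      unfolding convex_def[of "{x. _ x}"]
    proof (intro ballI allI impI CollectI)
      fix x y and u v :: real
      assume xy: "x \<in> {x. x \<in> affine hull P \<and> T x \<in> convex hull (T ` P)}"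
        "y \<in> {x. x \<in> affine hull P \<and> T x \<in> convex hull (T ` P)}" "0 \<le> u" "0 \<le> v" "u + v = 1"
      then have "u *\<^sub>R x + v *\<^sub>R y \<in> affine hull P"
        using mem_affine[OF affine_affine_hull] by blast
      moreover have "T (u *\<^sub>R x + v *\<^sub>R y) = u *\<^sub>R T x + v *\<^sub>R T y"
        using xy T unfolding affine_map_on_def by blast
      moreover have "u *\<^sub>R T x + v *\<^sub>R T y \<in> convex hull (T ` P)"
        using xy convexD[OF convex_convex_hull] by blast
      ultimately show "u *\<^sub>R x + v *\<^sub>R y \<in> affine hull P \<and>
          T (u *\<^sub>R x + v *\<^sub>R y) \<in> convex hull (T ` P)" by simp
    qed
  qed (auto intro: hull_inc)
  then show "T ` (convex hull P) \<subseteq> convex hull (T ` P)" by blast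
next
  have "convex (T ` (convex hull P))"
  proof (rule convexI)
    fix x' y' and u v :: real
    assume "x' \<in> T ` (convex hull P)" "y' \<in> T ` (convex hull P)" and uv: "0 \<le> u" "0 \<le> v" "u + v = 1"
    then obtain x y where xy: "x \<in> convex hull P" "y \<in> convex hull P" "x' = T x" "y' = T y" by blast
    then have "T (u *\<^sub>R x + v *\<^sub>R y) = u *\<^sub>R T x + v *\<^sub>R T y"
      using T uv convex_hull_subset_affine_hull[of P] unfolding affine_map_on_def by blast
    moreover have "u *\<^sub>R x + v *\<^sub>R y \<in> convex hull P"
      using xy uv convexD[OF convex_convex_hull] by blast
    ultimately show "u *\<^sub>R x' + v *\<^sub>R y' \<in> T ` (convex hull P)"
      unfolding xy by (metis imageI)
  qed
  moreover have "T ` P \<subseteq> T ` (convex hull P)"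
    using hull_subset by (rule image_mono)
  ultimately show "convex hull (T ` P) \<subseteq> T ` (convex hull P)" by (rule hull_minimal[rotated])
qed

lemma combination_fun: "u *\<^sub>R x + v *\<^sub>R y = (\<lambda>p. u * x p + v * y p :: real)"
  by (simp add: fun_eq_iff scaleR_fun_def)

lemma count_list_unfold:
  assumes "set bs \<subseteq> JB n" "i < n"
  shows "count_list (unfold_word n bs) (n + i) = count_list bs i"
    and "count_list (unfold_word n bs) (n - i) = count_list bs i"
proof -
  have "count_list (unfold_word n bs) (n + i) = count_list bs i \<and>
      count_list (unfold_word n bs) (n - i) = count_list bs i"
    using assms(1)
  proof (induction bs)
    case (Cons j bs)
    then have "j < n" by (simp add: JB_def)
    then have "n + j = n + i \<longleftrightarrow> j = i" "n - j = n - i \<longleftrightarrow> j = i"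
      "n + j = n - i \<longleftrightarrow> j = 0 \<and> i = 0" "n - j = n + i \<longleftrightarrow> j = 0 \<and> i = 0"
      using assms(2) by auto
    then show ?case using Cons by auto
  qed simp
  then show "count_list (unfold_word n bs) (n + i) = count_list bs i"
    "count_list (unfold_word n bs) (n - i) = count_list bs i" by auto
qed

lemma sA_commute: "\<bar>int i - int j\<bar> > 1 \<Longrightarrow> sA i \<circ> sA j = sA j \<circ> sA i"
  unfolding sA_def Transposition.transpose_def fun_eq_iff by auto

lemma sB_support:
  "\<bar>l\<bar> \<notin> {int i, int i + 1} \<Longrightarrow> sB i l = l"
  "\<bar>l\<bar> \<in> {int i, int i + 1} \<Longrightarrow> \<bar>sB i l\<bar> \<in> {int i, int i + 1}"
  by (cases "i = 0"; auto simp: sB_simps split: if_splits)+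

lemma sB_commute:
  assumes "\<bar>int i - int j\<bar> > 1"
  shows "sB i \<circ> sB j = sB j \<circ> sB i"
proof
  fix l
  have disj: "\<not> (\<bar>t\<bar> \<in> {int i, int i + 1} \<and> \<bar>t\<bar> \<in> {int j, int j + 1})" for t :: int
    using assms by auto
  show "(sB i \<circ> sB j) l = (sB j \<circ> sB i) l"
  proof (cases "\<bar>l\<bar> \<in> {int i, int i + 1}")
    case True
    have l: "\<bar>sB i l\<bar> \<notin> {int j, int j + 1}" "\<bar>l\<bar> \<notin> {int j, int j + 1}"
      using sB_support(2)[OF True] True disj by blast+
    show ?thesis unfolding comp_apply sB_support(1)[OF l(1)] sB_support(1)[OF l(2)] ..
  next
    case False
    have l: "\<bar>sB j l\<bar> \<notin> {int i, int i + 1}"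
    proof (cases "\<bar>l\<bar> \<in> {int j, int j + 1}")
      case True
      show ?thesis using sB_support(2)[OF True] disj by blast
    next
      case j: False
      show ?thesis unfolding sB_support(1)[OF j] by (rule False)
    qed
    show ?thesis unfolding comp_apply sB_support(1)[OF l] sB_support(1)[OF False] ..
  qed
qed

lemma finite_ideals: "finite {I. order_ideal ws I}"
  by (rule finite_subset[of _ "Pow {..<length ws}"]) (auto simp: order_ideal_iff)

lemma set_concat_replicate: "n \<ge> 1 \<Longrightarrow> set (concat (replicate n xs)) = set xs"
  by (cases n) auto

lemma unfold_word_concat_replicate:
  "unfold_word n (concat (replicate r bs)) = concat (replicate r (unfold_word n bs))"
  by (induction r) simp_all

section \<open>The sorting words as powers\<close>

context coxeter_pair begin

definition wordA :: "nat list" where "wordA = concat (replicate n csA)"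
definition wordB :: "nat list" where "wordB = concat (replicate n csB)"

lemma length_wordA: "length wordA = n * (2 * n - 1)"
  using distinct_card[OF csA(1)] csA(2) by (simp add: wordA_def length_concat sum_list_replicate)

lemma length_wordB: "length wordB = n\<^sup>2"
proof -
  have "length csB = n" using distinct_card[OF csB(1)] unfolding csB(2) by (simp add: JB_def)
  then show ?thesis by (simp only: wordB_def length_concat map_replicate sum_list_replicate) (simp add: power2_eq_square)
qed

lemma admissible_wordA: "admissible n csA wordA"
  unfolding wordA_def by (rule admissible_power) (use csA in auto)

lemma admissible_wordB: "admissible n csB wordB"
  unfolding wordB_def by (rule admissible_power) (use csB in auto)

lemma admissible_unfold_wordB: "admissible n csA (unfold_word n wordB)"
  unfolding wordB_def unfold_word_concat_replicate unfolded_csB_def[symmetric]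
  by (rule admissible_power) (use csA unfolded_csB before_uc in auto)

lemma count_wordA: "i \<in> {1..2 * n - 1} \<Longrightarrow> count_list wordA i = n"
  using csA by (simp add: wordA_def count_list_replicate_concat count_list_distinct)

lemma count_wordB: "i < n \<Longrightarrow> count_list wordB i = n"
  using csB by (simp add: wordB_def count_list_replicate_concat count_list_distinct JB_def)

lemma set_wordB: "set wordB = JB n" and set_wordA: "set wordA = {1..2 * n - 1}"
  using csA csB n_pos by (auto simp: wordA_def wordB_def set_concat_replicate)

lemma admissible_full_reversal:
  assumes "admissible n csA us" "\<And>i. i \<in> {1..2 * n - 1} \<Longrightarrow> count_list us i = n"
  shows "word_prod sA us = reversal (2 * n)"
proof
  fix j
  show "word_prod sA us j = reversal (2 * n) j"
  proof (cases "j \<in> {1..2 * n}")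
    case True
    then show ?thesis using admissible_full_longest[OF assms] by (simp add: reversal_def)
  next
    case False
    then show ?thesis
      using permutes_not_in[OF word_prod_sA_permutes[OF admissible_set_range[OF assms(1)]]] by (auto simp: reversal_def)
  qed
qed

lemma word_prod_wordA: "word_prod sA wordA = reversal (2 * n)"
  by (rule admissible_full_reversal[OF admissible_wordA]) (use count_wordA in auto)

text \<open>Proved through the injective \<open>eta\<close>: the unfolded word is admissible with
  all counts equal to \<open>n\<close>, so it gives the reversal.\<close>

lemma word_prod_wordB: "word_prod sB wordB = reversalB n"
proof (rule eta_inj)
  have "count_list (unfold_word n wordB) i = n" if "i \<in> {1..2 * n - 1}" for i
  proof -
    have "i = n + (i - n) \<and> i - n < n \<or> i = n - (n - i) \<and> n - i < n" using that by auto
    then show ?thesis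
      using count_list_unfold[of wordB n "i - n"] count_list_unfold[of wordB n "n - i"] set_wordB count_wordB
      by (metis order_refl)
  qed
  then have "word_prod sA (unfold_word n wordB) = reversal (2 * n)"
    by (rule admissible_full_reversal[OF admissible_unfold_wordB])
  then show "eta n (word_prod sB wordB) = eta n (reversalB n)"
    using eta_word_prod[of wordB n] set_wordB eta_reversalB by simp
qed (use word_prod_sB_mem reversalB_mem set_wordB in auto)

lemma reduced_wordA: "reduced_word sA (JA n) wordA (reversal (2 * n))"
  unfolding reduced_word_def using word_prod_wordA cox_length_longest_A length_wordA set_wordA
  by (simp add: JA_def)

lemma reduced_wordB: "reduced_word sB (JB n) wordB (reversalB n)"
  unfolding reduced_word_def using word_prod_wordB cox_length_longest_B length_wordB set_wordB by simp

lemma sortA_eq: "sortA n csA = wordA"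
  unfolding sortA_def longest_A wordA_def
proof (rule sort_word_power)
  have "1 \<in> set csA" using csA(2) n_pos by auto
  then show "csA \<noteq> []" by auto
  show "reduced_word sA (JA n) (concat (replicate n csA)) (reversal (2 * n))"
    using reduced_wordA by (simp only: wordA_def)
qed

lemma sortB_eq: "sortB n csB = wordB"
  unfolding sortB_def longest_B wordB_def
proof (rule sort_word_power)
  have "0 \<in> set csB" using csB(2) n_pos by (auto simp: JB_def)
  then show "csB \<noteq> []" by auto
  show "reduced_word sB (JB n) (concat (replicate n csB)) (reversalB n)"
    using reduced_wordB by (simp only: wordB_def)
qed

text \<open>Symmetric counts turn the condition at \<open>i\<close> into the conditions at
  \<open>n + i\<close> and \<open>n - i\<close>. A neighbour lies on the same side except at the
  middle: the neighbours \<open>n - 1\<close> and \<open>n + 1\<close> of \<open>n\<close> both come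
  from the letter 1.\<close>

lemma fire_unfold:
  assumes f: "fire n csB m i"
    and m': "\<And>l. l < n \<Longrightarrow> m' (n + l) = m l" "\<And>l. l < n \<Longrightarrow> m' (n - l) = m l"
  shows "fire n csA m' (n + i)" "fire n csA m' (n - i)"
proof -
  have i: "i < n" "m i < n" using f csB by (auto simp: fire_def JB_def)
  have nb: "m l = (if before csB l i then m i + 1 else m i)" if "l < n" "\<bar>int l - int i\<bar> = 1" for l
    using f that csB unfolding fire_def JB_def by blast
  have moves_up: "m' (n + l) = (if before csA (n + l) (n + i) then m' (n + i) + 1 else m' (n + i))"
    "m' (n - l) = (if before csA (n - l) (n - i) then m' (n - i) + 1 else m' (n - i))"
    if "l < n" "\<bar>int l - int i\<bar> = 1" for l
    using nb[OF that] before_csB[OF that(1) i(1) that(2)] m' that(1) i(1) by auto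
  show "fire n csA m' (n + i)"
    unfolding fire_def csA(2)
  proof (intro conjI ballI impI)
    fix j assume j: "j \<in> {1..2 * n - 1}" "\<bar>int j - int (n + i)\<bar> = 1"
    consider "n \<le> j" | "i = 0" "j = n - 1" using j by linarith
    then show "m' j = (if before csA j (n + i) then m' (n + i) + 1 else m' (n + i))"
    proof cases
      case 1
      then have "j = n + (j - n)" "j - n < n" "\<bar>int (j - n) - int i\<bar> = 1" using j by auto
      then show ?thesis using moves_up(1)[of "j - n"] by simp
    next
      case 2
      then have "1 < n" using j by auto
      then show ?thesis using moves_up(2)[of 1] 2 by simp
    qed
  qed (use i m' in auto)
  show "fire n csA m' (n - i)"
    unfolding fire_def csA(2)
  proof (intro conjI ballI impI)
    fix j assume j: "j \<in> {1..2 * n - 1}" "\<bar>int j - int (n - i)\<bar> = 1"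
    consider "j \<le> n" | "i = 0" "j = n + 1" using j i by linarith
    then show "m' j = (if before csA j (n - i) then m' (n - i) + 1 else m' (n - i))"
    proof cases
      case 1
      then have "j = n - (n - j)" "n - j < n" "\<bar>int (n - j) - int i\<bar> = 1" using j i by auto
      then show ?thesis using moves_up(2)[of "n - j"] by simp
    next
      case 2
      then have "1 < n" using j by auto
      then show ?thesis using moves_up(1)[of 1] 2 by simp
    qed
  qed (use i m' in auto)
qed

text \<open>For \<open>i > 0\<close> the letters \<open>n + i\<close> and \<open>n - i\<close> are
  at least 2 apart, so the second may still fire after the first.\<close>

lemma admissible_unfold: "admissible n csB bs \<Longrightarrow> admissible n csA (unfold_word n bs)"
proof (induction bs rule: rev_induct)
  case (snoc i bs)
  then have f: "fire n csB (count_list bs) i" and bs: "admissible n csB bs"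
    by (simp_all add: admissible_snoc)
  have set: "set bs \<subseteq> JB n" using admissible_set[OF bs] csB by simp
  have i: "i < n" using f csB by (auto simp: fire_def JB_def)
  have F: "fire n csA (count_list (unfold_word n bs)) (n + i)" "fire n csA (count_list (unfold_word n bs)) (n - i)"
    by (rule fire_unfold[OF f]; rule count_list_unfold[OF set]; assumption)+
  show ?case
  proof (cases "i = 0")
    case True
    then show ?thesis using snoc.IH[OF bs] F by (simp add: admissible_snoc)
  next
    case False
    have "fire n csA (count_list (unfold_word n bs @ [n + i])) (n - i) \<longleftrightarrow>
        fire n csA (count_list (unfold_word n bs)) (n - i)"
      by (rule fire_cong) (use False i in auto)
    then have "admissible n csA ((unfold_word n bs @ [n + i]) @ [n - i])"
      using snoc.IH[OF bs] F by (simp only: admissible_snoc)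
    then show ?thesis using False by simp
  qed
qed simp

lemma eta_admissible:
  "admissible n csB bs \<Longrightarrow> eta n (word_prod sB bs) = word_prod sA (unfold_word n bs)"
  using admissible_set csB eta_word_prod by blast

text \<open>Transferred from type A: \<open>eta\<close> is injective, and a word and its unfolding
  determine each other's counts.\<close>

lemma word_prod_sB_determined:
  assumes "admissible n csB us" "admissible n csB vs"
  shows "word_prod sB us = word_prod sB vs \<longleftrightarrow> count_list us = count_list vs"
proof -
  have set: "set us \<subseteq> JB n" "set vs \<subseteq> JB n" using admissible_set assms csB by blast+
  have "word_prod sB us = word_prod sB vs \<longleftrightarrow>
      eta n (word_prod sB us) = eta n (word_prod sB vs)"
    using eta_inj[OF word_prod_sB_mem[OF set(1)] word_prod_sB_mem[OF set(2)]] by auto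
  also have "\<dots> \<longleftrightarrow> count_list (unfold_word n us) = count_list (unfold_word n vs)"
    unfolding eta_admissible[OF assms(1)] eta_admissible[OF assms(2)]
    by (rule word_prod_determined[OF admissible_unfold[OF assms(1)] admissible_unfold[OF assms(2)]])
  also have "\<dots> \<longleftrightarrow> count_list us = count_list vs"
  proof
    assume eq: "count_list (unfold_word n us) = count_list (unfold_word n vs)"
    show "count_list us = count_list vs"
    proof
      fix i show "count_list us i = count_list vs i"
      proof (cases "i < n")
        case True
        then show ?thesis
          using count_list_unfold(1)[OF set(1)] count_list_unfold(1)[OF set(2)] eq by metis
      next
        case False
        then have "i \<notin> set us" "i \<notin> set vs" using set by (auto simp: JB_def)
        then show ?thesis by simp
      qed
    qed
  next
    assume eq: "count_list us = count_list vs"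
    show "count_list (unfold_word n us) = count_list (unfold_word n vs)"
    proof
      fix i show "count_list (unfold_word n us) i = count_list (unfold_word n vs) i"
      proof (cases "i \<in> {1..2 * n - 1}")
        case True
        then have "i = n + (i - n) \<and> i - n < n \<or> i = n - (n - i) \<and> n - i < n" by auto
        then show ?thesis
          using count_list_unfold[OF set(1)] count_list_unfold[OF set(2)] eq by metis
      next
        case False
        then have "i \<notin> set (unfold_word n us)" "i \<notin> set (unfold_word n vs)"
          using admissible_set_range admissible_unfold assms by blast+
        then show ?thesis by simp
      qed
    qed
  qed
  finally show ?thesis .
qed

sublocale A: sorted_heap sA "JA n" n csA wordA
  by unfold_locales
    (use csA admissible_wordA count_wordA reduced_wordA word_prod_wordA sA_commute word_prod_determined in \<open>auto simp: JA_def\<close>)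

sublocale B: sorted_heap sB "JB n" n csB wordB
  by unfold_locales
    (use csB admissible_wordB count_wordB reduced_wordB word_prod_wordB sB_commute word_prod_sB_determined in \<open>auto simp: JB_def\<close>)

section \<open>Heap coordinates on the affine hulls\<close>

lemma round_of_wordA: "x < length wordA \<Longrightarrow> wordA ! x \<in> {1..2 * n - 1} \<and> round_of wordA x < n"
  using round_of_less[of x "length wordA" wordA] count_wordA nth_mem[of x wordA] set_wordA by auto

lemma round_of_wordB: "y < length wordB \<Longrightarrow> wordB ! y < n \<and> round_of wordB y < n"
  using round_of_less[of y "length wordB" wordB] count_wordB nth_mem[of y wordB] set_wordB by (auto simp: JB_def)

text \<open>The explicit solution of the conditions that define \<open>Psi_A\<close>.\<close>

definition heap_coordsA :: "(nat \<times> nat \<Rightarrow> real) \<Rightarrow> nat \<Rightarrow> real" where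
  "heap_coordsA X = (\<lambda>x. if x < length wordA then coord X (wordA ! x) (round_of wordA x) else 0)"

lemma heap_coordsA_affine: "affine_map_on W heap_coordsA"
  unfolding affine_map_on_def
proof (intro ballI allI impI)
  fix X Y and u v :: real assume uv: "u + v = 1"
  have "coord (\<lambda>p. u * X p + v * Y p) (wordA ! x) k = u * coord X (wordA ! x) k + v * coord Y (wordA ! x) k"
    if "x < length wordA" for x k
    using round_of_wordA[OF that] by (intro coord_affine[OF uv]) auto
  then show "heap_coordsA (u *\<^sub>R X + v *\<^sub>R Y) = u *\<^sub>R heap_coordsA X + v *\<^sub>R heap_coordsA Y"
    unfolding combination_fun heap_coordsA_def by auto
qed

lemma heap_coordsA_singleton:
  assumes "w \<in> singletonsA n csA"
  shows "heap_coordsA (perm_matrix n w) = ideal_vector (fA n csA w)"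
proof -
  have "w \<in> singletons sA (JA n) wordA" using assms by (simp add: singletonsA_def sortA_eq)
  then obtain I where I: "order_ideal wordA I" "w = word_prod sA (nths wordA I)"
    "ideal_of sA (JA n) wordA w = I" by (rule A.singletonE)
  have X: "perm_matrix n w = matrix (\<lambda>i k. of_bool (k < count_list (nths wordA I) i))"
    unfolding I(2) by (rule perm_matrix_matrix[OF admissible_nths[OF I(1) admissible_wordA]])
  have "heap_coordsA (perm_matrix n w) x = ideal_vector I x" for x
  proof (cases "x < length wordA")
    case True
    then show ?thesis
      using round_of_wordA[OF True] ideal_mem_iff_round_of[OF I(1) True]
      by (simp add: heap_coordsA_def X coord_matrix ideal_vector_def)
  next
    case False
    then have "x \<notin> I" using I(1) by (auto simp: order_ideal_iff)
    then show ?thesis using False by (simp add: heap_coordsA_def ideal_vector_def)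
  qed
  then show ?thesis using I(3) by (auto simp: fA_def sortA_eq)
qed

lemma AffA_hull: "AffA n csA = affine hull (perm_matrix n ` singletonsA n csA)"
  unfolding AffA_def BirkA_def by (rule affine_hull_convex_hull)

lemma AffB_hull: "AffB n csB = affine hull ((\<lambda>v. perm_matrix n (eta n v)) ` singletonsB n csB)"
  unfolding AffB_def BirkB_def by (rule affine_hull_convex_hull)

text \<open>\<open>heap_coordsA\<close> witnesses that the choice in \<open>Psi_A\<close> is not
  empty; any chosen map agrees with it on the generators and hence on the affine hull.\<close>

lemma Psi_A_eq:
  assumes "X \<in> AffA n csA"
  shows "Psi_A n csA X = heap_coordsA X"
proof -
  have Psi: "affine_map_on (AffA n csA) (Psi_A n csA) \<and>
      (\<forall>w\<in>singletonsA n csA. Psi_A n csA (perm_matrix n w) = ideal_vector (fA n csA w))"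
    unfolding Psi_A_def by (rule someI[of _ heap_coordsA]) (use heap_coordsA_affine heap_coordsA_singleton in blast)
  show ?thesis
    by (rule affine_map_on_agree[of "perm_matrix n ` singletonsA n csA"])
      (use Psi heap_coordsA_affine heap_coordsA_singleton assms in \<open>auto simp: AffA_hull\<close>)
qed

lemma singletonB_cases:
  assumes "v \<in> singletonsB n csB"
  obtains I where "order_ideal wordB I" "v = word_prod sB (nths wordB I)" "fB n csB v = I"
proof -
  have "v \<in> singletons sB (JB n) wordB" using assms by (simp add: singletonsB_def sortB_eq)
  then show thesis by (rule B.singletonE) (use that in \<open>auto simp: fB_def sortB_eq\<close>)
qed

lemma ideal_singletonB:
  assumes "order_ideal wordB I"
  shows "word_prod sB (nths wordB I) \<in> singletonsB n csB" "fB n csB (word_prod sB (nths wordB I)) = I"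
  using B.ideal_singleton[OF assms] B.ideal_of_eq[OF assms]
  by (simp_all add: singletonsB_def fB_def sortB_eq)

lemma singletonsB_eq: "singletonsB n csB = (\<lambda>I. word_prod sB (nths wordB I)) ` {I. order_ideal wordB I}"
  by (auto elim: singletonB_cases intro: ideal_singletonB)

definition zvec :: "nat set \<Rightarrow> nat \<Rightarrow> nat \<Rightarrow> real" where
  "zvec I = (\<lambda>i k. of_bool (k < count_list (unfold_word n (nths wordB I)) i))"

lemma perm_matrix_ideal:
  assumes "order_ideal wordB I"
  shows "perm_matrix n (eta n (word_prod sB (nths wordB I))) = matrix (zvec I)"
proof -
  have "admissible n csB (nths wordB I)" by (rule admissible_nths[OF assms admissible_wordB])
  then show ?thesis
    unfolding zvec_def by (simp only: eta_admissible perm_matrix_matrix[OF admissible_unfold])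
qed

lemma zvec_values:
  assumes "order_ideal wordB I" "i < n"
  shows "zvec I (n + i) k = of_bool (k < count_list (nths wordB I) i)"
    and "zvec I (n - i) k = of_bool (k < count_list (nths wordB I) i)"
proof -
  have "set (nths wordB I) \<subseteq> JB n" using set_nths_subset[of wordB I] set_wordB by simp
  then show "zvec I (n + i) k = of_bool (k < count_list (nths wordB I) i)"
    "zvec I (n - i) k = of_bool (k < count_list (nths wordB I) i)"
    unfolding zvec_def using count_list_unfold assms(2) by simp_all
qed

text \<open>The unfolded word is admissible, so it has the counts and therefore the product of an
  ideal of \<open>wordA\<close>.\<close>

lemma eta_singleton:
  assumes "v \<in> singletonsB n csB"
  shows "eta n v \<in> singletonsA n csA"
proof -
  obtain I where I: "order_ideal wordB I" "v = word_prod sB (nths wordB I)"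
    using assms by (rule singletonB_cases)
  have a: "admissible n csB (nths wordB I)" by (rule admissible_nths[OF I(1) admissible_wordB])
  obtain I' where "order_ideal wordA I'" "word_prod sA (unfold_word n (nths wordB I)) = word_prod sA (nths wordA I')"
    using A.admissible_ideal[OF admissible_unfold[OF a]] by metis
  then show ?thesis
    using A.ideal_singleton eta_admissible[OF a] I(2) by (simp add: singletonsA_def sortA_eq)
qed

lemma AffB_subset: "AffB n csB \<subseteq> AffA n csA"
  unfolding AffA_hull AffB_hull by (rule hull_mono) (use eta_singleton in auto)

definition symmetric :: "(nat \<Rightarrow> nat \<Rightarrow> real) \<Rightarrow> bool" where
  "symmetric z \<longleftrightarrow> (\<forall>i<n. \<forall>k. z (n + i) k = z (n - i) k)"

text \<open>Symmetry of the parameters holds at the vertices and survives affine combinations. It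
  makes the coordinates with label below \<open>n\<close> copies of the others, so
  \<open>P_map\<close> loses no information here.\<close>

lemma AffB_matrix:
  assumes "X \<in> AffB n csB"
  obtains z where "symmetric z" "X = matrix z"
proof -
  let ?A = "{matrix z | z. symmetric z}"
  have "affine ?A"
    unfolding affine_def
  proof (intro ballI allI impI)
    fix X Y and u v :: real assume XY: "X \<in> ?A" "Y \<in> ?A" "u + v = 1"
    then obtain z z' where z: "symmetric z" "X = matrix z" "symmetric z'" "Y = matrix z'" by blast
    have "u *\<^sub>R X + v *\<^sub>R Y = matrix (\<lambda>i k. u * z i k + v * z' i k)"
      unfolding combination_fun matrix_affine[OF XY(3)] z ..
    moreover have "symmetric (\<lambda>i k. u * z i k + v * z' i k)"
      using z by (simp add: symmetric_def)
    ultimately show "u *\<^sub>R X + v *\<^sub>R Y \<in> ?A" by blast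
  qed
  moreover have "(\<lambda>v. perm_matrix n (eta n v)) ` singletonsB n csB \<subseteq> ?A"
  proof (intro image_subsetI)
    fix v assume "v \<in> singletonsB n csB"
    then obtain I where I: "order_ideal wordB I" "v = word_prod sB (nths wordB I)"
      by (rule singletonB_cases)
    have "symmetric (zvec I)" using zvec_values[OF I(1)] by (simp add: symmetric_def)
    then show "perm_matrix n (eta n v) \<in> ?A"
      using perm_matrix_ideal[OF I(1)] I(2) by blast
  qed
  ultimately have "AffB n csB \<subseteq> ?A"
    unfolding AffB_hull by (rule hull_minimal[rotated])
  then show thesis using assms that by blast
qed

lemma symmetric_cong:
  assumes "symmetric z" "symmetric z'" "\<And>i k. i < n \<Longrightarrow> k < n \<Longrightarrow> z (n - i) k = z' (n - i) k"
  shows "matrix z = matrix z'"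
proof (rule matrix_cong)
  fix i k assume ik: "1 \<le> i" "i \<le> 2 * n - 1" "k < n"
  show "z i k = z' i k"
  proof (cases "i \<le> n")
    case True
    then have "i = n - (n - i)" "n - i < n" using ik by auto
    then show ?thesis using assms(3) ik(3) by metis
  next
    case False
    then have "i = n + (i - n)" "i - n < n" using ik by auto
    then show ?thesis using assms ik(3) unfolding symmetric_def by metis
  qed
qed

text \<open>The rows up to \<open>n\<close> are recovered one after another: the entries of row
  \<open>i\<close> together with the known sums of the rows above give exactly the partial sums that
  \<open>coord\<close> uses. Symmetry supplies the parameters with label above
  \<open>n\<close>.\<close>

lemma Pi_inj: "inj_on (Pi_map n csA) (AffB n csB)"
proof (rule inj_onI)
  fix X Y assume XY: "X \<in> AffB n csB" "Y \<in> AffB n csB" "Pi_map n csA X = Pi_map n csA Y"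
  obtain z z' where z: "symmetric z" "X = matrix z" "symmetric z'" "Y = matrix z'"
    using AffB_matrix XY(1,2) by metis
  have rec: "X p = Y p" if p: "p \<in> set (recorded n csA)" for p
  proof -
    obtain l where "l < length (recorded n csA)" "recorded n csA ! l = p"
      using p by (auto simp: in_set_conv_nth)
    then show ?thesis using fun_cong[OF XY(3), of l] by (simp add: Pi_map_def)
  qed
  have "i \<le> n \<longrightarrow> (\<forall>k<n. z i k = z' i k)" if "1 \<le> i" for i
    using that
  proof (induction i rule: less_induct)
    case (less i)
    show ?case
    proof
      assume i: "i \<le> n"
      \<comment> \<open>For \<open>i = 1\<close> there is no row above, and the default of
        \<open>column_sum\<close> at 0 applies.\<close>
      have prev: "column_sum z (i - 1) j = column_sum z' (i - 1) j" for j
      proof (cases "i = 1")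
        case False
        then show ?thesis using less i by (intro column_sum_cong) auto
      qed (simp add: column_sum_def)
      have "row_sum X i (down_val i k) = row_sum Y i (down_val i k)" if k: "k < n" for k
      proof -
        have "X (i, down_val i k) = Y (i, down_val i k)"
          by (rule rec) (rule down_val_recorded[OF less.prems i k])
        then have "column_sum z i (down_val i k) = column_sum z' i (down_val i k)"
          using prev less.prems i by (simp add: z matrix_def)
        then show ?thesis using i by (simp add: z row_sum_matrix)
      qed
      then have coord: "coord X i k = coord Y i k" for k
      proof (induction k rule: coord_induct[where i = i])
        case (left k)
        then show ?case using less.prems by (simp add: coord_low)
      qed (use i less.prems n_pos in \<open>auto simp: coord_out\<close>)
      show "\<forall>k<n. z i k = z' i k"
      proof (intro allI impI)
        fix k assume "k < n"
        moreover have "i \<le> 2 * n - 1" using i n_pos by linarith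
        ultimately show "z i k = z' i k"
          using coord[of k] coord_matrix[OF less.prems, of _ k] unfolding z by simp
      qed
    qed
  qed
  then show "X = Y"
    unfolding z by (intro symmetric_cong z) auto
qed

definition heap_coordsB :: "(nat \<times> nat \<Rightarrow> real) \<Rightarrow> nat \<Rightarrow> real" where
  "heap_coordsB X = (\<lambda>y. if y < length wordB then coord X (n + wordB ! y) (round_of wordB y) else 0)"

text \<open>Label and occurrence identify a single element of \<open>wordA\<close>, so the sum in
  \<open>P_map\<close> has exactly one term.\<close>

lemma P_map_heap_coordsA: "P_map n csA csB (heap_coordsA X) = heap_coordsB X"
proof
  fix y
  show "P_map n csA csB (heap_coordsA X) y = heap_coordsB X y"
  proof (cases "y < length wordB")
    case True
    note r = round_of_wordB[OF True]
    obtain x where x: "x < length wordA" "wordA ! x = n + wordB ! y" "round_of wordA x = round_of wordB y"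
      using round_of_exists[of "round_of wordB y" wordA "n + wordB ! y"] count_wordA[of "n + wordB ! y"] r by auto
    have "{x'. x' < length wordA \<and> wordA ! x' = n + wordB ! y \<and> occurrence wordA x' = occurrence wordB y} = {x}"
    proof (intro equalityI subsetI)
      fix x' assume "x' \<in> {x'. x' < length wordA \<and> wordA ! x' = n + wordB ! y \<and> occurrence wordA x' = occurrence wordB y}"
      then have "x' < length wordA" "wordA ! x' = wordA ! x" "round_of wordA x' = round_of wordA x"
        using x True by (auto simp: occurrence_round_of)
      then show "x' \<in> {x}" using round_of_unique x(1) by blast
    qed (use x True in \<open>auto simp: occurrence_round_of\<close>)
    then show ?thesis
      unfolding P_map_def Let_def sortA_eq sortB_eq using True x by (simp add: heap_coordsA_def heap_coordsB_def)
  qed (simp add: P_map_def Let_def sortB_eq heap_coordsB_def)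
qed

text \<open>By injectivity the inverse inside \<open>U_map\<close> cancels the projection, and what
  remains is \<open>P_map\<close> applied to the explicit \<open>Psi_A\<close>.\<close>

lemma UPi_eq:
  assumes "X \<in> AffB n csB"
  shows "(U_map n csA csB \<circ> Pi_map n csA) X = heap_coordsB X"
  using assms AffB_subset Psi_A_eq[of X] the_inv_into_f_f[OF Pi_inj assms]
  by (auto simp: U_map_def P_map_heap_coordsA)

lemma heap_coordsB_matrix: "heap_coordsB (matrix z) = (\<lambda>y. if y < length wordB then z (n + wordB ! y) (round_of wordB y) else 0)"
proof
  fix y
  show "heap_coordsB (matrix z) y = (if y < length wordB then z (n + wordB ! y) (round_of wordB y) else 0)"
    using round_of_wordB[of y] n_pos by (auto simp: heap_coordsB_def coord_matrix)
qed

lemma heap_coordsB_singleton: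
  assumes "v \<in> singletonsB n csB"
  shows "heap_coordsB (perm_matrix n (eta n v)) = ideal_vector (fB n csB v)"
proof -
  obtain I where I: "order_ideal wordB I" "v = word_prod sB (nths wordB I)" "fB n csB v = I"
    using assms by (rule singletonB_cases)
  have "heap_coordsB (matrix (zvec I)) y = ideal_vector I y" for y
  proof (cases "y < length wordB")
    case True
    then show ?thesis
      using zvec_values(1)[OF I(1)] round_of_wordB[OF True] ideal_mem_iff_round_of[OF I(1) True]
      by (simp add: heap_coordsB_matrix ideal_vector_def)
  next
    case False
    then have "y \<notin> I" using I(1) by (auto simp: order_ideal_iff)
    then show ?thesis using False by (simp add: heap_coordsB_matrix ideal_vector_def)
  qed
  then show ?thesis using I perm_matrix_ideal[OF I(1)] by auto
qed

lemma heap_coordsB_affine: "affine_map_on W heap_coordsB"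
  unfolding affine_map_on_def
proof (intro ballI allI impI)
  fix X Y and u v :: real assume uv: "u + v = 1"
  have "coord (\<lambda>p. u * X p + v * Y p) (n + wordB ! y) k = u * coord X (n + wordB ! y) k + v * coord Y (n + wordB ! y) k"
    if "y < length wordB" for y k
    using round_of_wordB[OF that] n_pos by (intro coord_affine[OF uv]) auto
  then show "heap_coordsB (u *\<^sub>R X + v *\<^sub>R Y) = u *\<^sub>R heap_coordsB X + v *\<^sub>R heap_coordsB Y"
    unfolding combination_fun heap_coordsB_def by auto
qed

lemma heap_coordsB_coordinates:
  assumes "i < n" "k < n"
  obtains y where "y < length wordB" "\<And>z. heap_coordsB (matrix z) y = z (n + i) k"
proof -
  obtain y where "y < length wordB" "wordB ! y = i" "round_of wordB y = k"
    using round_of_exists[of k wordB i] count_wordB assms by auto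
  then show thesis using that[of y] by (simp add: heap_coordsB_matrix)
qed

text \<open>Integrality passes forward through \<open>coord\<close> and backward through
  \<open>matrix\<close>, both of which have integer coefficients; symmetry restores the coordinates
  that were dropped.\<close>

lemma heap_coordsB_unimodular: "unimodular_transformation (AffB n csB) heap_coordsB"
  unfolding unimodular_transformation_def
proof (intro conjI)
  show "affine (AffB n csB)" unfolding AffB_hull by (rule affine_affine_hull)
  show "affine_map_on (AffB n csB) heap_coordsB" by (rule heap_coordsB_affine)
  show inj: "inj_on heap_coordsB (AffB n csB)"
  proof (rule inj_onI)
    fix X Y assume XY: "X \<in> AffB n csB" "Y \<in> AffB n csB" "heap_coordsB X = heap_coordsB Y"
    obtain z z' where z: "symmetric z" "X = matrix z" "symmetric z'" "Y = matrix z'"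
      using AffB_matrix XY(1,2) by metis
    have "z (n + i) k = z' (n + i) k" if "i < n" "k < n" for i k
      using heap_coordsB_coordinates[OF that] XY(3) unfolding z by metis
    then show "X = Y"
      unfolding z using z by (intro symmetric_cong) (auto simp: symmetric_def)
  qed
  have "heap_coordsB X \<in> integer_points" if "X \<in> integer_points" for X
  proof -
    have "coord X (n + wordB ! y) k \<in> \<int>" if "y < length wordB" for y k
      using \<open>X \<in> integer_points\<close> round_of_wordB[OF that] n_pos by (intro coord_Ints) (auto simp: integer_points_def)
    then show ?thesis by (simp add: integer_points_def heap_coordsB_def)
  qed
  moreover have "X \<in> integer_points" if X: "X \<in> AffB n csB" "heap_coordsB X \<in> integer_points" for X
  proof -
    obtain z where z: "symmetric z" "X = matrix z" using X(1) by (rule AffB_matrix)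
    have int: "z (n + i) k \<in> \<int>" if "i < n" "k < n" for i k
      using heap_coordsB_coordinates[OF that] X(2) unfolding z integer_points_def by (metis mem_Collect_eq)
    have "z i k \<in> \<int>" if ik: "1 \<le> i" "i \<le> 2 * n - 1" "k < n" for i k
    proof (cases "i \<le> n")
      case True
      then have "i = n - (n - i)" "n - i < n" using ik by auto
      then have "z i k = z (n + (n - i)) k" using z(1) unfolding symmetric_def by metis
      then show ?thesis using int \<open>n - i < n\<close> ik(3) by simp
    next
      case False
      then have "i = n + (i - n)" "i - n < n" using ik by auto
      then show ?thesis using int ik(3) by metis
    qed
    then have "matrix z p \<in> \<int>" for p by (rule matrix_Ints)
    then show ?thesis by (simp add: z integer_points_def)
  qed
  ultimately have "heap_coordsB ` (AffB n csB \<inter> integer_points) = heap_coordsB ` AffB n csB \<inter> integer_points"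
    by blast
  then show "bij_betw heap_coordsB (AffB n csB \<inter> integer_points) (heap_coordsB ` AffB n csB \<inter> integer_points)"
    using inj_on_subset[OF inj] by (simp add: bij_betw_def)
qed

lemma heap_coordsB_BirkB: "heap_coordsB ` BirkB n csB = order_polytope wordB"
proof -
  have "heap_coordsB ` BirkB n csB = convex hull (heap_coordsB ` (\<lambda>v. perm_matrix n (eta n v)) ` singletonsB n csB)"
    unfolding BirkB_def by (rule affine_map_on_convex_hull[OF heap_coordsB_affine])
  also have "heap_coordsB ` (\<lambda>v. perm_matrix n (eta n v)) ` singletonsB n csB =
      (\<lambda>v. ideal_vector (fB n csB v)) ` singletonsB n csB"
    unfolding image_image using heap_coordsB_singleton by (intro image_cong) auto
  also have "\<dots> = {ideal_vector I | I. order_ideal wordB I}"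
    unfolding singletonsB_eq image_image using ideal_singletonB(2) by auto
  finally show ?thesis by (simp add: order_polytope_def)
qed

lemma BirkB_order_polytope: "integrally_equivalent (BirkB n csB) (order_polytope wordB)"
  unfolding integrally_equivalent_def
proof (intro conjI)
  have "finite (singletonsB n csB)"
    unfolding singletonsB_eq by (intro finite_imageI finite_ideals)
  then show "lattice_polytope (BirkB n csB)"
    unfolding lattice_polytope_def BirkB_def
    by (intro exI[of _ "(\<lambda>v. perm_matrix n (eta n v)) ` singletonsB n csB"])
      (auto simp: integer_points_def perm_matrix_def)
  have "{ideal_vector I | I. order_ideal wordB I} = ideal_vector ` {I. order_ideal wordB I}" by auto
  then show "lattice_polytope (order_polytope wordB)"
    unfolding lattice_polytope_def order_polytope_def using finite_ideals[of wordB]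
    by (intro exI[of _ "{ideal_vector I | I. order_ideal wordB I}"])
      (auto simp: integer_points_def ideal_vector_def)
  show "\<exists>T. unimodular_transformation (affine hull BirkB n csB) T \<and> T ` BirkB n csB = order_polytope wordB"
    using heap_coordsB_unimodular heap_coordsB_BirkB unfolding AffB_def by blast
qed

text \<open>Every clause of unimodularity evaluates the map only at points of
  \<open>AffB n csB\<close>, where it equals \<open>heap_coordsB\<close>; for affinity this needs
  that affine combinations stay in that space.\<close>

lemma UPi_unimodular: "unimodular_transformation (AffB n csB) (U_map n csA csB \<circ> Pi_map n csA)"
proof -
  have eq: "(U_map n csA csB \<circ> Pi_map n csA) ` W = heap_coordsB ` W" if "W \<subseteq> AffB n csB" for W
    using that UPi_eq by (intro image_cong) auto
  have aff: "u *\<^sub>R X + v *\<^sub>R Y \<in> AffB n csB" if "X \<in> AffB n csB" "Y \<in> AffB n csB" "u + v = 1" for u v X Y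
    using heap_coordsB_unimodular that unfolding unimodular_transformation_def affine_def by blast
  show ?thesis
    using heap_coordsB_unimodular aff
    unfolding unimodular_transformation_def affine_map_on_def bij_betw_def inj_on_def eq[OF order_refl]
      eq[OF Int_lower1]
    by (simp add: UPi_eq del: comp_apply)
qed

end

theorem theorem3p16:
  fixes n :: nat and cB :: "int \<Rightarrow> int" and csA csB :: "nat list"
  assumes "n \<ge> 1"
    and "coxeter_element sB (JB n) cB"
    and "reduced_word sB (JB n) csB cB"
    and "reduced_word sA (JA n) csA (eta n cB)"
  shows "unimodular_transformation (AffB n csB) (U_map n csA csB \<circ> Pi_map n csA) \<and>
         (U_map n csA csB \<circ> Pi_map n csA) ` AffB n csB
           \<subseteq> coord_space {..<length (sortB n csB)} \<and>
         length (sortB n csB) = n ^ 2 \<and>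
         (\<forall>v\<in>singletonsB n csB.
            (U_map n csA csB \<circ> Pi_map n csA) (perm_matrix n (eta n v))
              = ideal_vector (fB n csB v)) \<and>
         integrally_equivalent (BirkB n csB) (order_polytope (sortB n csB))"
proof -
  interpret coxeter_pair n csA csB cB
    using assms by unfold_locales
  have "perm_matrix n (eta n v) \<in> AffB n csB" if "v \<in> singletonsB n csB" for v
    unfolding AffB_hull using that by (intro hull_inc) blast
  then have "\<forall>v\<in>singletonsB n csB. (U_map n csA csB \<circ> Pi_map n csA) (perm_matrix n (eta n v))
      = ideal_vector (fB n csB v)"
    using UPi_eq heap_coordsB_singleton by metis
  moreover have "(U_map n csA csB \<circ> Pi_map n csA) ` AffB n csB \<subseteq> coord_space {..<length wordB}"
    using UPi_eq by (auto simp: coord_space_def heap_coordsB_def simp del: comp_apply)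
  ultimately show ?thesis
    unfolding sortB_eq using UPi_unimodular length_wordB BirkB_order_polytope by blast
qed

end
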